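(* Let $k$ be an algebraically closed field and let $\phi:X\rightarrow Y$ be a finite dominant morphism of affine varieties over $k$. Assume $Y$ is normal. Let $W$ be an irreducible closed subvariety of $Y$, and let $Z$ be an irreducible component of $\phi^{-1}(W)$. Then $\phi(Z)=W$, and $\dim(Z)=\dim(W)$.
   Context: Varieties are over an algebraically closed field $k$ and are irreducible by definition: an algebraic set is a variety if it is irreducible. A morphism $\phi:X\to Y$ of affine varieties is finite if the coordinate ring $k[X]$ is a finite module over $k[Y]$ via the induced homomorphism $k[Y]\to k[X]$, and dominant if its image is dense in $Y$. An affine variety $Y$ is normal if $k[Y]$ is integrally closed in its fraction field. *)

theory Defs
  imports
    "HOL-Library.Poly_Mapping"
    "HOL-Library.Extended_Nat"
    "HOL-Computational_Algebra.Polynomial"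
    "HOL-Analysis.Abstract_Topology"
    "HOL-Algebra.Polynomials"
begin

definition finite_ring_hom ::
  "('a, 'c) ring_scheme \<Rightarrow> ('b, 'd) ring_scheme \<Rightarrow> ('a \<Rightarrow> 'b) \<Rightarrow> bool" where
  "finite_ring_hom A B h \<longleftrightarrow> h \<in> ring_hom A B \<and>
    (\<exists>G. finite G \<and> G \<subseteq> carrier B \<and>
      (\<forall>b\<in>carrier B. \<exists>c\<in>G \<rightarrow> carrier A. b = (\<Oplus>\<^bsub>B\<^esub>g\<in>G. h (c g) \<otimes>\<^bsub>B\<^esub> g)))"

text \<open>Polynomials over a ring are coefficient lists with the leading coefficient first.\<close>

definition integral_over :: "('a, 'c) ring_scheme \<Rightarrow> 'a set \<Rightarrow> 'a \<Rightarrow> bool" where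
  "integral_over R S x \<longleftrightarrow>
    (\<exists>p. polynomial\<^bsub>R\<^esub> S p \<and> p \<noteq> [] \<and> hd p = \<one>\<^bsub>R\<^esub> \<and> ring.eval R p x = \<zero>\<^bsub>R\<^esub>)"

definition fraction_rel :: "('a, 'c) ring_scheme \<Rightarrow> (('a \<times> 'a) \<times> ('a \<times> 'a)) set" where
  "fraction_rel R = {((a, b), (c, d)).
     a \<in> carrier R \<and> b \<in> carrier R - {\<zero>\<^bsub>R\<^esub>} \<and> c \<in> carrier R \<and> d \<in> carrier R - {\<zero>\<^bsub>R\<^esub>} \<and>
     a \<otimes>\<^bsub>R\<^esub> d = c \<otimes>\<^bsub>R\<^esub> b}"

definition fraction :: "('a, 'c) ring_scheme \<Rightarrow> 'a \<Rightarrow> 'a \<Rightarrow> ('a \<times> 'a) set" where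
  "fraction R a b = fraction_rel R `` {(a, b)}"

text \<open>
  The operations are defined on representatives; for an integral domain all sets in the unions
  coincide (see \<open>fraction_mult\<close> and \<open>fraction_add\<close> below).
\<close>

definition fraction_field :: "('a, 'c) ring_scheme \<Rightarrow> ('a \<times> 'a) set ring" where
  "fraction_field R =
    \<lparr>carrier = {fraction R a b | a b. a \<in> carrier R \<and> b \<in> carrier R - {\<zero>\<^bsub>R\<^esub>}},
     mult = (\<lambda>u v. \<Union>(a, b)\<in>u. \<Union>(c, d)\<in>v. fraction R (a \<otimes>\<^bsub>R\<^esub> c) (b \<otimes>\<^bsub>R\<^esub> d)),
     one = fraction R \<one>\<^bsub>R\<^esub> \<one>\<^bsub>R\<^esub>,
     zero = fraction R \<zero>\<^bsub>R\<^esub> \<one>\<^bsub>R\<^esub>,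
     add = (\<lambda>u v. \<Union>(a, b)\<in>u. \<Union>(c, d)\<in>v.
              fraction R (a \<otimes>\<^bsub>R\<^esub> d \<oplus>\<^bsub>R\<^esub> c \<otimes>\<^bsub>R\<^esub> b) (b \<otimes>\<^bsub>R\<^esub> d))\<rparr>"

definition integrally_closed :: "('a, 'c) ring_scheme \<Rightarrow> bool" where
  "integrally_closed R \<longleftrightarrow>
    (let \<iota> = (\<lambda>a. fraction R a \<one>\<^bsub>R\<^esub>) in
      \<forall>x\<in>carrier (fraction_field R).
        integral_over (fraction_field R) (\<iota> ` carrier R) x \<longrightarrow> x \<in> \<iota> ` carrier R)"

context domain
begin

lemma fraction_rel_trans:
  assumes "a \<in> carrier R" "b \<in> carrier R" "c \<in> carrier R" "d \<in> carrier R" "d \<noteq> \<zero>"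
    "e \<in> carrier R" "f \<in> carrier R"
    and 1: "a \<otimes> d = c \<otimes> b" and 2: "c \<otimes> f = e \<otimes> d"
  shows "a \<otimes> f = e \<otimes> b"
proof -
  note cl = assms(1-4,6,7)
  have "d \<otimes> (a \<otimes> f) = (a \<otimes> d) \<otimes> f" using cl by (simp add: m_ac)
  also have "\<dots> = (c \<otimes> b) \<otimes> f" by (simp only: 1)
  also have "\<dots> = (c \<otimes> f) \<otimes> b" using cl by (simp add: m_ac)
  also have "\<dots> = (e \<otimes> d) \<otimes> b" by (simp only: 2)
  also have "\<dots> = d \<otimes> (e \<otimes> b)" using cl by (simp add: m_ac)
  finally show ?thesis using assms(1-7) m_lcancel by simp
qed

lemma equiv_fraction_rel: "equiv (carrier R \<times> (carrier R - {\<zero>})) (fraction_rel R)"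
proof (rule equivI)
  show "fraction_rel R \<subseteq> (carrier R \<times> (carrier R - {\<zero>})) \<times> (carrier R \<times> (carrier R - {\<zero>}))"
    by (auto simp: fraction_rel_def)
  show "refl_on (carrier R \<times> (carrier R - {\<zero>})) (fraction_rel R)"
    by (auto simp: refl_on_def fraction_rel_def)
  show "sym (fraction_rel R)"
    by (auto simp: sym_def fraction_rel_def)
  show "trans (fraction_rel R)"
    by (rule transI) (auto simp: fraction_rel_def intro: fraction_rel_trans)
qed

lemma fraction_eq_iff:
  assumes "a \<in> carrier R" "b \<in> carrier R - {\<zero>}" "c \<in> carrier R" "d \<in> carrier R - {\<zero>}"
  shows "fraction R a b = fraction R c d \<longleftrightarrow> a \<otimes> d = c \<otimes> b"
  using assms eq_equiv_class_iff[OF equiv_fraction_rel, of "(a, b)" "(c, d)"]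
  by (simp add: fraction_def fraction_rel_def)

lemma UN_fraction:
  assumes "a \<in> carrier R" "b \<in> carrier R - {\<zero>}"
    and "\<And>a' b'. a' \<in> carrier R \<Longrightarrow> b' \<in> carrier R - {\<zero>} \<Longrightarrow> a \<otimes> b' = a' \<otimes> b \<Longrightarrow> g a' b' = g a b"
  shows "(\<Union>(a', b')\<in>fraction R a b. g a' b') = g a b"
proof -
  have "(a, b) \<in> fraction R a b"
    using assms(1,2) by (simp add: fraction_def fraction_rel_def)
  moreover have "g a' b' = g a b" if "(a', b') \<in> fraction R a b" for a' b'
    by (rule assms(3)) (use that in \<open>simp_all add: fraction_def fraction_rel_def\<close>)
  ultimately show ?thesis by fast
qed

lemma fraction_mult:
  assumes "a \<in> carrier R" "b \<in> carrier R - {\<zero>}" "c \<in> carrier R" "d \<in> carrier R - {\<zero>}"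
  shows "fraction R a b \<otimes>\<^bsub>fraction_field R\<^esub> fraction R c d = fraction R (a \<otimes> c) (b \<otimes> d)"
proof -
  have *: "fraction R (a' \<otimes> c') (b' \<otimes> d') = fraction R (a \<otimes> c) (b \<otimes> d)"
    if "a' \<in> carrier R" "b' \<in> carrier R - {\<zero>}" "a \<otimes> b' = a' \<otimes> b"
       "c' \<in> carrier R" "d' \<in> carrier R - {\<zero>}" "c \<otimes> d' = c' \<otimes> d" for a' b' c' d'
  proof -
    have cl: "a \<in> carrier R" "b \<in> carrier R" "c \<in> carrier R" "d \<in> carrier R"
      "a' \<in> carrier R" "b' \<in> carrier R" "c' \<in> carrier R" "d' \<in> carrier R"
      using assms that(1,2,4,5) by simp_all
    have "(a' \<otimes> c') \<otimes> (b \<otimes> d) = (a' \<otimes> b) \<otimes> (c' \<otimes> d)" using cl by (simp add: m_ac)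
    also have "\<dots> = (a \<otimes> b') \<otimes> (c \<otimes> d')" by (simp only: that)
    also have "\<dots> = (a \<otimes> c) \<otimes> (b' \<otimes> d')" using cl by (simp add: m_ac)
    finally have eq: "(a' \<otimes> c') \<otimes> (b \<otimes> d) = (a \<otimes> c) \<otimes> (b' \<otimes> d')" .
    have nz: "b \<otimes> d \<in> carrier R - {\<zero>}" "b' \<otimes> d' \<in> carrier R - {\<zero>}"
      using assms(2,4) that(2,5) by (simp_all add: integral_iff)
    show ?thesis
      by (rule fraction_eq_iff[THEN iffD2, OF _ nz(2) _ nz(1) eq]) (simp_all add: cl)
  qed
  have inner: "(\<Union>(c', d')\<in>fraction R c d. fraction R (a' \<otimes> c') (b' \<otimes> d')) = fraction R (a \<otimes> c) (b \<otimes> d)"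
    if ab: "a' \<in> carrier R" "b' \<in> carrier R - {\<zero>}" "a \<otimes> b' = a' \<otimes> b" for a' b'
  proof -
    have "(\<Union>(c', d')\<in>fraction R c d. fraction R (a' \<otimes> c') (b' \<otimes> d')) = fraction R (a' \<otimes> c) (b' \<otimes> d)"
      by (rule UN_fraction[OF assms(3,4)]) (simp only: *[OF ab] *[OF ab assms(3,4) refl])
    then show ?thesis by (simp only: *[OF ab assms(3,4) refl])
  qed
  have "(\<Union>(a', b')\<in>fraction R a b. \<Union>(c', d')\<in>fraction R c d. fraction R (a' \<otimes> c') (b' \<otimes> d')) =
      (\<Union>(c', d')\<in>fraction R c d. fraction R (a \<otimes> c') (b \<otimes> d'))"
    by (rule UN_fraction[OF assms(1,2)]) (simp only: inner inner[OF assms(1,2) refl])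
  then show ?thesis
    unfolding inner[OF assms(1,2) refl] by (simp only: fraction_field_def monoid.select_convs ring.select_convs)
qed

lemma fraction_add:
  assumes "a \<in> carrier R" "b \<in> carrier R - {\<zero>}" "c \<in> carrier R" "d \<in> carrier R - {\<zero>}"
  shows "fraction R a b \<oplus>\<^bsub>fraction_field R\<^esub> fraction R c d =
    fraction R (a \<otimes> d \<oplus> c \<otimes> b) (b \<otimes> d)"
proof -
  have *: "fraction R (a' \<otimes> d' \<oplus> c' \<otimes> b') (b' \<otimes> d') = fraction R (a \<otimes> d \<oplus> c \<otimes> b) (b \<otimes> d)"
    if "a' \<in> carrier R" "b' \<in> carrier R - {\<zero>}" "a \<otimes> b' = a' \<otimes> b"
       "c' \<in> carrier R" "d' \<in> carrier R - {\<zero>}" "c \<otimes> d' = c' \<otimes> d" for a' b' c' d'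
  proof -
    have cl: "a \<in> carrier R" "b \<in> carrier R" "c \<in> carrier R" "d \<in> carrier R"
      "a' \<in> carrier R" "b' \<in> carrier R" "c' \<in> carrier R" "d' \<in> carrier R"
      using assms that(1,2,4,5) by simp_all
    have 1: "(a' \<otimes> d') \<otimes> (b \<otimes> d) = (a' \<otimes> b) \<otimes> (d \<otimes> d')"
      and 2: "(c' \<otimes> b') \<otimes> (b \<otimes> d) = (c' \<otimes> d) \<otimes> (b \<otimes> b')"
      and 3: "(a \<otimes> d) \<otimes> (b' \<otimes> d') = (a \<otimes> b') \<otimes> (d \<otimes> d')"
      and 4: "(c \<otimes> b) \<otimes> (b' \<otimes> d') = (c \<otimes> d') \<otimes> (b \<otimes> b')"
      using cl by (simp_all add: m_ac)
    have eq: "(a' \<otimes> d' \<oplus> c' \<otimes> b') \<otimes> (b \<otimes> d) = (a \<otimes> d \<oplus> c \<otimes> b) \<otimes> (b' \<otimes> d')"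
      by (simp only: l_distr m_closed cl 1 2 3 4 that(3,6))
    have nz: "b \<otimes> d \<in> carrier R - {\<zero>}" "b' \<otimes> d' \<in> carrier R - {\<zero>}"
      using assms(2,4) that(2,5) by (simp_all add: integral_iff)
    show ?thesis
      by (rule fraction_eq_iff[THEN iffD2, OF _ nz(2) _ nz(1) eq]) (simp_all add: cl)
  qed
  have inner: "(\<Union>(c', d')\<in>fraction R c d. fraction R (a' \<otimes> d' \<oplus> c' \<otimes> b') (b' \<otimes> d')) = fraction R (a \<otimes> d \<oplus> c \<otimes> b) (b \<otimes> d)"
    if ab: "a' \<in> carrier R" "b' \<in> carrier R - {\<zero>}" "a \<otimes> b' = a' \<otimes> b" for a' b'
  proof -
    have "(\<Union>(c', d')\<in>fraction R c d. fraction R (a' \<otimes> d' \<oplus> c' \<otimes> b') (b' \<otimes> d')) = fraction R (a' \<otimes> d \<oplus> c \<otimes> b') (b' \<otimes> d)"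
      by (rule UN_fraction[OF assms(3,4)]) (simp only: *[OF ab] *[OF ab assms(3,4) refl])
    then show ?thesis by (simp only: *[OF ab assms(3,4) refl])
  qed
  have "(\<Union>(a', b')\<in>fraction R a b. \<Union>(c', d')\<in>fraction R c d. fraction R (a' \<otimes> d' \<oplus> c' \<otimes> b') (b' \<otimes> d')) =
      (\<Union>(c', d')\<in>fraction R c d. fraction R (a \<otimes> d' \<oplus> c' \<otimes> b) (b \<otimes> d'))"
    by (rule UN_fraction[OF assms(1,2)]) (simp only: inner inner[OF assms(1,2) refl])
  then show ?thesis
    unfolding inner[OF assms(1,2) refl] by (simp only: fraction_field_def monoid.select_convs ring.select_convs)
qed

end

definition irreducible_space :: "'a topology \<Rightarrow> bool" where
  "irreducible_space T \<longleftrightarrow> topspace T \<noteq> {} \<and>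
    (\<forall>A B. closedin T A \<and> closedin T B \<and> A \<union> B = topspace T \<longrightarrow> A = topspace T \<or> B = topspace T)"

definition irreducible_component :: "'a topology \<Rightarrow> 'a set \<Rightarrow> bool" where
  "irreducible_component T C \<longleftrightarrow>
    C \<subseteq> topspace T \<and> irreducible_space (subtopology T C) \<and>
    (\<forall>D. C \<subseteq> D \<and> D \<subseteq> topspace T \<and> irreducible_space (subtopology T D) \<longrightarrow> D = C)"

definition krull_dim :: "'a topology \<Rightarrow> enat" where
  "krull_dim T = Sup {enat r | r. \<exists>C :: nat \<Rightarrow> 'a set.
     (\<forall>i\<le>r. closedin T (C i) \<and> irreducible_space (subtopology T (C i))) \<and>
     (\<forall>i<r. C i \<subset> C (Suc i))}"

text \<open>A monomial is a finitely supported exponent vector, a polynomial a finitely supported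
  family of coefficients indexed by monomials.\<close>

type_synonym 'k mpoly = "(nat \<Rightarrow>\<^sub>0 nat) \<Rightarrow>\<^sub>0 'k"

definition mpolys :: "nat \<Rightarrow> 'k::zero mpoly set" where
  "mpolys n = {p. \<forall>m\<in>Poly_Mapping.keys p. Poly_Mapping.keys m \<subseteq> {..<n}}"

definition mono_eval :: "(nat \<Rightarrow> 'k) \<Rightarrow> (nat \<Rightarrow>\<^sub>0 nat) \<Rightarrow> 'k::comm_semiring_1" where
  "mono_eval x m = (\<Prod>i\<in>Poly_Mapping.keys m. x i ^ Poly_Mapping.lookup m i)"

definition mpoly_eval :: "(nat \<Rightarrow> 'k) \<Rightarrow> 'k mpoly \<Rightarrow> 'k::comm_semiring_1" where
  "mpoly_eval x p = (\<Sum>m\<in>Poly_Mapping.keys p. Poly_Mapping.lookup p m * mono_eval x m)"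

definition affine_space :: "nat \<Rightarrow> (nat \<Rightarrow> 'k) set" where
  "affine_space n = {..<n} \<rightarrow>\<^sub>E UNIV"

definition zero_locus :: "nat \<Rightarrow> 'k mpoly set \<Rightarrow> (nat \<Rightarrow> 'k::comm_semiring_1) set" where
  "zero_locus n S = {x\<in>affine_space n. \<forall>p\<in>S. mpoly_eval x p = 0}"

definition zariski :: "nat \<Rightarrow> (nat \<Rightarrow> 'k::field) topology" where
  "zariski n = topology (\<lambda>U. \<exists>S\<subseteq>mpolys n. U = affine_space n - zero_locus n S)"

lemma mono_eval_superset:
  assumes "finite I" "Poly_Mapping.keys m \<subseteq> I"
  shows "mono_eval x m = (\<Prod>i\<in>I. x i ^ Poly_Mapping.lookup m i)"
  unfolding mono_eval_def using assms
  by (intro prod.mono_neutral_left) (auto simp: in_keys_iff)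

lemma mono_eval_add: "mono_eval x (m + m') = mono_eval x m * mono_eval x m'"
proof -
  let ?I = "Poly_Mapping.keys m \<union> Poly_Mapping.keys m'"
  have "Poly_Mapping.keys (m + m') \<subseteq> ?I" by (rule Poly_Mapping.keys_add)
  then show ?thesis
    by (simp add: mono_eval_superset[of ?I] lookup_add power_add prod.distrib)
qed

lemma mpoly_eval_superset:
  assumes "finite M" "Poly_Mapping.keys p \<subseteq> M"
  shows "mpoly_eval x p = (\<Sum>m\<in>M. Poly_Mapping.lookup p m * mono_eval x m)"
  unfolding mpoly_eval_def using assms
  by (intro sum.mono_neutral_left) (auto simp: in_keys_iff)

lemma mpoly_eval_0 [simp]: "mpoly_eval x 0 = 0"
  by (simp add: mpoly_eval_def)

lemma mpoly_eval_single [simp]: "mpoly_eval x (Poly_Mapping.single m c) = c * mono_eval x m"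
  by (subst mpoly_eval_superset[of "{m}"]) auto

lemma mpoly_eval_1 [simp]: "mpoly_eval x 1 = 1"
  using mpoly_eval_single[of x 0 1] by (simp add: mono_eval_def)

lemma mpoly_eval_add: "mpoly_eval x (p + q) = mpoly_eval x p + mpoly_eval x q"
proof -
  let ?M = "Poly_Mapping.keys p \<union> Poly_Mapping.keys q"
  have "Poly_Mapping.keys (p + q) \<subseteq> ?M" by (rule Poly_Mapping.keys_add)
  then show ?thesis
    by (simp add: mpoly_eval_superset[of ?M] lookup_add sum.distrib distrib_right)
qed

lemma mpoly_eval_sum: "mpoly_eval x (\<Sum>i\<in>I. p i) = (\<Sum>i\<in>I. mpoly_eval x (p i))"
  by (induction I rule: infinite_finite_induct) (auto simp: mpoly_eval_add)

lemma mpoly_expand: "p = (\<Sum>m\<in>Poly_Mapping.keys p. Poly_Mapping.single m (Poly_Mapping.lookup p m))"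
proof (rule poly_mapping_eqI)
  fix k
  show "Poly_Mapping.lookup p k = Poly_Mapping.lookup (\<Sum>m\<in>Poly_Mapping.keys p. Poly_Mapping.single m (Poly_Mapping.lookup p m)) k"
    by (auto simp: lookup_sum lookup_single when_def in_keys_iff)
qed

lemma mpoly_eval_mult: "mpoly_eval x (p * q) = mpoly_eval x p * mpoly_eval x q"
proof -
  have "p * q = (\<Sum>m\<in>Poly_Mapping.keys p. \<Sum>m'\<in>Poly_Mapping.keys q.
      Poly_Mapping.single (m + m') (Poly_Mapping.lookup p m * Poly_Mapping.lookup q m'))"
    by (subst mpoly_expand[of p], subst mpoly_expand[of q]) (simp add: sum_product mult_single)
  then have "mpoly_eval x (p * q) = (\<Sum>m\<in>Poly_Mapping.keys p. \<Sum>m'\<in>Poly_Mapping.keys q.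
      Poly_Mapping.lookup p m * Poly_Mapping.lookup q m' * (mono_eval x m * mono_eval x m'))"
    by (simp only: mpoly_eval_sum mpoly_eval_single mono_eval_add)
  also have "\<dots> = mpoly_eval x p * mpoly_eval x q"
    unfolding mpoly_eval_def sum_product by (intro sum.cong refl) (simp only: ac_simps)
  finally show ?thesis .
qed

lemma mpolys_mult:
  assumes "p \<in> mpolys n" "q \<in> mpolys n"
  shows "p * q \<in> mpolys n"
  unfolding mpolys_def
proof (intro CollectI ballI)
  fix k assume "k \<in> Poly_Mapping.keys (p * q)"
  then obtain a b where k: "k = a + b" "a \<in> Poly_Mapping.keys p" "b \<in> Poly_Mapping.keys q"
    using keys_mult[of p q] by blast
  have "Poly_Mapping.keys a \<subseteq> {..<n}" "Poly_Mapping.keys b \<subseteq> {..<n}"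
    using k assms by (simp_all add: mpolys_def)
  then show "Poly_Mapping.keys k \<subseteq> {..<n}"
    using Poly_Mapping.keys_add[of a b] unfolding k(1) by blast
qed

lemma istopology_zariski:
  "istopology (\<lambda>U :: (nat \<Rightarrow> 'k::field) set. \<exists>S\<subseteq>mpolys n. U = affine_space n - zero_locus n S)"
  unfolding istopology_def
proof (intro conjI allI impI)
  fix U V :: "(nat \<Rightarrow> 'k) set"
  assume "\<exists>S\<subseteq>mpolys n. U = affine_space n - zero_locus n S"
    and "\<exists>S\<subseteq>mpolys n. V = affine_space n - zero_locus n S"
  then obtain S T where ST: "S \<subseteq> mpolys n" "T \<subseteq> mpolys n"
    "U = affine_space n - zero_locus n S" "V = affine_space n - zero_locus n T" by blast
  let ?ST = "{p * q | p q. p \<in> S \<and> q \<in> T}"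
  have "?ST \<subseteq> mpolys n" using ST mpolys_mult by blast
  moreover have "zero_locus n ?ST = zero_locus n S \<union> zero_locus n T"
  proof (intro subset_antisym subsetI)
    fix x assume x: "x \<in> zero_locus n ?ST"
    have "mpoly_eval x p = 0 \<or> mpoly_eval x q = 0" if "p \<in> S" "q \<in> T" for p q
    proof -
      have "mpoly_eval x (p * q) = 0" using x that unfolding zero_locus_def by blast
      then show ?thesis by (simp add: mpoly_eval_mult)
    qed
    with x show "x \<in> zero_locus n S \<union> zero_locus n T" unfolding zero_locus_def by blast
  qed (auto simp: zero_locus_def mpoly_eval_mult)
  then have "U \<inter> V = affine_space n - zero_locus n ?ST" unfolding ST(3,4) by blast
  ultimately show "\<exists>S\<subseteq>mpolys n. U \<inter> V = affine_space n - zero_locus n S"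
    by (intro exI[of _ ?ST] conjI)
next
  fix \<U> :: "(nat \<Rightarrow> 'k) set set"
  assume *: "\<forall>U\<in>\<U>. \<exists>S\<subseteq>mpolys n. U = affine_space n - zero_locus n S"
  let ?S = "\<Union>{S. S \<subseteq> mpolys n \<and> affine_space n - zero_locus n S \<in> \<U>}"
  have "\<Union>\<U> = affine_space n - zero_locus n ?S"
  proof (intro subset_antisym subsetI)
    fix x assume "x \<in> \<Union>\<U>"
    then obtain U where U: "U \<in> \<U>" "x \<in> U" by blast
    with * obtain S where S: "S \<subseteq> mpolys n" "U = affine_space n - zero_locus n S" by blast
    with U have "x \<in> affine_space n" "S \<subseteq> ?S" by blast+
    moreover from this U(2) S(2) have "x \<notin> zero_locus n ?S"
      unfolding zero_locus_def by blast
    ultimately show "x \<in> affine_space n - zero_locus n ?S" by (intro DiffI)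
  next
    fix x assume x: "x \<in> affine_space n - zero_locus n ?S"
    then obtain p where "p \<in> ?S" "mpoly_eval x p \<noteq> 0"
      unfolding zero_locus_def by blast
    then obtain S where "p \<in> S" "affine_space n - zero_locus n S \<in> \<U>" "mpoly_eval x p \<noteq> 0"
      by blast
    moreover from this x have "x \<in> affine_space n - zero_locus n S"
      unfolding zero_locus_def by blast
    ultimately show "x \<in> \<Union>\<U>" by (intro UnionI)
  qed
  moreover have "?S \<subseteq> mpolys n" by blast
  ultimately show "\<exists>S\<subseteq>mpolys n. \<Union>\<U> = affine_space n - zero_locus n S"
    by (intro exI[of _ ?S] conjI)
qed

lemma openin_zariski:
  "openin (zariski n) U \<longleftrightarrow> (\<exists>S\<subseteq>mpolys n. U = affine_space n - zero_locus n S)"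
  unfolding zariski_def by (simp add: istopology_zariski)

lemma topspace_zariski [simp]: "topspace (zariski n) = (affine_space n :: (nat \<Rightarrow> 'k::field) set)"
proof -
  have "zero_locus n {1 :: 'k mpoly} = {}" by (auto simp: zero_locus_def)
  moreover have "{1 :: 'k mpoly} \<subseteq> mpolys n" by (auto simp: mpolys_def)
  ultimately have "openin (zariski n) (affine_space n :: (nat \<Rightarrow> 'k) set)"
    unfolding openin_zariski by (intro exI[of _ "{1}"]) auto
  then show ?thesis
    by (auto simp: topspace_def openin_zariski)
qed

lemma closedin_zariski: "closedin (zariski n) V \<longleftrightarrow> (\<exists>S\<subseteq>mpolys n. V = zero_locus n S)"
proof -
  have "zero_locus n S \<subseteq> affine_space n" for S :: "'a mpoly set"
    by (auto simp: zero_locus_def)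
  then have *: "V = zero_locus n S \<longleftrightarrow>
      V \<subseteq> affine_space n \<and> affine_space n - V = affine_space n - zero_locus n S" for S
    by blast
  show ?thesis
    unfolding closedin_def openin_zariski topspace_zariski *
    by (rule iffI; elim exE conjE; intro exI conjI; assumption)
qed

definition affine_variety :: "nat \<Rightarrow> (nat \<Rightarrow> 'k::field) set \<Rightarrow> bool" where
  "affine_variety n V \<longleftrightarrow> closedin (zariski n) V \<and> irreducible_space (subtopology (zariski n) V)"

text \<open>\<open>k[V]\<close> as the ring of functions on \<open>V\<close> given by polynomials, that is, polynomials
  modulo those vanishing on \<open>V\<close>.\<close>

definition coord_ring :: "nat \<Rightarrow> (nat \<Rightarrow> 'k::field) set \<Rightarrow> ((nat \<Rightarrow> 'k) \<Rightarrow> 'k) ring" where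
  "coord_ring n V =
    \<lparr>carrier = {\<lambda>x\<in>V. mpoly_eval x p | p. p \<in> mpolys n},
     mult = (\<lambda>f g. \<lambda>x\<in>V. f x * g x),
     one = (\<lambda>x\<in>V. 1),
     zero = (\<lambda>x\<in>V. 0),
     add = (\<lambda>f g. \<lambda>x\<in>V. f x + g x)\<rparr>"

definition variety_morphism ::
  "nat \<Rightarrow> (nat \<Rightarrow> 'k::field) set \<Rightarrow> nat \<Rightarrow> (nat \<Rightarrow> 'k) set \<Rightarrow> ((nat \<Rightarrow> 'k) \<Rightarrow> nat \<Rightarrow> 'k) \<Rightarrow> bool" where
  "variety_morphism m V n Y \<phi> \<longleftrightarrow>
    \<phi> \<in> V \<rightarrow> Y \<and> (\<forall>j<n. \<exists>p\<in>mpolys m. \<forall>x\<in>V. \<phi> x j = mpoly_eval x p)"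

definition pullback ::
  "(nat \<Rightarrow> 'k) set \<Rightarrow> ((nat \<Rightarrow> 'k) \<Rightarrow> nat \<Rightarrow> 'k) \<Rightarrow> ((nat \<Rightarrow> 'k) \<Rightarrow> 'k) \<Rightarrow> (nat \<Rightarrow> 'k) \<Rightarrow> 'k" where
  "pullback V \<phi> f = compose V f \<phi>"

definition finite_morphism ::
  "nat \<Rightarrow> (nat \<Rightarrow> 'k::field) set \<Rightarrow> nat \<Rightarrow> (nat \<Rightarrow> 'k) set \<Rightarrow> ((nat \<Rightarrow> 'k) \<Rightarrow> nat \<Rightarrow> 'k) \<Rightarrow> bool" where
  "finite_morphism m V n Y \<phi> \<longleftrightarrow> variety_morphism m V n Y \<phi> \<and>
    finite_ring_hom (coord_ring n Y) (coord_ring m V) (pullback V \<phi>)"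

definition dominant_morphism ::
  "nat \<Rightarrow> (nat \<Rightarrow> 'k::field) set \<Rightarrow> nat \<Rightarrow> (nat \<Rightarrow> 'k) set \<Rightarrow> ((nat \<Rightarrow> 'k) \<Rightarrow> nat \<Rightarrow> 'k) \<Rightarrow> bool" where
  "dominant_morphism m V n Y \<phi> \<longleftrightarrow> variety_morphism m V n Y \<phi> \<and>
    Abstract_Topology.closure_of (subtopology (zariski n) Y) (\<phi> ` V) = Y"

definition normal_variety :: "nat \<Rightarrow> (nat \<Rightarrow> 'k::field) set \<Rightarrow> bool" where
  "normal_variety n Y \<longleftrightarrow> affine_variety n Y \<and> integrally_closed (coord_ring n Y)"

end

theory Submission
  imports Defs
begin

text \<open>
  Let \<open>A = k[Y]\<close> and \<open>B = k[V]\<close>. Since \<open>A\<close> is normal, every \<open>f \<in> B\<close> has a monic minimal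
  polynomial over \<open>A\<close>, and by Nakayama's lemma every root of its specialisation at a point
  \<open>y\<close> is a value of \<open>f\<close> on the fibre over \<open>y\<close>. If \<open>f\<close> does not vanish at a point over \<open>W\<close>,
  some lower coefficient of this polynomial is not identically zero on \<open>W\<close>, so \<open>f\<close> has a
  nonzero value over a general point of \<open>W\<close>: the morphism is open. Hence for a component \<open>Z\<close> of the
  preimage of \<open>W\<close> no product \<open>f \<cdot> (a \<circ> \<phi>)\<close> with \<open>f\<close> nonzero on \<open>Z\<close> and \<open>a\<close> nonzero on \<open>W\<close>
  vanishes on the whole preimage, and a prime avoiding these products is the ideal of an irreducible
  closed set containing \<open>Z\<close> and mapping onto \<open>W\<close>; by maximality it is \<open>Z\<close>. The dimensions agree
  by lying over, going up and incomparability. The ring of polynomials in all variables stands in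
  for both coordinate rings, and all identities are read modulo vanishing ideals.
\<close>

section \<open>Ideals\<close>

text \<open>The usual proof that minimal polynomials over a normal \<open>A\<close> have
  coefficients in \<open>A\<close> takes conjugates in a splitting field. Here no field extension is
  formed: a relation of least degree divides a monic one after scaling by powers of its leading
  coefficient \<open>b\<close>, and the Dedekind-Mertens inclusion for content ideals shows that its
  coefficients divided by \<open>b\<close> are integral. Minimality matters because a merely monic
  relation may have roots that are not values of \<open>f\<close>. The minimal polynomial
  \<open>P\<close> divides every relation, so A[f] is A[T] modulo \<open>P\<close>; a root of
  \<open>P\<close> specialised at \<open>y\<close> is then a point of A[f] over \<open>y\<close>,
  and Nakayama is applied to \<open>B\<close> as a finite module over A[f], not over
  \<open>A\<close>. Since identities are read modulo ideals, a fraction p/b never appears outside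
  the last section; integrality of p/b is the homogeneous relation p^e + sum of c_i p^i
  b^(e-i).\<close>

definition is_ideal :: "'a::comm_ring_1 set \<Rightarrow> bool" where
  "is_ideal I \<longleftrightarrow> 0 \<in> I \<and> (\<forall>a\<in>I. \<forall>b\<in>I. a + b \<in> I) \<and> (\<forall>r. \<forall>a\<in>I. r * a \<in> I)"

definition is_prime_ideal :: "'a::comm_ring_1 set \<Rightarrow> bool" where
  "is_prime_ideal I \<longleftrightarrow> is_ideal I \<and> 1 \<notin> I \<and> (\<forall>a b. a * b \<in> I \<longrightarrow> a \<in> I \<or> b \<in> I)"

lemma is_idealI:
  assumes "0 \<in> I" "\<And>a b. a \<in> I \<Longrightarrow> b \<in> I \<Longrightarrow> a + b \<in> I" "\<And>r a. a \<in> I \<Longrightarrow> r * a \<in> I"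
  shows "is_ideal I"
  using assms by (auto simp: is_ideal_def)

lemma ideal_zero: "is_ideal I \<Longrightarrow> 0 \<in> I"
  and ideal_add: "is_ideal I \<Longrightarrow> a \<in> I \<Longrightarrow> b \<in> I \<Longrightarrow> a + b \<in> I"
  and ideal_mult: "is_ideal I \<Longrightarrow> a \<in> I \<Longrightarrow> r * a \<in> I"
  by (auto simp: is_ideal_def)

lemma ideal_uminus: "is_ideal I \<Longrightarrow> a \<in> I \<Longrightarrow> - a \<in> I"
  using ideal_mult[of I a "-1"] by simp

lemma ideal_diff: "is_ideal I \<Longrightarrow> a \<in> I \<Longrightarrow> b \<in> I \<Longrightarrow> a - b \<in> I"
  using ideal_add[of I a "- b"] ideal_uminus[of I b] by simp

lemma ideal_sum: "is_ideal I \<Longrightarrow> (\<And>x. x \<in> A \<Longrightarrow> f x \<in> I) \<Longrightarrow> sum f A \<in> I"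
  by (induction A rule: infinite_finite_induct) (auto intro: ideal_zero ideal_add)

lemma ideal_diff_iff:
  assumes "is_ideal I" "a - b \<in> I"
  shows "a \<in> I \<longleftrightarrow> b \<in> I"
  using ideal_diff[OF assms(1), of a "a - b"] ideal_add[OF assms(1), of "a - b" b] assms(2) by auto

lemma prime_ideal_prod_mset:
  assumes "is_prime_ideal Q" "(\<Prod>x\<in>#A. f x) \<in> Q"
  shows "\<exists>x\<in>#A. f x \<in> Q"
  using assms(2)
proof (induction A)
  case empty
  then show ?case using assms(1) by (simp add: is_prime_ideal_def)
next
  case (add x A)
  then have "f x \<in> Q \<or> (\<Prod>x\<in>#A. f x) \<in> Q" using assms(1) by (simp add: is_prime_ideal_def)
  then show ?case using add.IH by auto
qed

text \<open>An ideal \<open>Q\<close> maximal among those containing \<open>J\<close> and missing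
  \<open>M\<close> is prime: if neither \<open>a\<close> nor \<open>b\<close> lies in
  \<open>Q\<close>, both enlarged ideals meet \<open>M\<close>, and the product of the two meeting
  elements would fall into \<open>Q\<close> along with \<open>a * b\<close>. With
  \<open>M = {1}\<close> this gives a prime above a proper ideal.\<close>

lemma prime_avoiding_exists:
  fixes J M :: "'a::comm_ring_1 set"
  assumes J: "is_ideal J" and M: "1 \<in> M" "\<And>a b. a \<in> M \<Longrightarrow> b \<in> M \<Longrightarrow> a * b \<in> M" and JM: "J \<inter> M = {}"
  obtains Q where "is_prime_ideal Q" "J \<subseteq> Q" "Q \<inter> M = {}"
proof -
  let ?S = "{I. is_ideal I \<and> J \<subseteq> I \<and> I \<inter> M = {}}"
  have "\<exists>Q\<in>?S. \<forall>K\<in>?S. Q \<subseteq> K \<longrightarrow> K = Q"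
  proof (rule subset_Zorn_nonempty)
    show "?S \<noteq> {}" using J JM by blast
    fix C assume C: "C \<noteq> {}" "subset.chain ?S C"
    have id: "is_ideal I" "J \<subseteq> I" "I \<inter> M = {}" if "I \<in> C" for I
      using that C(2) by (auto simp: subset.chain_def)
    have tot: "I \<subseteq> K \<or> K \<subseteq> I" if "I \<in> C" "K \<in> C" for I K
      using subset.chain_total[OF C(2) that] by auto
    have "is_ideal (\<Union>C)"
    proof (rule is_idealI)
      show "0 \<in> \<Union>C" using C(1) ideal_zero[OF id(1)] by blast
      show "r * a \<in> \<Union>C" if "a \<in> \<Union>C" for r a
        using that ideal_mult[OF id(1), of _ a r] by blast
      fix a b assume "a \<in> \<Union>C" "b \<in> \<Union>C"
      then obtain I K where "I \<in> C" "K \<in> C" "a \<in> I" "b \<in> K" by blast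
      moreover from this tot have "K \<subseteq> I \<or> I \<subseteq> K" by blast
      ultimately show "a + b \<in> \<Union>C" using ideal_add[OF id(1), of I a b] ideal_add[OF id(1), of K a b] by blast
    qed
    then show "\<Union>C \<in> ?S" using C(1) id by blast
  qed
  then obtain Q where "Q \<in> ?S" and maxQ: "\<forall>K\<in>?S. Q \<subseteq> K \<longrightarrow> K = Q" by (elim bexE)
  then have Q: "is_ideal Q" "J \<subseteq> Q" "Q \<inter> M = {}" by simp_all
  have max: "K = Q" if "is_ideal K" "K \<inter> M = {}" "Q \<subseteq> K" for K
    using maxQ that Q(2) by (simp add: order_trans[of J Q K])
  have meet: "\<exists>q\<in>Q. \<exists>r. q + r * a \<in> M" if "a \<notin> Q" for a
  proof -
    let ?K = "{q + r * a | q r. q \<in> Q}"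
    have "is_ideal ?K"
    proof (rule is_idealI)
      show "0 \<in> ?K" using ideal_zero[OF Q(1)] by (intro CollectI exI[of _ 0]) auto
    next
      fix x y assume "x \<in> ?K" "y \<in> ?K"
      then obtain q r q' r' where "x = q + r * a" "y = q' + r' * a" "q \<in> Q" "q' \<in> Q" by blast
      then have "x + y = (q + q') + (r + r') * a" "q + q' \<in> Q"
        using ideal_add[OF Q(1)] by (auto simp: algebra_simps)
      then show "x + y \<in> ?K" by blast
    next
      fix s x assume "x \<in> ?K"
      then obtain q r where "x = q + r * a" "q \<in> Q" by blast
      then have "s * x = s * q + (s * r) * a" "s * q \<in> Q"
        using ideal_mult[OF Q(1)] by (auto simp: algebra_simps)
      then show "s * x \<in> ?K" by blast
    qed
    moreover have "Q \<subseteq> ?K"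
    proof
      fix q assume "q \<in> Q"
      moreover have "q = q + 0 * a" by simp
      ultimately show "q \<in> ?K" by blast
    qed
    moreover have "a \<in> ?K"
      using ideal_zero[OF Q(1)] by (intro CollectI exI[of _ 0] exI[of _ 1]) auto
    ultimately have "?K \<inter> M \<noteq> {}" using max[of ?K] that by blast
    then show ?thesis by blast
  qed
  have "is_prime_ideal Q"
    unfolding is_prime_ideal_def
  proof (intro conjI allI impI)
    show "is_ideal Q" "1 \<notin> Q" using Q M(1) by auto
    fix a b assume ab: "a * b \<in> Q"
    show "a \<in> Q \<or> b \<in> Q"
    proof (rule ccontr)
      assume "\<not> (a \<in> Q \<or> b \<in> Q)"
      then have "a \<notin> Q" "b \<notin> Q" by auto
      from meet[OF this(1)] meet[OF this(2)]
      obtain q r q' r' where *: "q \<in> Q" "q' \<in> Q" "q + r * a \<in> M" "q' + r' * b \<in> M"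
        by (elim bexE exE)
      have "(q + r * a) * (q' + r' * b) = (q' + r' * b) * q + (r * a) * q' + (r * r') * (a * b)"
        by (simp add: algebra_simps)
      also have "\<dots> \<in> Q"
        by (intro ideal_add[OF Q(1)]; rule ideal_mult[OF Q(1)]; fact)
      finally show False using M(2)[OF *(3,4)] Q(3) by blast
    qed
  qed
  then show thesis using that Q by blast
qed

section \<open>Elimination modulo an ideal\<close>

text \<open>Gaussian elimination without division: \<open>U\<close> plays the role of the pivots and \<open>N\<close> of the
  off-diagonal entries, graded so that pivots may be monic polynomials of a given degree and
  off-diagonal entries polynomials of smaller degree.\<close>

lemma elimination:
  fixes v :: "'i \<Rightarrow> 'a::comm_ring_1" and U N :: "nat \<Rightarrow> 'a set"
  assumes I: "is_ideal I" and "finite J"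
    and one: "1 \<in> U 0"
    and UU: "\<And>d e a b. a \<in> U d \<Longrightarrow> b \<in> U e \<Longrightarrow> a * b \<in> U (d + e)"
    and UN: "\<And>d e a b. a \<in> U d \<Longrightarrow> b \<in> N e \<Longrightarrow> a * b \<in> N (d + e)"
    and NN: "\<And>d e a b. a \<in> N d \<Longrightarrow> b \<in> N e \<Longrightarrow> a * b \<in> N (d + e)"
    and U_diff: "\<And>d a b. a \<in> U d \<Longrightarrow> b \<in> N d \<Longrightarrow> a - b \<in> U d"
    and N_diff: "\<And>d a b. a \<in> N d \<Longrightarrow> b \<in> N d \<Longrightarrow> a - b \<in> N d"
    and "\<And>i. i \<in> J \<Longrightarrow> c i i \<in> U d" and "\<And>i j. i \<in> J \<Longrightarrow> j \<in> J \<Longrightarrow> i \<noteq> j \<Longrightarrow> c i j \<in> N d"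
    and "\<And>i. i \<in> J \<Longrightarrow> (\<Sum>j\<in>J. c i j * v j) \<in> I"
  shows "\<exists>e. \<exists>u\<in>U e. \<forall>j\<in>J. u * v j \<in> I"
  using \<open>finite J\<close> assms(9-)
proof (induction J arbitrary: c d rule: finite_induct)
  case empty
  then show ?case using one by blast
next
  case (insert l J)
  \<comment> \<open>Row \<open>i\<close> is scaled by the pivot of row \<open>l\<close> before a
    multiple of row \<open>l\<close> is subtracted, so column \<open>l\<close> cancels and the grade
    doubles.\<close>
  define c' where "c' i j = c l l * c i j - c i l * c l j" for i j
  have ne: "i \<noteq> l" if "i \<in> J" for i using that insert.hyps by blast
  have "\<exists>e. \<exists>u\<in>U e. \<forall>j\<in>J. u * v j \<in> I"
  proof (rule insert.IH[where c = c' and d = "d + d"])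
    fix i assume i: "i \<in> J"
    show "c' i i \<in> U (d + d)"
      unfolding c'_def using i ne[OF i] insert.prems by (intro U_diff UU NN) auto
    have eq: "(\<Sum>j\<in>J. c' i j * v j) =
        c l l * (\<Sum>j\<in>insert l J. c i j * v j) - c i l * (\<Sum>j\<in>insert l J. c l j * v j)"
      using insert.hyps
      by (simp add: c'_def algebra_simps sum_distrib_left sum_subtractf)
    show "(\<Sum>j\<in>J. c' i j * v j) \<in> I"
      unfolding eq using i insert.prems(3) by (intro ideal_diff[OF I] ideal_mult[OF I]) auto
  next
    fix i j assume ij: "i \<in> J" "j \<in> J" "i \<noteq> j"
    show "c' i j \<in> N (d + d)"
      unfolding c'_def using ij ne insert.prems
      by (intro N_diff UN NN) auto
  qed
  then obtain e u where u: "u \<in> U e" "\<And>j. j \<in> J \<Longrightarrow> u * v j \<in> I" by blast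
  have *: "u * c l l \<in> U (e + d)" using u insert.prems by (intro UU) auto
  have "u * c l l * v l = u * (\<Sum>j\<in>insert l J. c l j * v j) - (\<Sum>j\<in>J. c l j * (u * v j))"
    using insert.hyps by (simp add: algebra_simps sum_distrib_left)
  also have "\<dots> \<in> I"
    by (intro ideal_diff[OF I] ideal_sum[OF I])
      (use u(2) insert.prems(3)[of l] ideal_mult[OF I] in auto)
  finally have "u * c l l * v l \<in> I" .
  moreover have "u * c l l * v j \<in> I" if "j \<in> J" for j
    using ideal_mult[OF I u(2)[OF that], of "c l l"] by (simp add: mult_ac)
  ultimately show ?case using * by blast
qed

text \<open>Determinant form, with \<open>N\<close> in the role of an ideal of the subring
  \<open>S\<close>. If \<open>I\<close> and \<open>N\<close> generated the unit ideal, every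
  generator would be an \<open>N\<close>-combination of generators modulo \<open>I\<close>;
  elimination on the identity minus this matrix would yield some \<open>1 + a\<close> with
  \<open>a\<close> in \<open>N\<close> annihilating all generators, hence annihilating 1.\<close>

lemma nakayama:
  fixes I S N G :: "'a::comm_ring_1 set"
  assumes I: "is_ideal I" and G: "finite G"
    and gen: "\<And>b. \<exists>c. (\<forall>g\<in>G. c g \<in> S) \<and> b - (\<Sum>g\<in>G. c g * g) \<in> I"
    and zero: "0 \<in> N" and add: "\<And>a b. a \<in> N \<Longrightarrow> b \<in> N \<Longrightarrow> a + b \<in> N"
    and neg: "\<And>a. a \<in> N \<Longrightarrow> - a \<in> N"
    and SN: "\<And>s a. s \<in> S \<Longrightarrow> a \<in> N \<Longrightarrow> s * a \<in> N" and NS: "N \<subseteq> S"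
    and unit: "\<And>a. a \<in> N \<Longrightarrow> 1 + a \<notin> I"
  obtains J where "is_ideal J" "I \<subseteq> J" "N \<subseteq> J" "1 \<notin> J"
proof
  define J where "J = {x. \<exists>c. (\<forall>g\<in>G. c g \<in> N) \<and> x - (\<Sum>g\<in>G. c g * g) \<in> I}"
  have N_sum: "(\<And>x. x \<in> A \<Longrightarrow> f x \<in> N) \<Longrightarrow> sum f A \<in> N" for A :: "'a set" and f
    by (induction A rule: infinite_finite_induct) (auto intro: zero add)
  have NN: "a * b \<in> N" if "a \<in> N" "b \<in> N" for a b using that SN NS by blast
  have mult_gen: "r * n \<in> J" if n: "n \<in> N" for r n
  proof -
    obtain c where c: "\<forall>g\<in>G. c g \<in> S" "r - (\<Sum>g\<in>G. c g * g) \<in> I" using gen by blast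
    have "r * n - (\<Sum>g\<in>G. (c g * n) * g) = n * (r - (\<Sum>g\<in>G. c g * g))"
      by (simp add: algebra_simps sum_distrib_left)
    also have "\<dots> \<in> I" using c(2) by (rule ideal_mult[OF I])
    finally show ?thesis
      unfolding J_def using c(1) n SN by (intro CollectI exI[of _ "\<lambda>g. c g * n"]) auto
  qed
  have J_add: "x + y \<in> J" if xy: "x \<in> J" "y \<in> J" for x y
  proof -
    obtain a b where a: "\<forall>g\<in>G. a g \<in> N" "x - (\<Sum>g\<in>G. a g * g) \<in> I"
      and b: "\<forall>g\<in>G. b g \<in> N" "y - (\<Sum>g\<in>G. b g * g) \<in> I" using xy unfolding J_def by blast
    have "(x + y) - (\<Sum>g\<in>G. (a g + b g) * g) = (x - (\<Sum>g\<in>G. a g * g)) + (y - (\<Sum>g\<in>G. b g * g))"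
      by (simp add: algebra_simps sum.distrib)
    also have "\<dots> \<in> I" using a(2) b(2) by (rule ideal_add[OF I])
    finally show ?thesis
      unfolding J_def using a(1) b(1) add by (intro CollectI exI[of _ "\<lambda>g. a g + b g"]) auto
  qed
  have J_0: "x \<in> J" if "x \<in> I" for x
    unfolding J_def using that zero by (intro CollectI exI[of _ "\<lambda>_. 0"]) auto
  have J_sum: "sum f A \<in> J" if "\<And>x. x \<in> A \<Longrightarrow> f x \<in> J" for f and A :: "'a set"
    using that by (induction A rule: infinite_finite_induct) (auto intro: J_add J_0 ideal_zero[OF I])
  show id: "is_ideal J"
  proof (rule is_idealI)
    show "0 \<in> J" by (intro J_0 ideal_zero[OF I])
    show "x + y \<in> J" if "x \<in> J" "y \<in> J" for x y using that by (rule J_add)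
    fix r x assume "x \<in> J"
    then obtain c where c: "\<forall>g\<in>G. c g \<in> N" "x - (\<Sum>g\<in>G. c g * g) \<in> I" unfolding J_def by blast
    have "r * x = (\<Sum>g\<in>G. (r * g) * c g) + r * (x - (\<Sum>g\<in>G. c g * g))"
      by (simp add: algebra_simps sum_distrib_left)
    also have "\<dots> \<in> J"
      using c by (intro J_add J_sum mult_gen J_0 ideal_mult[OF I]) auto
    finally show "r * x \<in> J" .
  qed
  show "I \<subseteq> J" using J_0 by blast
  show "N \<subseteq> J" using mult_gen[of _ 1] by auto
  show "1 \<notin> J"
  proof
    assume "1 \<in> J"
    then have "g \<in> J" for g using ideal_mult[OF id, of 1 g] by simp
    then have "\<exists>c. (\<forall>g\<in>G. c g \<in> N) \<and> x - (\<Sum>g\<in>G. c g * g) \<in> I" for x unfolding J_def by blast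
    then obtain c where c: "\<And>x g. g \<in> G \<Longrightarrow> c x g \<in> N" "\<And>x. x - (\<Sum>g\<in>G. c x g * g) \<in> I"
      by metis
    have "\<exists>e::nat. \<exists>u\<in>{1 + a | a. a \<in> N}. \<forall>g\<in>G. u * g \<in> I"
    proof (rule elimination[OF I G, where N = "\<lambda>_. N" and v = "\<lambda>x. x"
          and c = "\<lambda>i j. (if i = j then 1 else 0) - c i j"])
      let ?c = "\<lambda>i j. (if i = j then 1 else 0) - c i j"
      show "1 \<in> {1 + a | a. a \<in> N}" using zero by force
      show "a * b \<in> {1 + a |a. a \<in> N}" if ab: "a \<in> {1 + a |a. a \<in> N}" "b \<in> {1 + a |a. a \<in> N}" for a b
      proof -
        obtain s t where "a = 1 + s" "b = 1 + t" "s \<in> N" "t \<in> N" using ab by blast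
        then have "a * b = 1 + (s + t + s * t)" "s + t + s * t \<in> N"
          by (auto simp: algebra_simps intro!: add NN)
        then show ?thesis by blast
      qed
      show "a * b \<in> N" if ab: "a \<in> {1 + a |a. a \<in> N}" "b \<in> N" for a b
      proof -
        obtain s where "a = 1 + s" "s \<in> N" using ab(1) by blast
        then have "a * b = b + s * b" "s * b \<in> N" using ab(2) NN by (auto simp: algebra_simps)
        then show ?thesis using add ab(2) by simp
      qed
      show "a * b \<in> N" if "a \<in> N" "b \<in> N" for a b using that by (rule NN)
      show "a - b \<in> N" if "a \<in> N" "b \<in> N" for a b using add[OF that(1) neg[OF that(2)]] by simp
      show "a - b \<in> {1 + a |a. a \<in> N}" if ab: "a \<in> {1 + a |a. a \<in> N}" "b \<in> N" for a b
      proof -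
        obtain s where "a = 1 + s" "s \<in> N" using ab by blast
        then have "a - b = 1 + (s + - b)" "s + - b \<in> N"
          using ab(2) add[of s "- b"] neg[of b] by auto
        then show ?thesis by blast
      qed
      show "?c i i \<in> {1 + a |a. a \<in> N}" if "i \<in> G" for i
        using neg[OF c(1)[OF that, of i]] by force
      show "?c i j \<in> N" if "j \<in> G" "i \<noteq> j" for i j
        using neg[OF c(1)[OF that(1), of i]] that(2) by simp
      show "(\<Sum>j\<in>G. ?c i j * j) \<in> I" if "i \<in> G" for i
      proof -
        have "(\<Sum>j\<in>G. ?c i j * j) = i - (\<Sum>j\<in>G. c i j * j)"
          using that G by (simp add: left_diff_distrib sum_subtractf if_distrib[of "\<lambda>x. x * _"] cong: if_cong)
        then show ?thesis using c(2) by simp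
      qed
    qed
    then obtain a where a: "a \<in> N" "\<And>g. g \<in> G \<Longrightarrow> (1 + a) * g \<in> I" by blast
    obtain s where s: "1 - (\<Sum>g\<in>G. s g * g) \<in> I" using gen by blast
    have "1 + a = (1 + a) * (1 - (\<Sum>g\<in>G. s g * g)) + (\<Sum>g\<in>G. s g * ((1 + a) * g))"
      by (simp add: right_diff_distrib sum_distrib_left mult_ac)
    also have "\<dots> \<in> I"
      by (intro ideal_add[OF I] ideal_sum[OF I]; rule ideal_mult[OF I]; use s a(2) in simp)
    finally show False using unit a(1) by blast
  qed
qed

section \<open>Polynomial relations through a ring homomorphism\<close>

definition is_ring_hom :: "('a::comm_ring_1 \<Rightarrow> 'b::comm_ring_1) \<Rightarrow> bool" where
  "is_ring_hom h \<longleftrightarrow> h 1 = 1 \<and> (\<forall>a b. h (a + b) = h a + h b) \<and> (\<forall>a b. h (a * b) = h a * h b)"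

lemma hom_one: "is_ring_hom h \<Longrightarrow> h 1 = 1"
  and hom_add: "is_ring_hom h \<Longrightarrow> h (a + b) = h a + h b"
  and hom_mult: "is_ring_hom h \<Longrightarrow> h (a * b) = h a * h b"
  by (auto simp: is_ring_hom_def)

lemma hom_zero: "is_ring_hom h \<Longrightarrow> h 0 = 0"
  using hom_add[of h 0 0] by simp

lemma hom_uminus: "is_ring_hom h \<Longrightarrow> h (- a) = - h a"
  using hom_add[of h a "- a"] hom_zero[of h] by (simp add: eq_neg_iff_add_eq_0 add.commute)

lemma hom_diff: "is_ring_hom h \<Longrightarrow> h (a - b) = h a - h b"
  using hom_add[of h a "- b"] hom_uminus[of h b] by simp

lemma hom_power: "is_ring_hom h \<Longrightarrow> h (a ^ n) = h a ^ n"
  by (induction n) (auto simp: hom_one hom_mult)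

definition hpoly :: "('a::comm_ring_1 \<Rightarrow> 'b::comm_ring_1) \<Rightarrow> 'a poly \<Rightarrow> 'b \<Rightarrow> 'b" where
  "hpoly h P x = poly (map_poly h P) x"

context
  fixes h :: "'a::comm_ring_1 \<Rightarrow> 'b::comm_ring_1"
  assumes h: "is_ring_hom h"
begin

lemma hpoly_0 [simp]: "hpoly h 0 x = 0"
  by (simp add: hpoly_def)

lemma hpoly_pCons: "hpoly h (pCons a P) x = h a + x * hpoly h P x"
  by (simp add: hpoly_def map_poly_pCons hom_zero[OF h])

lemma hpoly_add: "hpoly h (P + Q) x = hpoly h P x + hpoly h Q x"
proof -
  have "map_poly h (P + Q) = map_poly h P + map_poly h Q"
    by (rule poly_eqI) (simp add: coeff_map_poly hom_zero[OF h] hom_add[OF h])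
  then show ?thesis by (simp add: hpoly_def)
qed

lemma hpoly_uminus: "hpoly h (- P) x = - hpoly h P x"
  using hpoly_add[of P "- P" x] by (simp add: eq_neg_iff_add_eq_0 add.commute)

lemma hpoly_diff: "hpoly h (P - Q) x = hpoly h P x - hpoly h Q x"
  using hpoly_add[of P "- Q" x] by (simp add: hpoly_uminus)

lemma hpoly_smult: "hpoly h (Polynomial.smult a P) x = h a * hpoly h P x"
  by (induction P) (auto simp: hpoly_pCons hom_mult[OF h] algebra_simps)

lemma hpoly_const: "hpoly h [:a:] x = h a"
  by (simp add: hpoly_pCons)

lemma hpoly_1: "hpoly h 1 x = 1"
  using hpoly_const[of 1 x] by (simp add: hom_one[OF h] one_pCons)

lemma hpoly_mult: "hpoly h (P * Q) x = hpoly h P x * hpoly h Q x"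
  by (induction P) (auto simp: hpoly_pCons hpoly_add hpoly_smult hom_zero[OF h] algebra_simps)

lemma hpoly_monom: "hpoly h (Polynomial.monom a i) x = h a * x ^ i"
  by (simp add: hpoly_def map_poly_monom hom_zero[OF h] poly_monom)

lemma hpoly_sum: "hpoly h (\<Sum>i\<in>A. P i) x = (\<Sum>i\<in>A. hpoly h (P i) x)"
  by (induction A rule: infinite_finite_induct) (auto simp: hpoly_add)

lemma hpoly_in_ideal:
  assumes J: "is_ideal J" and "\<And>i. h (Polynomial.coeff P i) \<in> J"
  shows "hpoly h P x \<in> J"
  using assms(2)
proof (induction P)
  case 0
  then show ?case using ideal_zero[OF J] by simp
next
  case (pCons a P)
  have "h (Polynomial.coeff P i) \<in> J" for i using pCons.prems[of "Suc i"] by simp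
  then show ?case
    using pCons.IH pCons.prems[of 0] by (simp add: hpoly_pCons ideal_add[OF J] ideal_mult[OF J])
qed

text \<open>Determinant trick for \<open>p\<close> times the identity minus \<open>b\<close> times
  the matrix \<open>h (a i j)\<close>, kept homogeneous so that it speaks of p/b without dividing.
  With \<open>b = 1\<close> it gives integrality of elements of a finite algebra; with
  \<open>h\<close> the identity, integrality of a fraction stabilising a finitely generated
  ideal.\<close>

lemma integral_relation:
  fixes v :: "'i \<Rightarrow> 'b" and p b :: 'b and a :: "'i \<Rightarrow> 'i \<Rightarrow> 'a"
  assumes I: "is_ideal I" and J: "finite J"
    and rel: "\<And>i. i \<in> J \<Longrightarrow> p * v i - b * (\<Sum>j\<in>J. h (a i j) * v j) \<in> I"
  shows "\<exists>e c. \<forall>j\<in>J. (p ^ e + (\<Sum>i<e. h (c i) * p ^ i * b ^ (e - i))) * v j \<in> I"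
proof -
  define T where "T d = {(\<Sum>i\<le>d. h (c i) * p ^ i * b ^ (d - i)) | c. True}" for d
  \<comment> \<open>Forms of degree \<open>d\<close> in \<open>p\<close> and \<open>b\<close>: those
    in \<open>N d\<close> have degree below \<open>d\<close> in \<open>p\<close>, those in
    \<open>U d\<close> are monic in \<open>p\<close>. They serve as off-diagonal entries and
    pivots.\<close>
  define N where "N d = {(\<Sum>i<d. h (c i) * p ^ i * b ^ (d - i)) | c. True}" for d
  define U where "U d = {p ^ d + x | x. x \<in> N d}" for d
  have NI: "(\<Sum>i<d. h (c i) * p ^ i * b ^ (d - i)) \<in> N d" for d c unfolding N_def by blast
  have N_add: "x + y \<in> N d" if xy: "x \<in> N d" "y \<in> N d" for x y d
  proof -
    obtain c c' where "x = (\<Sum>i<d. h (c i) * p ^ i * b ^ (d - i))"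
      "y = (\<Sum>i<d. h (c' i) * p ^ i * b ^ (d - i))" using xy unfolding N_def by blast
    then have "x + y = (\<Sum>i<d. h (c i + c' i) * p ^ i * b ^ (d - i))"
      by (simp add: hom_add[OF h] distrib_right sum.distrib)
    then show ?thesis using NI by simp
  qed
  have N_neg: "- x \<in> N d" if "x \<in> N d" for x d
  proof -
    obtain c where "x = (\<Sum>i<d. h (c i) * p ^ i * b ^ (d - i))" using \<open>x \<in> N d\<close> unfolding N_def by blast
    then have "- x = (\<Sum>i<d. h (- c i) * p ^ i * b ^ (d - i))"
      by (simp add: hom_uminus[OF h] sum_negf)
    then show ?thesis using NI by simp
  qed
  have N_zero: "0 \<in> N d" for d
    using NI[where d = d and c = "\<lambda>_. 0"] by (simp add: hom_zero[OF h])
  have N_sum: "(\<And>x. x \<in> A \<Longrightarrow> f x \<in> N d) \<Longrightarrow> sum f A \<in> N d" for f A d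
    by (induction A rule: infinite_finite_induct) (auto intro: N_zero N_add)
  have N_term: "h x * p ^ i * b ^ (d - i) \<in> N d" if "i < d" for x i d
  proof -
    have "h (if k = i then x else 0) * p ^ k * b ^ (d - k) = (if k = i then h x * p ^ i * b ^ (d - i) else 0)" for k
      by (simp add: hom_zero[OF h])
    then have "(\<Sum>k<d. h (if k = i then x else 0) * p ^ k * b ^ (d - k)) = h x * p ^ i * b ^ (d - i)"
      using that by simp
    then show ?thesis using NI[where d = d and c = "\<lambda>k. if k = i then x else 0"] by simp
  qed
  have pN: "p ^ d * x \<in> N (d + e)" if "x \<in> N e" for d e x
  proof -
    obtain c where c: "x = (\<Sum>i<e. h (c i) * p ^ i * b ^ (e - i))" using \<open>x \<in> N e\<close> unfolding N_def by blast
    have "p ^ d * x = (\<Sum>i<e. h (c i) * p ^ (d + i) * b ^ (d + e - (d + i)))"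
      unfolding c sum_distrib_left by (intro sum.cong refl) (simp add: power_add mult_ac)
    also have "\<dots> \<in> N (d + e)" by (intro N_sum N_term) auto
    finally show ?thesis .
  qed
  have NN: "x * y \<in> N (d + e)" if x: "x \<in> N d" and y: "y \<in> N e" for d e x y
  proof -
    obtain c where c: "x = (\<Sum>i<d. h (c i) * p ^ i * b ^ (d - i))" using x unfolding N_def by blast
    obtain c' where c': "y = (\<Sum>j<e. h (c' j) * p ^ j * b ^ (e - j))" using y unfolding N_def by blast
    have "x * y = (\<Sum>i<d. \<Sum>j<e. h (c i * c' j) * p ^ (i + j) * b ^ (d + e - (i + j)))"
      unfolding c c' sum_product
    proof (intro sum.cong refl)
      fix i j assume "i \<in> {..<d}" "j \<in> {..<e}"
      then have "b ^ (d + e - (i + j)) = b ^ (d - i) * b ^ (e - j)" by (simp flip: power_add)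
      then show "h (c i) * p ^ i * b ^ (d - i) * (h (c' j) * p ^ j * b ^ (e - j)) =
          h (c i * c' j) * p ^ (i + j) * b ^ (d + e - (i + j))"
        by (simp add: hom_mult[OF h] power_add mult_ac)
    qed
    also have "\<dots> \<in> N (d + e)" by (intro N_sum N_term) auto
    finally show ?thesis .
  qed
  have "\<exists>e. \<exists>u\<in>U e. \<forall>j\<in>J. u * v j \<in> I"
  proof (rule elimination[OF I J, where N = N and d = 1
        and c = "\<lambda>i j. (if i = j then p else 0) - b * h (a i j)"])
    show "1 \<in> U 0" unfolding U_def using N_zero[of 0] by force
    show "x * y \<in> U (d + e)" if "x \<in> U d" "y \<in> U e" for d e x y
    proof -
      obtain s t where st: "x = p ^ d + s" "y = p ^ e + t" "s \<in> N d" "t \<in> N e"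
        using \<open>x \<in> U d\<close> \<open>y \<in> U e\<close> unfolding U_def by blast
      have "x * y = p ^ (d + e) + (p ^ d * t + p ^ e * s + s * t)"
        unfolding st by (simp add: algebra_simps power_add)
      moreover have "p ^ d * t + p ^ e * s + s * t \<in> N (d + e)"
        using pN[OF st(4), of d] pN[OF st(3), of e] NN[OF st(3,4)] N_add by (simp add: add.commute)
      ultimately show ?thesis unfolding U_def by blast
    qed
    show "x * y \<in> N (d + e)" if "x \<in> U d" "y \<in> N e" for d e x y
    proof -
      obtain s where s: "x = p ^ d + s" "s \<in> N d" using \<open>x \<in> U d\<close> unfolding U_def by blast
      have "x * y = p ^ d * y + s * y" unfolding s by (simp add: distrib_right)
      then show ?thesis using pN[OF \<open>y \<in> N e\<close>, of d] NN[OF s(2) \<open>y \<in> N e\<close>] N_add by simp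
    qed
    show "x * y \<in> N (d + e)" if "x \<in> N d" "y \<in> N e" for d e x y using that by (rule NN)
    show N_diff: "x - y \<in> N d" if "x \<in> N d" "y \<in> N d" for d x y
      using N_add[OF that(1) N_neg[OF that(2)]] by simp
    show "x - y \<in> U d" if "x \<in> U d" "y \<in> N d" for d x y
    proof -
      obtain s where s: "x = p ^ d + s" "s \<in> N d" using \<open>x \<in> U d\<close> unfolding U_def by blast
      have "x - y = p ^ d + (s - y)" "s - y \<in> N d" using s N_diff \<open>y \<in> N d\<close> by auto
      then show ?thesis unfolding U_def by blast
    qed
    have N1: "- (b * h x) \<in> N 1" for x using N_neg[OF N_term[of 0 1 x]] by (simp add: mult.commute)
    show "(if i = i then p else 0) - b * h (a i i) \<in> U 1" for i
    proof -
      have "(if i = i then p else 0) - b * h (a i i) = p ^ 1 + - (b * h (a i i))" by simp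
      then show ?thesis unfolding U_def using N1 by blast
    qed
    show "(if i = j then p else 0) - b * h (a i j) \<in> N 1" if "i \<noteq> j" for i j
      using N1 that by simp
    show "(\<Sum>j\<in>J. ((if i = j then p else 0) - b * h (a i j)) * v j) \<in> I" if "i \<in> J" for i
    proof -
      have "(\<Sum>j\<in>J. ((if i = j then p else 0) - b * h (a i j)) * v j) =
          (\<Sum>j\<in>J. if i = j then p * v j else 0) - b * (\<Sum>j\<in>J. h (a i j) * v j)"
        unfolding sum_distrib_left sum_subtractf[symmetric]
        by (intro sum.cong refl) (simp add: algebra_simps)
      also have "(\<Sum>j\<in>J. if i = j then p * v j else 0) = p * v i" using that J by simp
      finally show ?thesis using rel[OF that] by simp
    qed
  qed
  then show ?thesis unfolding U_def N_def by blast
qed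

end

section \<open>Ideals generated by coefficients\<close>

definition ideal_gen :: "'a::comm_ring_1 set \<Rightarrow> 'a set" where
  "ideal_gen A = \<Inter>{I. is_ideal I \<and> A \<subseteq> I}"

lemma is_ideal_gen: "is_ideal (ideal_gen A)"
  unfolding ideal_gen_def
  by (rule is_idealI) (auto intro: ideal_zero ideal_add ideal_mult)

lemma ideal_gen_superset: "A \<subseteq> ideal_gen A"
  unfolding ideal_gen_def by blast

lemma ideal_gen_subset: "is_ideal I \<Longrightarrow> A \<subseteq> I \<Longrightarrow> ideal_gen A \<subseteq> I"
  unfolding ideal_gen_def by blast

text \<open>The ideal power c(S)^d, where c(S) is the content ideal of \<open>S\<close>. Splitting
  off one coefficient at a time matches the induction on the degree in
  \<open>dedekind_mertens\<close>.\<close>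

primrec content_power :: "'a::comm_ring_1 poly \<Rightarrow> nat \<Rightarrow> 'a set" where
  "content_power S 0 = UNIV"
| "content_power S (Suc d) = ideal_gen {Polynomial.coeff S j * z | j z. z \<in> content_power S d}"

lemma is_ideal_content_power: "is_ideal (content_power S d)"
  by (cases d) (auto simp: is_ideal_gen is_ideal_def[of UNIV])

lemma content_power_Suc: "z \<in> content_power S d \<Longrightarrow> Polynomial.coeff S j * z \<in> content_power S (Suc d)"
  using ideal_gen_superset[of "{Polynomial.coeff S j * z | j z. z \<in> content_power S d}"] by auto

lemma is_ideal_vimage: "is_ideal I \<Longrightarrow> is_ideal {w. x * w \<in> I}"
  by (rule is_idealI) (auto simp: ideal_zero distrib_left ideal_add mult.left_commute[of x] ideal_mult)

lemma coeff_power_in_content_power: "Polynomial.coeff S j ^ d \<in> content_power S d"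
proof (induction d)
  case (Suc d)
  then show ?case using content_power_Suc by (simp del: content_power.simps)
qed simp

lemma content_power_fin_gen:
  "\<exists>F. finite F \<and> F \<subseteq> content_power S d \<and>
    (\<forall>z\<in>content_power S d. \<exists>a. z = (\<Sum>g\<in>F. a g * g))"
proof (induction d)
  case 0
  show ?case by (intro exI[of _ "{1}"]) auto
next
  case (Suc d)
  then obtain F where F: "finite F" "F \<subseteq> content_power S d"
    "\<And>z. z \<in> content_power S d \<Longrightarrow> \<exists>a. z = (\<Sum>g\<in>F. a g * g)" by blast
  let ?F = "(\<lambda>(j, g). Polynomial.coeff S j * g) ` ({..Polynomial.degree S} \<times> F)"
  let ?C = "{z. \<exists>a. z = (\<Sum>g\<in>?F. a g * g)}"
  have fin: "finite ?F" using F(1) by simp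
  have C: "is_ideal ?C"
  proof (rule is_idealI)
    show "0 \<in> ?C" by (intro CollectI exI[of _ "\<lambda>_. 0"]) simp
  next
    fix x y assume "x \<in> ?C" "y \<in> ?C"
    then obtain a b where "x = (\<Sum>g\<in>?F. a g * g)" "y = (\<Sum>g\<in>?F. b g * g)" by blast
    then show "x + y \<in> ?C"
      by (intro CollectI exI[of _ "\<lambda>g. a g + b g"]) (simp add: distrib_right sum.distrib)
  next
    fix r x assume "x \<in> ?C"
    then obtain a where "x = (\<Sum>g\<in>?F. a g * g)" by blast
    then show "r * x \<in> ?C"
      by (intro CollectI exI[of _ "\<lambda>g. r * a g"]) (simp add: sum_distrib_left mult.assoc)
  qed
  have gen: "x \<in> ?C" if x: "x \<in> ?F" for x
  proof -
    have "(if g = x then 1 else 0) * g = (if g = x then x else 0)" for g by simp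
    then have "x = (\<Sum>g\<in>?F. (if g = x then 1 else 0) * g)" using x fin by simp
    then show ?thesis by (intro CollectI exI[of _ "\<lambda>g. if g = x then 1 else 0"])
  qed
  have "content_power S (Suc d) \<subseteq> ?C"
    unfolding content_power.simps
  proof (rule ideal_gen_subset[OF C], rule subsetI)
    fix x assume "x \<in> {Polynomial.coeff S j * z | j z. z \<in> content_power S d}"
    then obtain j z where x: "x = Polynomial.coeff S j * z" "z \<in> content_power S d" by blast
    obtain a where a: "z = (\<Sum>g\<in>F. a g * g)" using F(3)[OF x(2)] by blast
    show "x \<in> ?C"
    proof (cases "j \<le> Polynomial.degree S")
      case True
      have "x = (\<Sum>g\<in>F. a g * (Polynomial.coeff S j * g))"
        unfolding x a by (simp add: sum_distrib_left mult_ac)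
      moreover have "Polynomial.coeff S j * g \<in> ?C" if "g \<in> F" for g
        using True that by (intro gen image_eqI[of _ _ "(j, g)"]) auto
      ultimately show ?thesis
        by (simp only:) (intro ideal_sum[OF C], rule ideal_mult[OF C], blast)
    next
      case False
      then have "x = 0" using x by (simp add: coeff_eq_0)
      then show ?thesis using ideal_zero[OF C] by simp
    qed
  qed
  moreover have "?F \<subseteq> content_power S (Suc d)"
    using F(2) by (auto simp del: content_power.simps intro!: content_power_Suc)
  ultimately show ?case using fin by (intro exI[of _ ?F]) blast
qed

text \<open>The Dedekind--Mertens inclusion \<open>c(S)\<^sup>d\<^sup>+\<^sup>1 c(P) \<subseteq> c(S)\<^sup>d c(P S)\<close> of ideals generated by
  coefficients. Quantifying over the ideals \<open>K\<close> containing the right-hand side lets the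
  induction hypothesis be applied to ideal quotients.\<close>

lemma dedekind_mertens:
  assumes "Polynomial.degree P \<le> d" and "is_ideal K"
    and "\<And>k z. z \<in> content_power S d \<Longrightarrow> Polynomial.coeff (P * S) k * z \<in> K"
    and "z \<in> content_power S d"
  shows "Polynomial.coeff P i * Polynomial.coeff S j * z \<in> K"
  using assms
proof (induction d arbitrary: P K z i j)
  case 0
  then obtain p where P: "P = [:p:]" by (auto elim: degree_eq_zeroE)
  show ?case
  proof (cases i)
    case 0
    then show ?thesis using "0.prems"(3)[OF "0.prems"(4), of j] P by simp
  next
    case (Suc i')
    then show ?thesis using P ideal_zero[OF "0.prems"(2)] by simp
  qed
next
  case (Suc d)
  note K = Suc.prems(2)
  note KPS = Suc.prems(3)
  let ?s = "Polynomial.coeff S"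
  define p where "p = Polynomial.coeff P (Suc d)"
  define P' where "P' = P - Polynomial.monom p (Suc d)"
  have coeff_P': "Polynomial.coeff P' i = (if i = Suc d then 0 else Polynomial.coeff P i)" for i
    by (simp add: P'_def p_def)
  have deg_P': "Polynomial.degree P' \<le> d"
    by (rule degree_le) (use Suc.prems(1) in \<open>auto simp: coeff_P' coeff_eq_0\<close>)
  \<comment> \<open>Once \<open>p * ?s l\<close> times c(S)^(d+1) lies in \<open>K\<close>, the top
    term of \<open>P\<close> may be dropped: the coefficients of \<open>P' * S\<close> times c(S)^d
    lie in the ideal quotient of \<open>K\<close> by \<open>?s l\<close>, and the induction
    hypothesis applies to \<open>P'\<close> there.\<close>
  have lower: "Polynomial.coeff P i * ?s l * w \<in> K"
    if l: "\<And>w. w \<in> content_power S (Suc d) \<Longrightarrow> p * ?s l * w \<in> K"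
      and i: "i \<noteq> Suc d" and w: "w \<in> content_power S (Suc d)" for i l w
  proof -
    let ?K = "{x. ?s l * x \<in> K}"
    have K': "is_ideal ?K" by (rule is_ideal_vimage[OF K])
    have P'S: "Polynomial.coeff (P' * S) k * z \<in> ?K" if z: "z \<in> content_power S d" for k z
    proof -
      have 1: "?s l * (Polynomial.coeff (P * S) k * z) \<in> K"
        using KPS[OF content_power_Suc[OF z, of l], of k] by (simp add: mult_ac)
      have 2: "p * ?s l * ((if k < Suc d then 0 else ?s (k - Suc d)) * z) \<in> K"
      proof (cases "k < Suc d")
        case True
        then show ?thesis using ideal_zero[OF K] by simp
      next
        case False
        then show ?thesis using l[OF content_power_Suc[OF z, of "k - Suc d"]] by simp
      qed
      have "Polynomial.coeff (P' * S) k =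
          Polynomial.coeff (P * S) k - p * (if k < Suc d then 0 else ?s (k - Suc d))"
        by (simp add: P'_def left_diff_distrib coeff_monom_mult)
      then have "?s l * (Polynomial.coeff (P' * S) k * z) =
          ?s l * (Polynomial.coeff (P * S) k * z) - p * ?s l * ((if k < Suc d then 0 else ?s (k - Suc d)) * z)"
        by (simp only:) (simp add: algebra_simps)
      then show ?thesis using ideal_diff[OF K 1 2] by simp
    qed
    have IH: "Polynomial.coeff P' i * ?s j * z \<in> ?K" if "z \<in> content_power S d" for i j z
      by (rule Suc.IH[OF deg_P' K' P'S that])
    let ?W = "{w. (Polynomial.coeff P i * ?s l) * w \<in> K}"
    have "content_power S (Suc d) \<subseteq> ?W"
      unfolding content_power.simps
    proof (rule ideal_gen_subset[OF is_ideal_vimage[OF K]], rule subsetI)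
      fix x assume "x \<in> {?s j * z | j z. z \<in> content_power S d}"
      then obtain j z where x: "x = ?s j * z" "z \<in> content_power S d" by blast
      show "x \<in> ?W" using IH[OF x(2), of i j] i unfolding x(1) by (simp add: coeff_P' mult_ac)
    qed
    then show ?thesis using w by blast
  qed
  \<comment> \<open>Descending induction on \<open>j\<close>, starting above the degree of
    \<open>S\<close>, where coefficients are 0. In the coefficient of \<open>P * S\<close> at
    \<open>Suc d + j\<close>, every nonzero term besides \<open>p * ?s j\<close> pairs a lower
    coefficient of \<open>P\<close> with one of \<open>S\<close> of index above \<open>j\<close>, so
    \<open>lower\<close> disposes of it.\<close>
  have top: "p * ?s j * w \<in> K" if "w \<in> content_power S (Suc d)" for j w
    using that
  proof (induction "Polynomial.degree S + 1 - j" arbitrary: j w rule: less_induct)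
    case (less j)
    show ?case
    proof (cases "j \<le> Polynomial.degree S")
      case True
      let ?n = "Suc d + j"
      have "Polynomial.coeff (P * S) ?n = (\<Sum>i\<le>?n. Polynomial.coeff P i * ?s (?n - i))"
        by (rule coeff_mult)
      also have "\<dots> = p * ?s j + (\<Sum>i\<in>{..?n} - {Suc d}. Polynomial.coeff P i * ?s (?n - i))"
        by (subst sum.remove[of _ "Suc d"]) (auto simp: p_def)
      finally have "p * ?s j * w = Polynomial.coeff (P * S) ?n * w -
          (\<Sum>i\<in>{..?n} - {Suc d}. Polynomial.coeff P i * ?s (?n - i) * w)"
        by (simp only: distrib_right sum_distrib_right add_diff_cancel_right')
      also have "\<dots> \<in> K"
      proof (intro ideal_diff[OF K] ideal_sum[OF K] KPS less.prems)
        fix i assume i: "i \<in> {..?n} - {Suc d}"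
        show "Polynomial.coeff P i * ?s (?n - i) * w \<in> K"
        proof (cases "i < Suc d")
          case True
          have "p * ?s (?n - i) * w' \<in> K" if "w' \<in> content_power S (Suc d)" for w'
            by (rule less.hyps[OF _ that]) (use True \<open>j \<le> _\<close> in auto)
          then show ?thesis using i by (intro lower less.prems) auto
        next
          case False
          then have "Polynomial.coeff P i = 0" using i Suc.prems(1) by (auto intro!: coeff_eq_0)
          then show ?thesis using ideal_zero[OF K] by simp
        qed
      qed
      finally show ?thesis .
    next
      case False
      then show ?thesis using ideal_zero[OF K] by (simp add: coeff_eq_0)
    qed
  qed
  show ?case
  proof (cases "i = Suc d")
    case True
    then show ?thesis using top[OF Suc.prems(4)] by (simp add: p_def)
  next
    case False
    then show ?thesis using lower[OF top _ Suc.prems(4)] by blast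
  qed
qed

section \<open>Minimal polynomials over a normal domain\<close>

text \<open>This is \<open>c\<close> times \<open>C\<close> plus \<open>I\<close>, the kind of ideal
  to which \<open>coeff_quotient_integral\<close> applies \<open>dedekind_mertens\<close>.\<close>

lemma ideal_coset_multiples:
  assumes I: "is_ideal I" and C: "is_ideal C"
  shows "is_ideal {x. \<exists>y\<in>C. x - c * y \<in> I}"
proof (rule is_idealI)
  show "0 \<in> {x. \<exists>y\<in>C. x - c * y \<in> I}"
    using ideal_zero[OF I] ideal_zero[OF C] by force
next
  fix x x' assume "x \<in> {x. \<exists>y\<in>C. x - c * y \<in> I}" "x' \<in> {x. \<exists>y\<in>C. x - c * y \<in> I}"
  then obtain y y' where y: "y \<in> C" "y' \<in> C" "x - c * y \<in> I" "x' - c * y' \<in> I" by blast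
  have "x + x' - c * (y + y') = (x - c * y) + (x' - c * y')" by (simp add: algebra_simps)
  then have "x + x' - c * (y + y') \<in> I" using ideal_add[OF I y(3,4)] by (simp only:)
  then show "x + x' \<in> {x. \<exists>y\<in>C. x - c * y \<in> I}" using ideal_add[OF C y(1,2)] by blast
next
  fix r x assume "x \<in> {x. \<exists>y\<in>C. x - c * y \<in> I}"
  then obtain y where y: "y \<in> C" "x - c * y \<in> I" by blast
  have "r * x - c * (r * y) = r * (x - c * y)" by (simp add: algebra_simps)
  then have "r * x - c * (r * y) \<in> I" using ideal_mult[OF I y(2)] by (simp only:)
  then show "r * x \<in> {x. \<exists>y\<in>C. x - c * y \<in> I}" using ideal_mult[OF C y(1)] by blast
qed

text \<open>The quotients of the coefficients of \<open>P\<close> by \<open>b\<close> are integral because they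
  stabilise the finitely generated nonzero ideal \<open>c(S)\<^sup>d\<close> of the domain of residues modulo \<open>I\<close>.\<close>

lemma coeff_quotient_integral:
  fixes I :: "'a::comm_ring_1 set"
  assumes I: "is_prime_ideal I"
    and deg: "Polynomial.degree P \<le> d"
    and s: "Polynomial.coeff S j \<notin> I"
    and PS: "\<And>k. \<exists>x. Polynomial.coeff (P * S) k - b * Polynomial.coeff S j * x \<in> I"
  shows "\<exists>e c. Polynomial.coeff P i ^ e + (\<Sum>l<e. c l * Polynomial.coeff P i ^ l * b ^ (e - l)) \<in> I"
proof -
  have id: "is_ideal I" and prime: "\<And>x y. x * y \<in> I \<Longrightarrow> x \<in> I \<or> y \<in> I"
    using I by (auto simp: is_prime_ideal_def)
  let ?s = "Polynomial.coeff S j" and ?p = "Polynomial.coeff P i" and ?C = "content_power S d"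
  note C = is_ideal_content_power[of S d]
  let ?K = "{x. \<exists>y\<in>?C. x - b * ?s * y \<in> I}"
  have coeffs: "Polynomial.coeff (P * S) k * z \<in> ?K" if z: "z \<in> ?C" for k z
  proof -
    obtain x where "Polynomial.coeff (P * S) k - b * ?s * x \<in> I" using PS by blast
    then have "z * (Polynomial.coeff (P * S) k - b * ?s * x) \<in> I" by (rule ideal_mult[OF id])
    then have "Polynomial.coeff (P * S) k * z - b * ?s * (x * z) \<in> I" by (simp add: algebra_simps)
    then show ?thesis using ideal_mult[OF C z] by blast
  qed
  \<comment> \<open>Dedekind-Mertens puts \<open>?p * ?s * z\<close> into \<open>b * ?s\<close>
    times \<open>?C\<close> modulo \<open>I\<close>. Cancelling \<open>?s\<close>, which is outside
    the prime \<open>I\<close>, shows that multiplication by p/b maps \<open>?C\<close> into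
    itself.\<close>
  have stable: "\<exists>y\<in>?C. ?p * z - b * y \<in> I" if z: "z \<in> ?C" for z
  proof -
    have "?p * ?s * z \<in> ?K"
      by (rule dedekind_mertens[OF deg ideal_coset_multiples[OF id C] coeffs z])
    then obtain y where y: "y \<in> ?C" "?p * ?s * z - b * ?s * y \<in> I" by blast
    then have "?s * (?p * z - b * y) \<in> I" by (simp add: algebra_simps)
    then show ?thesis using prime s y(1) by blast
  qed
  obtain F where F: "finite F" "F \<subseteq> ?C" "\<And>z. z \<in> ?C \<Longrightarrow> \<exists>a. z = (\<Sum>g\<in>F. a g * g)"
    using content_power_fin_gen[of S d] by blast
  have "\<exists>a. ?p * g - b * (\<Sum>g'\<in>F. a g' * g') \<in> I" if g: "g \<in> F" for g
  proof -
    obtain y where y: "y \<in> ?C" "?p * g - b * y \<in> I" using stable g F(2) by blast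
    then show ?thesis using F(3)[OF y(1)] by blast
  qed
  then obtain a where a: "\<And>g. g \<in> F \<Longrightarrow> ?p * g - b * (\<Sum>g'\<in>F. a g g' * g') \<in> I" by metis
  have "is_ring_hom (\<lambda>x::'a. x)" by (simp add: is_ring_hom_def)
  from integral_relation[OF this id F(1), of ?p "\<lambda>g. g" b a, OF a]
  obtain e c where ec: "\<And>g. g \<in> F \<Longrightarrow>
      (?p ^ e + (\<Sum>l<e. c l * ?p ^ l * b ^ (e - l))) * g \<in> I" by auto
  let ?r = "?p ^ e + (\<Sum>l<e. c l * ?p ^ l * b ^ (e - l))"
  \<comment> \<open>The relation annihilates \<open>?s ^ d\<close>, an element of \<open>?C\<close>
    that is nonzero modulo the prime \<open>I\<close>; hence the relation itself holds.\<close>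
  obtain w where w: "?s ^ d = (\<Sum>g\<in>F. w g * g)"
    using F(3)[OF coeff_power_in_content_power] by blast
  have "?r * ?s ^ d = (\<Sum>g\<in>F. w g * (?r * g))"
    unfolding w sum_distrib_left by (simp only: mult.left_commute)
  also have "\<dots> \<in> I" by (rule ideal_sum[OF id], rule ideal_mult[OF id], rule ec)
  finally have "?r \<in> I \<or> ?s ^ d \<in> I" by (rule prime)
  moreover have "?s ^ n \<notin> I" for n
    by (induction n) (use I s prime in \<open>auto simp: is_prime_ideal_def\<close>)
  ultimately show ?thesis by blast
qed

text \<open>A substitute for Gauss's lemma. Let \<open>P\<close> be a relation of least degree that
  is nonzero modulo \<open>IA\<close>, with leading coefficient \<open>b\<close>. Pseudo-division of
  \<open>F\<close> by \<open>P\<close> has remainder zero modulo \<open>IA\<close>, so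
  \<open>P * S\<close> is congruent to \<open>b * lead_coeff S\<close> times \<open>F\<close>, and
  \<open>coeff_quotient_integral\<close> with \<open>normal\<close> lets \<open>b\<close> be divided
  out of \<open>P\<close>. Division by the resulting monic \<open>G\<close> leaves a remainder of
  smaller degree, which minimality kills.\<close>

lemma minimal_polynomial_exists:
  fixes h :: "'a::idom \<Rightarrow> 'b::comm_ring_1" and IA :: "'a set" and IB :: "'b set"
  assumes h: "is_ring_hom h" and IA: "is_prime_ideal IA" and IB: "is_prime_ideal IB"
    and h_iff: "\<And>a. h a \<in> IB \<longleftrightarrow> a \<in> IA"
    and normal: "\<And>p b c e. b \<notin> IA \<Longrightarrow> p ^ e + (\<Sum>i<e. c i * p ^ i * b ^ (e - i)) \<in> IA \<Longrightarrow>
      \<exists>q. p - q * b \<in> IA"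
    and F: "Polynomial.lead_coeff F = 1" "hpoly h F f \<in> IB"
  shows "\<exists>G. Polynomial.lead_coeff G = 1 \<and> hpoly h G f \<in> IB \<and>
    (\<forall>Q. hpoly h Q f \<in> IB \<longrightarrow> (\<exists>S. \<forall>i. Polynomial.coeff (Q - G * S) i \<in> IA))"
proof -
  let ?c = "Polynomial.coeff" and ?deg = "Polynomial.degree"
  have idA: "is_ideal IA" and idB: "is_ideal IB" and "1 \<notin> IA"
    and primeA: "\<And>x y. x * y \<in> IA \<Longrightarrow> x \<in> IA \<or> y \<in> IA"
    and primeB: "\<And>x y. x * y \<in> IB \<Longrightarrow> x \<in> IB \<or> y \<in> IB"
    using IA IB by (auto simp: is_prime_ideal_def)
  have hpoly_IB: "hpoly h P f \<in> IB" if "\<And>i. ?c P i \<in> IA" for P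
    using that by (intro hpoly_in_ideal[OF h idB]) (simp add: h_iff)
  define good where "good P \<longleftrightarrow> hpoly h P f \<in> IB \<and> (\<exists>i. ?c P i \<notin> IA)" for P
  have "good F" unfolding good_def using F \<open>1 \<notin> IA\<close> by metis
  then obtain P where P: "good P" and min: "\<And>R. good R \<Longrightarrow> ?deg P \<le> ?deg R"
    using exists_least_iff[of "\<lambda>n. \<exists>P. good P \<and> ?deg P = n"] by (metis not_le_imp_less)
  define d where "d = ?deg P"
  define b where "b = ?c P d"
  have small: "?c R i \<in> IA" if "hpoly h R f \<in> IB" "R = 0 \<or> ?deg R < d" for R i
  proof (rule ccontr)
    assume "?c R i \<notin> IA"
    then have "good R" "R \<noteq> 0" using that(1) ideal_zero[OF idA] by (auto simp: good_def)
    then show False using min[of R] that(2) by (simp add: d_def)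
  qed
  \<comment> \<open>Degrees are those of actual polynomials, not of their residues, so the leading
    coefficient could a priori vanish modulo \<open>IA\<close>; dropping the leading term would then
    contradict the choice of \<open>P\<close>.\<close>
  have b: "b \<notin> IA"
  proof
    assume "b \<in> IA"
    let ?R = "P - Polynomial.monom b d"
    have cR: "?c ?R i = (if i = d then 0 else ?c P i)" for i by (simp add: b_def)
    have "hpoly h ?R f \<in> IB"
      using P \<open>b \<in> IA\<close> ideal_mult[OF idB, of "h b" "f ^ d"]
      by (simp add: hpoly_diff[OF h] hpoly_monom[OF h] good_def ideal_diff[OF idB] h_iff mult.commute)
    moreover have "?R = 0 \<or> ?deg ?R < d"
    proof (cases "?R = 0")
      case False
      have "?deg ?R \<le> d" by (rule degree_le) (auto simp: cR d_def coeff_eq_0)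
      moreover have "?deg ?R \<noteq> d" using False cR[of d] leading_coeff_neq_0[of ?R] by metis
      ultimately show ?thesis by simp
    qed simp
    ultimately have "?c ?R i \<in> IA" for i by (rule small)
    then have "?c P i \<in> IA" for i
      using \<open>b \<in> IA\<close> cR[of i] b_def by (cases "i = d") metis+
    then show False using P by (auto simp: good_def)
  qed
  have "b \<noteq> 0" using b ideal_zero[OF idA] by auto
  then have "P \<noteq> 0" by (auto simp: b_def)
  have lead_P: "Polynomial.lead_coeff P = b" by (simp add: b_def d_def)
  have d_le: "d \<le> ?deg F" using min[OF \<open>good F\<close>] by (simp add: d_def)
  obtain S R where SR: "pseudo_divmod F P = (S, R)" by (cases "pseudo_divmod F P")
  define k where "k = Suc (?deg F) - d"
  have div: "Polynomial.smult (b ^ k) F = P * S + R" "R = 0 \<or> ?deg R < d"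
    using pseudo_divmod[OF \<open>P \<noteq> 0\<close> SR] by (auto simp: k_def lead_P d_def)
  have "hpoly h R f = h (b ^ k) * hpoly h F f - hpoly h S f * hpoly h P f"
    using arg_cong[OF div(1), of "\<lambda>Q. hpoly h Q f"]
    by (simp add: hpoly_smult[OF h] hpoly_add[OF h] hpoly_mult[OF h] mult.commute)
  also have "\<dots> \<in> IB"
    using F(2) P by (intro ideal_diff[OF idB]; intro ideal_mult[OF idB]) (auto simp: good_def)
  finally have R: "?c R i \<in> IA" for i using div(2) by (rule small)
  have bk: "b ^ k \<noteq> 0" using \<open>b \<noteq> 0\<close> by simp
  have "F \<noteq> 0" using F(1) by auto
  have PS: "P * S = Polynomial.smult (b ^ k) F - R" using div(1) by simp
  have cPS: "?c (P * S) i = b ^ k * ?c F i - ?c R i" for i unfolding PS by simp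
  have cR0: "?c R (?deg F) = 0" using div(2) d_le by (auto intro: coeff_eq_0)
  have cPS_F: "?c (P * S) (?deg F) = b ^ k" using cPS[of "?deg F"] cR0 F(1) by simp
  have "?deg (P * S) = ?deg F"
  proof (rule antisym)
    show "?deg (P * S) \<le> ?deg F"
      by (rule degree_le) (use div(2) d_le in \<open>auto simp: cPS coeff_eq_0\<close>)
    show "?deg F \<le> ?deg (P * S)" by (rule le_degree) (use cPS_F bk in simp)
  qed
  \<comment> \<open>Comparing coefficients at the degree of \<open>F\<close>, to which
    \<open>R\<close> does not contribute, brings the scalar \<open>b ^ k\<close> into the form
    \<open>b * lead_coeff S\<close> that \<open>coeff_quotient_integral\<close> expects.\<close>
  then have bs: "b * Polynomial.lead_coeff S = b ^ k"
    using cPS_F lead_coeff_mult[of P S] lead_P by simp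
  have s: "Polynomial.lead_coeff S \<notin> IA"
  proof
    assume "Polynomial.lead_coeff S \<in> IA"
    then have "b ^ k \<in> IA" using ideal_mult[OF idA] bs by metis
    moreover have "b ^ n \<notin> IA" for n
      by (induction n) (use \<open>1 \<notin> IA\<close> b primeA in auto)
    ultimately show False by blast
  qed
  have "\<exists>q. ?c P i - q * b \<in> IA" for i
  proof -
    have "\<exists>x. ?c (P * S) i - b * Polynomial.lead_coeff S * x \<in> IA" for i
      unfolding cPS bs using ideal_uminus[OF idA R[of i]] by (intro exI[of _ "?c F i"]) simp
    from coeff_quotient_integral[OF IA _ s this, of d i]
    show ?thesis using normal[OF b] by (auto simp: d_def)
  qed
  then obtain q where q: "\<And>i. ?c P i - q i * b \<in> IA" by metis
  define G where "G = Polynomial.monom 1 d + (\<Sum>i<d. Polynomial.monom (q i) i)"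
  have cG: "?c G i = (if i = d then 1 else if i < d then q i else 0)" for i
    by (auto simp: G_def coeff_sum)
  have deg_G: "?deg G = d"
    by (rule antisym, rule degree_le, simp add: cG, rule le_degree, simp add: cG)
  have lead_G: "Polynomial.lead_coeff G = 1" by (simp add: deg_G cG)
  have GIB: "hpoly h G f \<in> IB"
  proof -
    have "?c (P - Polynomial.smult b G) i \<in> IA" for i
      using q[of i] ideal_zero[OF idA]
      by (cases i d rule: linorder_cases) (auto simp: cG b_def d_def coeff_eq_0 mult.commute)
    then have "hpoly h (P - Polynomial.smult b G) f \<in> IB" by (rule hpoly_IB)
    then have "hpoly h P f - h b * hpoly h G f \<in> IB"
      by (simp add: hpoly_diff[OF h] hpoly_smult[OF h])
    then have "h b * hpoly h G f \<in> IB" using ideal_diff_iff[OF idB] P by (auto simp: good_def)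
    then show ?thesis using primeB b h_iff by blast
  qed
  have "\<exists>S. \<forall>i. ?c (Q - G * S) i \<in> IA" if Q: "hpoly h Q f \<in> IB" for Q
  proof -
    have "G \<noteq> 0" using lead_G by auto
    obtain S R where SR: "pseudo_divmod Q G = (S, R)" by (cases "pseudo_divmod Q G")
    have div: "Q = G * S + R" "R = 0 \<or> ?deg R < d"
      using pseudo_divmod[OF \<open>G \<noteq> 0\<close> SR] by (auto simp: lead_G deg_G cG)
    then have R_eq: "R = Q - G * S" by simp
    have "hpoly h R f = hpoly h Q f - hpoly h S f * hpoly h G f"
      unfolding R_eq by (simp add: hpoly_diff[OF h] hpoly_mult[OF h] mult.commute)
    also have "\<dots> \<in> IB" using Q ideal_mult[OF idB GIB] by (intro ideal_diff[OF idB])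
    finally show ?thesis using small[OF _ div(2)] R_eq by blast
  qed
  then show ?thesis using lead_G GIB by blast
qed

section \<open>Polynomials and the Zariski topology\<close>

abbreviation mconst :: "'k::comm_ring_1 \<Rightarrow> 'k mpoly" where
  "mconst c \<equiv> Poly_Mapping.single 0 c"

abbreviation mvar :: "nat \<Rightarrow> 'k::comm_ring_1 mpoly" where
  "mvar i \<equiv> Poly_Mapping.single (Poly_Mapping.single i 1) 1"

definition mpoly_subst :: "(nat \<Rightarrow> 'k mpoly) \<Rightarrow> 'k mpoly \<Rightarrow> 'k::comm_ring_1 mpoly" where
  "mpoly_subst g p = (\<Sum>m\<in>Poly_Mapping.keys p. mconst (Poly_Mapping.lookup p m) * mono_eval g m)"

lemma mpoly_eval_hom: "is_ring_hom (mpoly_eval (x :: nat \<Rightarrow> 'k::comm_ring_1))"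
  by (simp add: is_ring_hom_def mpoly_eval_add mpoly_eval_mult)

lemma mpoly_eval_diff: "mpoly_eval (x :: nat \<Rightarrow> 'k::comm_ring_1) (p - q) = mpoly_eval x p - mpoly_eval x q"
  by (rule hom_diff[OF mpoly_eval_hom])

lemma mono_eval_0 [simp]: "mono_eval x 0 = 1"
  by (simp add: mono_eval_def)

lemma mono_eval_single [simp]: "mono_eval x (Poly_Mapping.single i k) = x i ^ k"
  by (simp add: mono_eval_def)

lemma mpoly_eval_mconst: "mpoly_eval x (mconst c) = c"
  by simp

lemma mpoly_subst_superset:
  assumes "finite M" "Poly_Mapping.keys p \<subseteq> M"
  shows "mpoly_subst g p = (\<Sum>m\<in>M. mconst (Poly_Mapping.lookup p m) * mono_eval g m)"
  unfolding mpoly_subst_def using assms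
  by (intro sum.mono_neutral_left) (auto simp: in_keys_iff)

lemma mpoly_subst_single: "mpoly_subst g (Poly_Mapping.single m c) = mconst c * mono_eval g m"
  by (subst mpoly_subst_superset[of "{m}"]) auto

lemma mpoly_subst_mconst: "mpoly_subst g (mconst c) = mconst c"
  by (simp add: mpoly_subst_single mono_eval_def)

lemma mpoly_subst_add: "mpoly_subst g (p + q) = mpoly_subst g p + mpoly_subst g q"
proof -
  let ?M = "Poly_Mapping.keys p \<union> Poly_Mapping.keys q"
  have "Poly_Mapping.keys (p + q) \<subseteq> ?M" by (rule Poly_Mapping.keys_add)
  then show ?thesis
    by (simp add: mpoly_subst_superset[of ?M] lookup_add single_add sum.distrib distrib_right)
qed

lemma mpoly_subst_sum: "mpoly_subst g (\<Sum>i\<in>I. p i) = (\<Sum>i\<in>I. mpoly_subst g (p i))"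
  by (induction I rule: infinite_finite_induct) (auto simp: mpoly_subst_add mpoly_subst_def[of g 0])

lemma mpoly_subst_mult: "mpoly_subst g (p * q) = mpoly_subst g p * mpoly_subst g q"
proof -
  have "p * q = (\<Sum>m\<in>Poly_Mapping.keys p. \<Sum>m'\<in>Poly_Mapping.keys q.
      Poly_Mapping.single (m + m') (Poly_Mapping.lookup p m * Poly_Mapping.lookup q m'))"
    by (subst mpoly_expand[of p], subst mpoly_expand[of q]) (simp add: sum_product mult_single)
  then have "mpoly_subst g (p * q) = (\<Sum>m\<in>Poly_Mapping.keys p. \<Sum>m'\<in>Poly_Mapping.keys q.
      mconst (Poly_Mapping.lookup p m * Poly_Mapping.lookup q m') * (mono_eval g m * mono_eval g m'))"
    by (simp only: mpoly_subst_sum mpoly_subst_single mono_eval_add)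
  also have "\<dots> = mpoly_subst g p * mpoly_subst g q"
    unfolding mpoly_subst_def sum_product
  proof (intro sum.cong refl)
    fix m m'
    have "mconst (Poly_Mapping.lookup p m * Poly_Mapping.lookup q m') =
        mconst (Poly_Mapping.lookup p m) * mconst (Poly_Mapping.lookup q m')"
      by (simp add: mult_single)
    then show "mconst (Poly_Mapping.lookup p m * Poly_Mapping.lookup q m') * (mono_eval g m * mono_eval g m') =
        mconst (Poly_Mapping.lookup p m) * mono_eval g m * (mconst (Poly_Mapping.lookup q m') * mono_eval g m')"
      by (simp only: ac_simps)
  qed
  finally show ?thesis .
qed

lemma mpoly_subst_hom: "is_ring_hom (mpoly_subst g)"
  using mpoly_subst_mconst[of g 1] by (simp add: is_ring_hom_def mpoly_subst_add mpoly_subst_mult)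

lemma mpoly_eval_mono_eval:
  fixes x :: "nat \<Rightarrow> 'k::comm_ring_1"
  shows "mpoly_eval x (mono_eval g m) = mono_eval (\<lambda>i. mpoly_eval x (g i)) m"
proof -
  have "mpoly_eval x (\<Prod>i\<in>A. g i ^ k i) = (\<Prod>i\<in>A. mpoly_eval x (g i) ^ k i)" for A and k :: "nat \<Rightarrow> nat"
    by (induction A rule: infinite_finite_induct)
      (auto simp: mpoly_eval_mult hom_power[OF mpoly_eval_hom])
  then show ?thesis unfolding mono_eval_def .
qed

lemma mpoly_eval_subst:
  fixes x :: "nat \<Rightarrow> 'k::comm_ring_1"
  shows "mpoly_eval x (mpoly_subst g p) = mpoly_eval (\<lambda>i. mpoly_eval x (g i)) p"
  by (simp only: mpoly_subst_def mpoly_eval_sum mpoly_eval_mult mpoly_eval_mconst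
      mpoly_eval_mono_eval mpoly_eval_def[of "\<lambda>i. mpoly_eval x (g i)"])

lemma mpoly_induct [case_names const var add mult]:
  fixes p :: "'k::comm_ring_1 mpoly"
  assumes const: "\<And>c. P (mconst c)" and var: "\<And>i. P (mvar i)"
    and add: "\<And>p q. P p \<Longrightarrow> P q \<Longrightarrow> P (p + q)" and mult: "\<And>p q. P p \<Longrightarrow> P q \<Longrightarrow> P (p * q)"
  shows "P p"
proof -
  have P0: "P 0" and P1: "P 1" using const[of 0] const[of 1] by simp_all
  have pow: "P (p ^ k)" if "P p" for p k
    by (induction k) (auto intro: P1 mult that)
  have prod: "P (prod f A)" if "\<And>i. P (f i)" for f :: "nat \<Rightarrow> _" and A
    by (induction A rule: infinite_finite_induct) (auto intro: P1 mult that)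
  have sum: "P (sum f A)" if "\<And>i. P (f i)" for f :: "(nat \<Rightarrow>\<^sub>0 nat) \<Rightarrow> _" and A
    by (induction A rule: infinite_finite_induct) (auto intro: P0 add that)
  have "p = mpoly_subst mvar p"
  proof -
    have var_pow: "mvar i ^ k = (Poly_Mapping.single (Poly_Mapping.single i k) 1 :: 'k mpoly)" for i k
      by (induction k) (auto simp: mult_single single_add[symmetric])
    have "(\<Prod>i\<in>A. mvar i ^ k i) = (Poly_Mapping.single (\<Sum>i\<in>A. Poly_Mapping.single i (k i)) 1 :: 'k mpoly)"
      if "finite A" for A k
      using that by (induction A rule: finite_induct) (auto simp: var_pow[unfolded One_nat_def] mult_single)
    moreover have "(\<Sum>i\<in>Poly_Mapping.keys m. Poly_Mapping.single i (Poly_Mapping.lookup m i)) = m"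
      for m :: "nat \<Rightarrow>\<^sub>0 nat"
      by (rule poly_mapping_eqI) (auto simp: lookup_sum lookup_single when_def in_keys_iff)
    ultimately have mono: "mono_eval mvar m = (Poly_Mapping.single m 1 :: 'k mpoly)" for m
      unfolding mono_eval_def by simp
    have "p = (\<Sum>m\<in>Poly_Mapping.keys p. Poly_Mapping.single m (Poly_Mapping.lookup p m))"
      by (rule mpoly_expand)
    also have "\<dots> = mpoly_subst mvar p"
      unfolding mpoly_subst_def mono by (simp add: mult_single)
    finally show ?thesis .
  qed
  moreover have "P (mpoly_subst mvar p)"
    unfolding mpoly_subst_def mono_eval_def
    by (intro sum mult const prod pow var)
  ultimately show ?thesis by simp
qed

lemma mpolys_mconst: "mconst c \<in> mpolys n"
  by (auto simp: mpolys_def)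

lemma mpolys_add: "p \<in> mpolys n \<Longrightarrow> q \<in> mpolys n \<Longrightarrow> p + q \<in> mpolys n"
  unfolding mpolys_def using Poly_Mapping.keys_add[of p q] by blast

text \<open>Polynomials may involve variables \<open>X\<^sub>i\<close> with \<open>i \<ge> n\<close>; on \<open>affine_space n\<close> these take the
  constant value \<open>undefined\<close>.\<close>

lemma mpoly_restrict_vars:
  fixes p :: "'k::comm_ring_1 mpoly"
  obtains q where "q \<in> mpolys n" "\<And>x. x \<in> affine_space n \<Longrightarrow> mpoly_eval x q = mpoly_eval x p"
proof -
  have "\<exists>q\<in>mpolys n. \<forall>x\<in>affine_space n. mpoly_eval x q = mpoly_eval x p"
  proof (induction p rule: mpoly_induct)
    case (const c)
    then show ?case using mpolys_mconst[of c] by blast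
  next
    case (var i)
    show ?case
    proof (cases "i < n")
      case True
      then have "mvar i \<in> mpolys n" by (auto simp: mpolys_def)
      then show ?thesis by blast
    next
      case False
      then have "mpoly_eval x (mconst undefined) = mpoly_eval x (mvar i)" if "x \<in> affine_space n" for x :: "nat \<Rightarrow> 'k"
        using that by (auto simp: affine_space_def PiE_def extensional_def)
      then show ?thesis using mpolys_mconst by blast
    qed
  next
    case (add p q)
    then obtain p' q' where "p' \<in> mpolys n" "q' \<in> mpolys n"
      "\<forall>x\<in>affine_space n. mpoly_eval x p' = mpoly_eval x p"
      "\<forall>x\<in>affine_space n. mpoly_eval x q' = mpoly_eval x q" by blast
    then show ?case by (intro bexI[of _ "p' + q'"] mpolys_add) (auto simp: mpoly_eval_add)
  next
    case (mult p q)
    then obtain p' q' where "p' \<in> mpolys n" "q' \<in> mpolys n"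
      "\<forall>x\<in>affine_space n. mpoly_eval x p' = mpoly_eval x p"
      "\<forall>x\<in>affine_space n. mpoly_eval x q' = mpoly_eval x q" by blast
    then show ?case by (intro bexI[of _ "p' * q'"] mpolys_mult) (auto simp: mpoly_eval_mult)
  qed
  then show thesis using that by blast
qed

text \<open>Taken in the ring in all variables: for \<open>C\<close> inside
  \<open>affine_space n\<close> it also contains each variable of index at least \<open>n\<close>
  minus the constant \<open>undefined\<close>, and the residue ring is the coordinate ring.\<close>

definition vanishing_ideal :: "(nat \<Rightarrow> 'k) set \<Rightarrow> 'k::comm_ring_1 mpoly set" where
  "vanishing_ideal C = {p. \<forall>x\<in>C. mpoly_eval x p = 0}"

lemma is_ideal_vanishing: "is_ideal (vanishing_ideal C)"
  by (rule is_idealI) (auto simp: vanishing_ideal_def mpoly_eval_add mpoly_eval_mult)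

lemma vanishing_idealD: "p \<in> vanishing_ideal C \<Longrightarrow> x \<in> C \<Longrightarrow> mpoly_eval x p = 0"
  by (simp add: vanishing_ideal_def)

lemma vanishing_ideal_mono: "C \<subseteq> D \<Longrightarrow> vanishing_ideal D \<subseteq> vanishing_ideal C"
  by (auto simp: vanishing_ideal_def)

lemma closedin_zariski_zero_locus: "closedin (zariski n) (zero_locus n (S :: 'k::field mpoly set))"
proof -
  let ?T = "{q\<in>mpolys n. \<exists>p\<in>S. \<forall>x\<in>affine_space n. mpoly_eval x q = mpoly_eval x p}"
  have "zero_locus n S = zero_locus n ?T"
  proof (intro subset_antisym subsetI)
    fix x assume x: "x \<in> zero_locus n ?T"
    have "mpoly_eval x p = 0" if "p \<in> S" for p
    proof -
      obtain q where q: "q \<in> mpolys n" "\<And>x. x \<in> affine_space n \<Longrightarrow> mpoly_eval x q = mpoly_eval x p"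
        using mpoly_restrict_vars[of n p] by blast
      then have "q \<in> ?T" using that by blast
      then show ?thesis using x q(2)[of x] by (simp add: zero_locus_def)
    qed
    then show "x \<in> zero_locus n S" using x by (simp add: zero_locus_def)
  qed (auto simp: zero_locus_def)
  then show ?thesis unfolding closedin_zariski by (intro exI[of _ ?T]) auto
qed

lemma closedin_zariski_memI:
  assumes "closedin (zariski n) C" "x \<in> affine_space n"
    and "\<And>p. p \<in> vanishing_ideal C \<Longrightarrow> mpoly_eval x p = 0"
  shows "x \<in> C"
proof -
  obtain S where C: "C = zero_locus n S" using assms(1) closedin_zariski by blast
  then have "p \<in> vanishing_ideal C" if "p \<in> S" for p
    using that by (auto simp: vanishing_ideal_def zero_locus_def)
  then show ?thesis using assms(2,3) by (auto simp: C zero_locus_def)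
qed

lemma closedin_zariski_subset: "closedin (zariski n) C \<Longrightarrow> C \<subseteq> affine_space n"
  using closedin_subset by fastforce

text \<open>A product vanishing on \<open>C\<close> covers \<open>C\<close> by two relatively closed
  sets; conversely, points missed by two closed sets give separating polynomials whose product
  vanishes on the union. The form for arbitrary subsets serves components, whose closedness emerges
  only in \<open>irreducible_component_preimage\<close>.\<close>

lemma irreducible_iff_prime:
  fixes C :: "(nat \<Rightarrow> 'k::field) set"
  assumes C: "C \<subseteq> affine_space n"
  shows "irreducible_space (subtopology (zariski n) C) \<longleftrightarrow> is_prime_ideal (vanishing_ideal C)"
proof (rule iffI)
  assume irr: "irreducible_space (subtopology (zariski n) C)"
  have top: "topspace (subtopology (zariski n) C) = C" using C by auto
  from irr obtain x where x: "x \<in> C" unfolding irreducible_space_def top by blast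
  have "p \<in> vanishing_ideal C \<or> q \<in> vanishing_ideal C" if pq: "p * q \<in> vanishing_ideal C" for p q
  proof -
    let ?A = "zero_locus n {p} \<inter> C" and ?B = "zero_locus n {q} \<inter> C"
    have "closedin (subtopology (zariski n) C) ?A" "closedin (subtopology (zariski n) C) ?B"
      using closedin_zariski_zero_locus by (auto simp: closedin_subtopology)
    moreover have "?A \<union> ?B = C"
      using pq C by (auto simp: zero_locus_def vanishing_ideal_def mpoly_eval_mult)
    ultimately have "?A = C \<or> ?B = C" using irr unfolding irreducible_space_def top by blast
    then show ?thesis by (auto simp: zero_locus_def vanishing_ideal_def)
  qed
  then show "is_prime_ideal (vanishing_ideal C)"
    using x is_ideal_vanishing by (auto simp: is_prime_ideal_def vanishing_ideal_def)
next
  assume prime: "is_prime_ideal (vanishing_ideal C)"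
  have top: "topspace (subtopology (zariski n) C) = C" using C by auto
  show "irreducible_space (subtopology (zariski n) C)"
    unfolding irreducible_space_def top
  proof (intro conjI allI impI)
    show "C \<noteq> {}" using prime by (auto simp: is_prime_ideal_def vanishing_ideal_def)
    fix A B assume AB: "closedin (subtopology (zariski n) C) A \<and>
      closedin (subtopology (zariski n) C) B \<and> A \<union> B = C"
    obtain A' where A: "closedin (zariski n) A'" "A = A' \<inter> C" using AB by (auto simp: closedin_subtopology)
    obtain B' where B: "closedin (zariski n) B'" "B = B' \<inter> C" using AB by (auto simp: closedin_subtopology)
    show "A = C \<or> B = C"
    proof (rule ccontr)
      assume "\<not> (A = C \<or> B = C)"
      then obtain x y where x: "x \<in> C" "x \<notin> A'" and y: "y \<in> C" "y \<notin> B'" using A B by blast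
      obtain p where p: "p \<in> vanishing_ideal A'" "mpoly_eval x p \<noteq> 0"
        using closedin_zariski_memI[OF A(1), of x] x C by blast
      obtain q where q: "q \<in> vanishing_ideal B'" "mpoly_eval y q \<noteq> 0"
        using closedin_zariski_memI[OF B(1), of y] y C by blast
      have "mpoly_eval z (p * q) = 0" if "z \<in> C" for z
      proof -
        have "z \<in> A' \<or> z \<in> B'" using that AB A(2) B(2) by blast
        then show ?thesis
          using vanishing_idealD[OF p(1), of z] vanishing_idealD[OF q(1), of z]
          by (auto simp: mpoly_eval_mult)
      qed
      then have "p * q \<in> vanishing_ideal C" by (simp add: vanishing_ideal_def)
      then have "p \<in> vanishing_ideal C \<or> q \<in> vanishing_ideal C"
        using prime by (simp add: is_prime_ideal_def)
      then show False using p(2) q(2) x(1) y(1) by (auto simp: vanishing_ideal_def)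
    qed
  qed
qed

text \<open>When every polynomial is constant modulo \<open>Q\<close>, the residues of the variables
  are the coordinates of a point, and evaluation there is reduction modulo \<open>Q\<close>.\<close>

lemma prime_ideal_point:
  fixes Q :: "'k::field mpoly set"
  assumes Q: "is_prime_ideal Q" and V: "closedin (zariski n) V" "V \<noteq> {}" "vanishing_ideal V \<subseteq> Q"
    and const: "\<And>p. \<exists>c. p - mconst c \<in> Q"
  obtains x where "x \<in> V" "\<And>p. p \<in> Q \<Longrightarrow> mpoly_eval x p = 0"
proof -
  have I: "is_ideal Q" and "1 \<notin> Q" using Q by (auto simp: is_prime_ideal_def)
  have const0: "c = 0" if "mconst c \<in> Q" for c
  proof (rule ccontr)
    assume "c \<noteq> 0"
    then have "mconst (inverse c) * mconst c = 1" by (simp add: mult_single)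
    then show False using ideal_mult[OF I that, of "mconst (inverse c)"] \<open>1 \<notin> Q\<close> by simp
  qed
  have "\<forall>i. \<exists>c. mvar i - mconst c \<in> Q" using const by blast
  from choice[OF this] obtain x where x: "\<And>i. mvar i - mconst (x i) \<in> Q" by blast
  have eval: "p - mconst (mpoly_eval x p) \<in> Q" for p
  proof (induction p rule: mpoly_induct)
    case (const c)
    then show ?case using ideal_zero[OF I] by simp
  next
    case (var i)
    then show ?case using x by simp
  next
    case (add p q)
    have "p + q - mconst (mpoly_eval x (p + q)) = (p - mconst (mpoly_eval x p)) + (q - mconst (mpoly_eval x q))"
      by (simp add: mpoly_eval_add single_add)
    then show ?case using ideal_add[OF I add] by (simp only:)
  next
    case (mult p q)
    have "mconst (mpoly_eval x (p * q)) = mconst (mpoly_eval x p) * mconst (mpoly_eval x q)"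
      by (simp add: mpoly_eval_mult mult_single)
    then have "p * q - mconst (mpoly_eval x (p * q)) =
        q * (p - mconst (mpoly_eval x p)) + mconst (mpoly_eval x p) * (q - mconst (mpoly_eval x q))"
      by (simp only:) (simp add: algebra_simps)
    then show ?case
      using ideal_add[OF I ideal_mult[OF I mult(1)] ideal_mult[OF I mult(2)]] by (simp only:)
  qed
  have Q0: "mpoly_eval x p = 0" if "p \<in> Q" for p
    using const0 ideal_diff[OF I that eval[of p]] by simp
  \<comment> \<open>A variable of index at least \<open>n\<close> minus \<open>undefined\<close>
    vanishes on \<open>V\<close> and so lies in \<open>Q\<close>; this gives extensionality of
    \<open>x\<close>.\<close>
  have "x \<in> affine_space n"
    unfolding affine_space_def PiE_def extensional_def
  proof (intro IntI CollectI allI impI)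
    fix i assume "i \<notin> {..<n}"
    then have "mvar i - mconst undefined \<in> vanishing_ideal V"
      using closedin_zariski_subset[OF V(1)]
      by (auto simp: vanishing_ideal_def mpoly_eval_diff affine_space_def PiE_def extensional_def)
    then have "mpoly_eval x (mvar i - mconst undefined) = 0" using V(3) Q0 by blast
    then show "x i = undefined" by (simp add: mpoly_eval_diff)
  qed auto
  then have "x \<in> V" using closedin_zariski_memI[OF V(1)] V(3) Q0 by blast
  then show thesis using that Q0 by blast
qed

section \<open>Finite morphisms\<close>

lemma hpoly_eval_comp:
  assumes "f 0 = 0" "g 0 = 0"
  shows "hpoly (\<lambda>a. f (g a)) P x = hpoly f (map_poly g P) x"
  unfolding hpoly_def by (simp add: map_poly_map_poly assms comp_def)

lemma mconst_hom: "is_ring_hom (mconst :: 'k::comm_ring_1 \<Rightarrow> 'k mpoly)"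
  by (simp add: is_ring_hom_def single_add mult_single)

lemma mpoly_eval_hpoly:
  assumes "is_ring_hom h" and "\<And>a. mpoly_eval x (h a) = mpoly_eval y a"
  shows "mpoly_eval x (hpoly h P f) = poly (map_poly (mpoly_eval y) P) (mpoly_eval x f)"
  by (induction P)
    (simp_all add: hpoly_pCons[OF assms(1)] hpoly_0[OF assms(1)] mpoly_eval_add mpoly_eval_mult assms(2) map_poly_pCons)

lemma lead_coeff_map_poly_monic:
  assumes "is_ring_hom f" and "Polynomial.lead_coeff P = 1" and "f 1 \<noteq> 0"
  shows "Polynomial.lead_coeff (map_poly f P) = 1"
proof -
  have "Polynomial.degree (map_poly f P) = Polynomial.degree P"
    by (rule map_poly_degree_eq) (simp add: assms(2,3))
  then show ?thesis by (simp add: coeff_map_poly hom_zero[OF assms(1)] assms(2) hom_one[OF assms(1)])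
qed

text \<open>\<open>h\<close> lifts the pullback along \<open>\<phi>\<close> to the ring in all
  variables, and \<open>gen\<close> says that \<open>G\<close> generates k[V] as a module over k[Y]
  through \<open>h\<close>.\<close>

locale finite_cover =
  fixes m n :: nat and V Y :: "(nat \<Rightarrow> 'k::alg_closed_field) set"
    and \<phi> :: "(nat \<Rightarrow> 'k) \<Rightarrow> nat \<Rightarrow> 'k"
    and h :: "'k mpoly \<Rightarrow> 'k mpoly" and G :: "'k mpoly set"
  assumes V_closed: "closedin (zariski m) V" and Y_closed: "closedin (zariski n) Y"
    and V_nonempty: "V \<noteq> {}"
    and \<phi>: "\<phi> \<in> V \<rightarrow> Y"
    and h: "is_ring_hom h"
    and eval_h: "\<And>x a. x \<in> V \<Longrightarrow> mpoly_eval x (h a) = mpoly_eval (\<phi> x) a"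
    and h_mconst: "\<And>c. h (mconst c) = mconst c"
    and fin_G: "finite G"
    and gen: "\<And>b. \<exists>c. b - (\<Sum>g\<in>G. h (c g) * g) \<in> vanishing_ideal V"
begin

lemma \<phi>_affine: "x \<in> V \<Longrightarrow> \<phi> x \<in> affine_space n"
  using \<phi> closedin_zariski_subset[OF Y_closed] by blast

text \<open>Multiplication by \<open>f\<close> acts on the generators, so the determinant trick with
  \<open>b = 1\<close> gives a monic expression annihilating all of \<open>G\<close>, hence also 1,
  which is a combination of generators.\<close>

lemma integral:
  obtains F where "Polynomial.lead_coeff F = 1" "hpoly h F f \<in> vanishing_ideal V"
proof -
  let ?I = "vanishing_ideal V"
  note I = is_ideal_vanishing[of V]
  have "\<forall>b. \<exists>c. b - (\<Sum>g\<in>G. h (c g) * g) \<in> ?I" using gen by blast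
  from choice[OF this] obtain a where a: "\<And>b. b - (\<Sum>g\<in>G. h (a b g) * g) \<in> ?I" by blast
  have "\<exists>e c. \<forall>g\<in>G. (f ^ e + (\<Sum>i<e. h (c i) * f ^ i * 1 ^ (e - i))) * g \<in> ?I"
    by (rule integral_relation[OF h I fin_G, where a = "\<lambda>g. a (f * g)"]) (use a in simp)
  then obtain e c where ec: "\<And>g. g \<in> G \<Longrightarrow> (f ^ e + (\<Sum>i<e. h (c i) * f ^ i)) * g \<in> ?I" by auto
  let ?r = "f ^ e + (\<Sum>i<e. h (c i) * f ^ i)"
  have "?r = ?r * (1 - (\<Sum>g\<in>G. h (a 1 g) * g)) + (\<Sum>g\<in>G. h (a 1 g) * (?r * g))"
    by (simp only: right_diff_distrib sum_distrib_left mult.left_commute[of ?r] mult_1_right diff_add_cancel)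
  also have "\<dots> \<in> ?I"
    by (intro ideal_add[OF I] ideal_sum[OF I]; rule ideal_mult[OF I]) (use a[of 1] ec in auto)
  finally have r: "?r \<in> ?I" .
  define F where "F = Polynomial.monom 1 e + (\<Sum>i<e. Polynomial.monom (c i) i)"
  have cF: "Polynomial.coeff F i = (if i = e then 1 else if i < e then c i else 0)" for i
    by (auto simp: F_def coeff_sum)
  have "Polynomial.degree F = e"
    by (rule antisym, rule degree_le, simp add: cF, rule le_degree, simp add: cF)
  then have "Polynomial.lead_coeff F = 1" using cF[of e] by simp
  moreover have "hpoly h F f = ?r"
    by (simp add: F_def hpoly_add[OF h] hpoly_sum[OF h] hpoly_monom[OF h] hom_one[OF h])
  ultimately show thesis using that r by metis
qed

text \<open>This takes the place of the Nullstellensatz. A monic relation for \<open>p\<close>,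
  specialised at \<open>y\<close>, becomes a monic polynomial over the field that \<open>p\<close>
  satisfies modulo \<open>Q\<close>. It splits into linear factors, and primality makes
  \<open>p\<close> congruent to one of its roots, so \<open>prime_ideal_point\<close>
  applies.\<close>

lemma point_over:
  assumes Q: "is_prime_ideal Q" "vanishing_ideal V \<subseteq> Q"
    and y: "\<And>a. mpoly_eval y a = 0 \<Longrightarrow> h a \<in> Q"
  obtains x where "x \<in> V" "\<phi> x = y" "\<And>p. p \<in> Q \<Longrightarrow> mpoly_eval x p = 0"
proof -
  have I: "is_ideal Q" using Q(1) by (simp add: is_prime_ideal_def)
  have "\<exists>c. p - mconst c \<in> Q" for p
  proof -
    obtain F where F: "Polynomial.lead_coeff F = 1" "hpoly h F p \<in> vanishing_ideal V" by (rule integral)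
    let ?e = "\<lambda>a. mconst (mpoly_eval y a)"
    let ?F = "map_poly (mpoly_eval y) F"
    have e: "is_ring_hom ?e"
      by (simp add: is_ring_hom_def mpoly_eval_add mpoly_eval_mult single_add mult_single)
    have "hpoly h P p - hpoly ?e P p \<in> Q" for P
    proof (induction P)
      case 0
      then show ?case using ideal_zero[OF I] by (simp add: hpoly_def)
    next
      case (pCons a P)
      have "mpoly_eval y (a - ?e a) = 0" by (simp add: mpoly_eval_diff)
      from y[OF this] have 1: "h a - ?e a \<in> Q" by (simp add: hom_diff[OF h] h_mconst)
      have "hpoly h (pCons a P) p - hpoly ?e (pCons a P) p =
          (h a - ?e a) + p * (hpoly h P p - hpoly ?e P p)"
        by (simp only: hpoly_pCons[OF h] hpoly_pCons[OF e]) (simp add: algebra_simps)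
      then show ?case using ideal_add[OF I 1 ideal_mult[OF I pCons.IH]] by (simp only:)
    qed
    then have "hpoly ?e F p \<in> Q" using ideal_diff_iff[OF I] F(2) Q(2) by blast
    then have FQ: "hpoly mconst ?F p \<in> Q"
      by (subst (asm) hpoly_eval_comp) auto
    have "Polynomial.lead_coeff ?F = 1"
      by (rule lead_coeff_map_poly_monic[OF mpoly_eval_hom F(1)]) simp
    then obtain A where A: "?F = (\<Prod>c\<in>#A. [:- c, 1:])"
      using alg_closed_imp_factorization[of ?F] by force
    have "hpoly mconst [:- c, 1:] p = p - mconst c" for c
      by (simp add: hpoly_pCons[OF mconst_hom] hpoly_0[OF mconst_hom] hom_uminus[OF mconst_hom])
    then have "hpoly mconst (\<Prod>c\<in>#B. [:- c, 1:]) p = (\<Prod>c\<in>#B. p - mconst c)" for B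
      by (induction B)
        (simp_all del: mult_pCons_left add: hpoly_mult[OF mconst_hom] hpoly_1[OF mconst_hom])
    then have "(\<Prod>c\<in>#A. p - mconst c) \<in> Q" using FQ A by simp
    then show ?thesis using prime_ideal_prod_mset[OF Q(1)] by blast
  qed
  from prime_ideal_point[OF Q(1) V_closed V_nonempty Q(2) this]
  obtain x where x: "x \<in> V" "\<And>p. p \<in> Q \<Longrightarrow> mpoly_eval x p = 0" by blast
  have "\<phi> x i = y i" for i
  proof -
    have "mpoly_eval y (mvar i - mconst (y i)) = 0" by (simp add: mpoly_eval_diff)
    from x(2)[OF y[OF this]] show ?thesis by (simp add: eval_h[OF x(1)] mpoly_eval_diff)
  qed
  then show thesis using that x by blast
qed

text \<open>\<open>Q\<close> and the pullbacks of polynomials vanishing at \<open>y\<close> lie in a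
  common proper ideal by \<open>nakayama\<close>: if \<open>1 + h a\<close> were in
  \<open>Q\<close>, the hypothesis on \<open>y\<close> would make \<open>1 + a\<close> vanish at
  \<open>y\<close> along with \<open>a\<close>. A prime above that ideal gives the point through
  \<open>point_over\<close>.\<close>

lemma lying_over:
  assumes Q: "is_ideal Q" "vanishing_ideal V \<subseteq> Q"
    and y: "\<And>a. h a \<in> Q \<Longrightarrow> mpoly_eval y a = 0"
  obtains x where "x \<in> V" "\<phi> x = y" "\<And>p. p \<in> Q \<Longrightarrow> mpoly_eval x p = 0"
proof -
  let ?N = "{h a | a. mpoly_eval y a = 0}"
  obtain J where J: "is_ideal J" "Q \<subseteq> J" "?N \<subseteq> J" "1 \<notin> J"
  proof (rule nakayama[OF Q(1) fin_G, of "range h" ?N])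
    show "\<exists>c. (\<forall>g\<in>G. c g \<in> range h) \<and> b - (\<Sum>g\<in>G. c g * g) \<in> Q" for b
    proof -
      obtain c where "b - (\<Sum>g\<in>G. h (c g) * g) \<in> vanishing_ideal V" using gen by blast
      then show ?thesis using Q(2) by (intro exI[of _ "\<lambda>g. h (c g)"]) auto
    qed
    show "0 \<in> ?N" using hom_zero[OF h] by (intro CollectI exI[of _ 0]) simp
    show "a + b \<in> ?N" if ab: "a \<in> ?N" "b \<in> ?N" for a b
    proof -
      obtain a' b' where "a = h a'" "b = h b'" "mpoly_eval y a' = 0" "mpoly_eval y b' = 0" using ab by blast
      then show ?thesis by (intro CollectI exI[of _ "a' + b'"]) (simp add: hom_add[OF h] mpoly_eval_add)
    qed
    show "- a \<in> ?N" if a: "a \<in> ?N" for a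
    proof -
      obtain a' where "a = h a'" "mpoly_eval y a' = 0" using a by blast
      then show ?thesis
        by (intro CollectI exI[of _ "- a'"]) (simp add: hom_uminus[OF h] hom_uminus[OF mpoly_eval_hom])
    qed
    show "s * a \<in> ?N" if sa: "s \<in> range h" "a \<in> ?N" for s a
    proof -
      obtain s' a' where "s = h s'" "a = h a'" "mpoly_eval y a' = 0" using sa by blast
      then show ?thesis by (intro CollectI exI[of _ "s' * a'"]) (simp add: hom_mult[OF h] mpoly_eval_mult)
    qed
    show "1 + a \<notin> Q" if a: "a \<in> ?N" for a
    proof
      assume 1: "1 + a \<in> Q"
      obtain a' where a': "a = h a'" "mpoly_eval y a' = 0" using a by blast
      have "h (1 + a') \<in> Q" using 1 a' by (simp add: hom_add[OF h] hom_one[OF h])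
      from y[OF this] show False using a'(2) by (simp add: mpoly_eval_add)
    qed
  qed auto
  obtain Q' where Q': "is_prime_ideal Q'" "J \<subseteq> Q'"
    using prime_avoiding_exists[OF J(1), of "{1}"] J(4) by auto
  have Q'_V: "vanishing_ideal V \<subseteq> Q'" using Q(2) J(2) Q'(2) by blast
  have Q'_y: "h a \<in> Q'" if "mpoly_eval y a = 0" for a using that J(3) Q'(2) by blast
  obtain x where "x \<in> V" "\<phi> x = y" "\<And>p. p \<in> Q' \<Longrightarrow> mpoly_eval x p = 0"
    using point_over[OF Q'(1) Q'_V, of y] Q'_y by blast
  then show thesis using that[of x] J(2) Q'(2) by blast
qed

text \<open>The constant term of a monic relation of minimal degree for \<open>f\<close> modulo \<open>Q\<close> is a
  multiple of \<open>f\<close> outside \<open>Q\<close>.\<close>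

lemma pullback_multiple_notin_prime:
  assumes Q: "is_prime_ideal Q" "vanishing_ideal V \<subseteq> Q" and f: "f \<notin> Q"
  obtains a g where "h a \<notin> Q" "h a - f * g \<in> Q"
proof -
  have I: "is_ideal Q" using Q(1) by (simp add: is_prime_ideal_def)
  have *: "\<exists>a g. h a \<notin> Q \<and> h a - f * g \<in> Q" if "Polynomial.lead_coeff F = 1" "hpoly h F f \<in> Q" for F
    using that
  proof (induction F)
    case 0
    then show ?case by simp
  next
    case (pCons a F)
    have rel: "h a + f * hpoly h F f \<in> Q" using pCons.prems(2) by (simp add: hpoly_pCons[OF h])
    show ?case
    proof (cases "h a \<in> Q")
      case False
      then show ?thesis using rel by (intro exI[of _ a] exI[of _ "- hpoly h F f"]) simp
    next
      case True
      have "F \<noteq> 0"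
        using True pCons.prems(1) Q(1) hom_one[OF h] by (auto simp: is_prime_ideal_def)
      then have "Polynomial.lead_coeff F = 1" using pCons.prems(1) by simp
      moreover have "f * hpoly h F f \<in> Q" using ideal_diff[OF I rel True] by simp
      then have "hpoly h F f \<in> Q" using f Q(1) by (auto simp: is_prime_ideal_def)
      ultimately show ?thesis by (rule pCons.IH)
    qed
  qed
  obtain F where F: "Polynomial.lead_coeff F = 1" "hpoly h F f \<in> vanishing_ideal V"
    by (rule integral)
  then have "hpoly h F f \<in> Q" using Q(2) by blast
  from *[OF F(1) this] show thesis using that by (elim exE conjE)
qed

lemma pullback_vanishing_iff: "C \<subseteq> V \<Longrightarrow> h a \<in> vanishing_ideal C \<longleftrightarrow> a \<in> vanishing_ideal (\<phi> ` C)"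
  using eval_h by (auto simp: vanishing_ideal_def subset_iff)

lemma prime_vanishing_image:
  assumes "C \<subseteq> V" "is_prime_ideal (vanishing_ideal C)"
  shows "is_prime_ideal (vanishing_ideal (\<phi> ` C))"
  using assms(2) is_ideal_vanishing[of "\<phi> ` C"]
  unfolding is_prime_ideal_def pullback_vanishing_iff[OF assms(1), symmetric]
  by (auto simp: hom_one[OF h] hom_mult[OF h])

text \<open>If \<open>y\<close> satisfies all equations of the image, \<open>lying_over\<close> for
  the ideal of \<open>C\<close> produces a point over \<open>y\<close> at which that ideal vanishes,
  which is a point of \<open>C\<close>.\<close>

lemma closed_image:
  assumes C: "closedin (zariski m) C" "C \<subseteq> V"
  shows "closedin (zariski n) (\<phi> ` C)"
proof -
  have "\<phi> ` C = zero_locus n (vanishing_ideal (\<phi> ` C))"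
  proof (intro subset_antisym subsetI)
    fix y assume "y \<in> \<phi> ` C"
    then show "y \<in> zero_locus n (vanishing_ideal (\<phi> ` C))"
      using C(2) \<phi>_affine by (auto simp: zero_locus_def vanishing_ideal_def)
  next
    fix y assume y: "y \<in> zero_locus n (vanishing_ideal (\<phi> ` C))"
    obtain x where "x \<in> V" "\<phi> x = y" "\<And>p. p \<in> vanishing_ideal C \<Longrightarrow> mpoly_eval x p = 0"
    proof (rule lying_over[OF is_ideal_vanishing vanishing_ideal_mono[OF C(2)]])
      show "mpoly_eval y a = 0" if "h a \<in> vanishing_ideal C" for a
        using that y by (simp add: pullback_vanishing_iff[OF C(2)] zero_locus_def)
    qed blast
    then show "y \<in> \<phi> ` C"
      using closedin_zariski_memI[OF C(1)] closedin_zariski_subset[OF V_closed] by blast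
  qed
  then show ?thesis using closedin_zariski_zero_locus by metis
qed

lemma preimage_closed:
  assumes "closedin (zariski n) D"
  shows "closedin (zariski m) {x \<in> V. \<phi> x \<in> D}"
proof -
  have "{x \<in> V. \<phi> x \<in> D} = V \<inter> zero_locus m (h ` vanishing_ideal D)"
    using eval_h \<phi>_affine closedin_zariski_memI[OF assms] closedin_zariski_subset[OF V_closed]
    by (fastforce simp: zero_locus_def vanishing_idealD)
  then show ?thesis using closedin_Int[OF V_closed closedin_zariski_zero_locus] by metis
qed

text \<open>No Nullstellensatz is needed here: that \<open>Q\<close> is the full ideal of its zero locus
  follows from the same property of its contraction, which is the ideal of \<open>D\<close>.\<close>

lemma prime_over_closed:
  assumes D: "closedin (zariski n) D"
    and Q: "is_prime_ideal Q" "vanishing_ideal V \<subseteq> Q"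
    and contr: "\<And>a. h a \<in> Q \<longleftrightarrow> a \<in> vanishing_ideal D"
  shows "zero_locus m Q \<subseteq> V" "\<phi> ` zero_locus m Q = D" "vanishing_ideal (zero_locus m Q) = Q"
proof -
  let ?C = "zero_locus m Q"
  have I: "is_ideal Q" using Q(1) by (simp add: is_prime_ideal_def)
  show CV: "?C \<subseteq> V"
    using closedin_zariski_memI[OF V_closed] Q(2) by (auto simp: zero_locus_def)
  show im: "\<phi> ` ?C = D"
  proof (intro subset_antisym subsetI)
    fix y assume "y \<in> \<phi> ` ?C"
    then obtain x where x: "x \<in> ?C" "y = \<phi> x" by blast
    have "mpoly_eval (\<phi> x) a = 0" if "a \<in> vanishing_ideal D" for a
      using that x(1) CV contr eval_h[of x a] by (auto simp: zero_locus_def)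
    then show "y \<in> D" using closedin_zariski_memI[OF D] \<phi>_affine x CV by blast
  next
    fix y assume y: "y \<in> D"
    obtain x where "x \<in> V" "\<phi> x = y" "\<And>p. p \<in> Q \<Longrightarrow> mpoly_eval x p = 0"
    proof (rule lying_over[OF I Q(2)])
      show "mpoly_eval y a = 0" if "h a \<in> Q" for a using that y contr vanishing_idealD by blast
    qed blast
    then show "y \<in> \<phi> ` ?C"
      using closedin_zariski_subset[OF V_closed] by (auto simp: zero_locus_def)
  qed
  show "vanishing_ideal ?C = Q"
  proof (intro subset_antisym subsetI)
    fix f assume f: "f \<in> vanishing_ideal ?C"
    show "f \<in> Q"
    proof (rule ccontr)
      \<comment> \<open>Some multiple of \<open>f\<close> is congruent modulo \<open>Q\<close> to a
        pullback \<open>h a\<close> outside \<open>Q\<close>. It vanishes on \<open>?C\<close>, so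
        \<open>a\<close> vanishes on \<open>D\<close>, and \<open>contr\<close> puts
        \<open>h a\<close> into \<open>Q\<close>.\<close>
      assume "f \<notin> Q"
      then obtain a g where ag: "h a \<notin> Q" "h a - f * g \<in> Q"
        by (rule pullback_multiple_notin_prime[OF Q])
      have "Q \<subseteq> vanishing_ideal ?C" by (auto simp: zero_locus_def vanishing_ideal_def)
      then have "h a - f * g \<in> vanishing_ideal ?C" using ag(2) by blast
      moreover have "f * g \<in> vanishing_ideal ?C"
        using ideal_mult[OF is_ideal_vanishing f, of g] by (simp add: mult.commute)
      ultimately have "h a \<in> vanishing_ideal ?C" using ideal_diff_iff[OF is_ideal_vanishing] by blast
      then show False using ag(1) contr im by (simp add: pullback_vanishing_iff[OF CV])
    qed
  qed (auto simp: zero_locus_def vanishing_ideal_def)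
qed

section \<open>Lifting irreducible closed sets, and incomparability\<close>

text \<open>A prime containing the ideal of \<open>T\<close> and missing \<open>M\<close> contracts
  exactly to the ideal of \<open>D\<close>: one inclusion holds because \<open>T\<close> maps into
  \<open>D\<close>, the other because of \<open>DM\<close>. \<open>irreducible_lift\<close> uses the
  smallest such \<open>M\<close>; the component argument enlarges it.\<close>

lemma irreducible_lift_avoiding:
  assumes T: "closedin (zariski m) T" "T \<subseteq> V" and D: "closedin (zariski n) D" "\<phi> ` T \<subseteq> D"
    and M: "1 \<in> M" "\<And>a b. a \<in> M \<Longrightarrow> b \<in> M \<Longrightarrow> a * b \<in> M" "vanishing_ideal T \<inter> M = {}"
    and DM: "\<And>a. a \<notin> vanishing_ideal D \<Longrightarrow> h a \<in> M"
  obtains C where "closedin (zariski m) C" "C \<subseteq> T" "is_prime_ideal (vanishing_ideal C)"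
    "\<phi> ` C = D" "vanishing_ideal C \<inter> M = {}"
proof -
  obtain Q where Q: "is_prime_ideal Q" "vanishing_ideal T \<subseteq> Q" "Q \<inter> M = {}"
    using prime_avoiding_exists[OF is_ideal_vanishing M] by blast
  have QV: "vanishing_ideal V \<subseteq> Q" using vanishing_ideal_mono[OF T(2)] Q(2) by blast
  have contr: "h a \<in> Q \<longleftrightarrow> a \<in> vanishing_ideal D" for a
  proof
    assume "a \<in> vanishing_ideal D"
    then have "a \<in> vanishing_ideal (\<phi> ` T)" using vanishing_ideal_mono[OF D(2)] by blast
    then show "h a \<in> Q" using Q(2) pullback_vanishing_iff[OF T(2)] by blast
  next
    assume "h a \<in> Q"
    then show "a \<in> vanishing_ideal D" using DM Q(3) by blast
  qed
  note C = prime_over_closed[OF D(1) Q(1) QV contr]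
  have "zero_locus m Q \<subseteq> T"
    using closedin_zariski_memI[OF T(1)] Q(2) by (auto simp: zero_locus_def)
  then show thesis using that[OF closedin_zariski_zero_locus] C Q(1,3) by simp
qed

lemma irreducible_lift:
  assumes E: "closedin (zariski m) E" "E \<subseteq> V"
    and D: "closedin (zariski n) D" "is_prime_ideal (vanishing_ideal D)" "D \<subseteq> \<phi> ` E"
  obtains C where "closedin (zariski m) C" "C \<subseteq> E" "is_prime_ideal (vanishing_ideal C)" "\<phi> ` C = D"
proof -
  let ?T = "E \<inter> {x \<in> V. \<phi> x \<in> D}" and ?M = "{h a | a. a \<notin> vanishing_ideal D}"
  have T: "closedin (zariski m) ?T" using E(1) preimage_closed[OF D(1)] by (rule closedin_Int)
  have im: "\<phi> ` ?T = D" using D(3) E(2) by auto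
  have TV: "?T \<subseteq> V" by blast
  have M1: "1 \<in> ?M"
    using D(2) hom_one[OF h] by (intro CollectI exI[of _ 1]) (simp add: is_prime_ideal_def)
  have M_mult: "a * b \<in> ?M" if ab: "a \<in> ?M" "b \<in> ?M" for a b
  proof -
    obtain a' b' where "a = h a'" "b = h b'" "a' \<notin> vanishing_ideal D" "b' \<notin> vanishing_ideal D"
      using ab by blast
    then show ?thesis using D(2)
      by (intro CollectI exI[of _ "a' * b'"]) (auto simp: hom_mult[OF h] is_prime_ideal_def)
  qed
  have disj: "vanishing_ideal ?T \<inter> ?M = {}"
    using pullback_vanishing_iff[OF TV] im by auto
  obtain C where "closedin (zariski m) C" "C \<subseteq> ?T" "is_prime_ideal (vanishing_ideal C)" "\<phi> ` C = D"
  proof (rule irreducible_lift_avoiding[OF T TV D(1) _ M1 _ disj])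
    show "\<phi> ` ?T \<subseteq> D" using im by simp
    show "a * b \<in> ?M" if "a \<in> ?M" "b \<in> ?M" for a b using that by (rule M_mult)
    show "h a \<in> ?M" if "a \<notin> vanishing_ideal D" for a using that by blast
  qed blast
  then show thesis using that by blast
qed

text \<open>Incomparability. A polynomial vanishing on \<open>C\<close> but not on \<open>C'\<close>
  has, modulo the ideal of \<open>C'\<close>, a pulled-back multiple with the same property, and the
  polynomial \<open>a\<close> behind it separates the images.\<close>

lemma image_psubset:
  assumes C: "closedin (zariski m) C" "C \<subset> C'" "C' \<subseteq> V" "is_prime_ideal (vanishing_ideal C')"
  shows "\<phi> ` C \<subset> \<phi> ` C'"
proof -
  obtain x where x: "x \<in> C'" "x \<notin> C" using C(2) by blast
  then have "x \<in> affine_space m" using C(3) closedin_zariski_subset[OF V_closed] by blast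
  then obtain f where f: "f \<in> vanishing_ideal C" "mpoly_eval x f \<noteq> 0"
    using closedin_zariski_memI[OF C(1)] x(2) by blast
  then have "f \<notin> vanishing_ideal C'" using x(1) vanishing_idealD by blast
  from pullback_multiple_notin_prime[OF C(4) vanishing_ideal_mono[OF C(3)] this]
  obtain a g where ag: "h a \<notin> vanishing_ideal C'" "h a - f * g \<in> vanishing_ideal C'" .
  have "h a - f * g \<in> vanishing_ideal C" using ag(2) vanishing_ideal_mono[of C C'] C(2) by blast
  moreover have "f * g \<in> vanishing_ideal C"
    using ideal_mult[OF is_ideal_vanishing f(1), of g] by (simp add: mult.commute)
  ultimately have "h a \<in> vanishing_ideal C" using ideal_diff_iff[OF is_ideal_vanishing] by blast
  then have "a \<in> vanishing_ideal (\<phi> ` C)" using pullback_vanishing_iff[of C a] C(2,3) by blast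
  moreover have "a \<notin> vanishing_ideal (\<phi> ` C')" using ag(1) pullback_vanishing_iff[OF C(3)] by blast
  ultimately have "\<phi> ` C \<noteq> \<phi> ` C'" by metis
  then show ?thesis using C(2) by blast
qed

end

section \<open>Krull dimension along a finite morphism\<close>

lemma krull_dim_closed:
  fixes Z :: "(nat \<Rightarrow> 'k::field) set"
  assumes Z: "closedin (zariski n) Z"
  shows "krull_dim (subtopology (zariski n) Z) = Sup {enat r | r. \<exists>C.
    (\<forall>i\<le>r. closedin (zariski n) (C i) \<and> C i \<subseteq> Z \<and> is_prime_ideal (vanishing_ideal (C i))) \<and>
    (\<forall>i<r. C i \<subset> C (Suc i))}"
proof -
  have "closedin (subtopology (zariski n) Z) C \<and> irreducible_space (subtopology (subtopology (zariski n) Z) C) \<longleftrightarrow>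
      closedin (zariski n) C \<and> C \<subseteq> Z \<and> is_prime_ideal (vanishing_ideal C)" for C
  proof (cases "closedin (zariski n) C \<and> C \<subseteq> Z")
    case True
    then have "subtopology (subtopology (zariski n) Z) C = subtopology (zariski n) C"
      by (simp add: subtopology_subtopology Int_absorb1)
    then show ?thesis
      using True irreducible_iff_prime[OF closedin_zariski_subset[of n C]] by (simp add: closedin_closed_subtopology[OF Z])
  next
    case False
    then show ?thesis by (auto simp: closedin_closed_subtopology[OF Z])
  qed
  then show ?thesis unfolding krull_dim_def by simp
qed

text \<open>If 0 were the only root, the factorisation would make \<open>p\<close> a multiple of a
  power of the variable, with no nonzero coefficient below the top.\<close>

lemma nonzero_root_exists:
  fixes p :: "'k::alg_closed_field poly"
  assumes "Polynomial.coeff p i \<noteq> 0" "i < Polynomial.degree p"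
  shows "\<exists>c. poly p c = 0 \<and> c \<noteq> 0"
proof (rule ccontr)
  assume contra: "\<not> ?thesis"
  obtain A where A: "size A = Polynomial.degree p"
    "p = Polynomial.smult (Polynomial.lead_coeff p) (\<Prod>c\<in>#A. [:- c, 1:])"
    using alg_closed_imp_factorization[of p] assms by force
  have "c = 0" if "c \<in># A" for c
  proof -
    have "poly (\<Prod>c\<in>#A. [:- c, 1:]) c = 0"
      using that by (auto simp: poly_prod_mset prod_mset_zero_iff)
    then have "poly p c = 0" by (subst A(2)) simp
    then show ?thesis using contra by blast
  qed
  then have "(\<Prod>c\<in>#A. [:- c, 1:]) = (\<Prod>c\<in>#A. [:0, 1 :: 'k:])"
    by (intro arg_cong[of _ _ prod_mset] image_mset_cong) simp
  also have "\<dots> = Polynomial.monom 1 (Polynomial.degree p)"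
    by (simp add: A(1) prod_mset_constant monom_altdef)
  finally have "Polynomial.coeff p i = 0"
    by (subst A(2)) (use assms(2) in simp)
  then show False using assms(1) by simp
qed

context finite_cover
begin

text \<open>Going up, run from the largest set downwards: each further lift is taken inside the
  previous one, which keeps the lifts nested.\<close>

lemma chain_lift:
  assumes "closedin (zariski m) E" "E \<subseteq> V"
    and "\<And>i. i \<le> r \<Longrightarrow> closedin (zariski n) (D i) \<and> is_prime_ideal (vanishing_ideal (D i))"
    and "\<And>i. i < r \<Longrightarrow> D i \<subset> D (Suc i)" and "D r \<subseteq> \<phi> ` E"
  shows "\<exists>C. (\<forall>i\<le>r. closedin (zariski m) (C i) \<and> C i \<subseteq> E \<and> is_prime_ideal (vanishing_ideal (C i)) \<and>
    \<phi> ` C i = D i) \<and> (\<forall>i<r. C i \<subseteq> C (Suc i))"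
  using assms
proof (induction r arbitrary: E)
  case 0
  then have D: "closedin (zariski n) (D 0)" "is_prime_ideal (vanishing_ideal (D 0))" by auto
  obtain C where "closedin (zariski m) C" "C \<subseteq> E" "is_prime_ideal (vanishing_ideal C)" "\<phi> ` C = D 0"
    by (rule irreducible_lift[OF "0.prems"(1,2) D "0.prems"(5)])
  then show ?case by (intro exI[of _ "\<lambda>_. C"]) auto
next
  case (Suc r)
  have D: "closedin (zariski n) (D (Suc r))" "is_prime_ideal (vanishing_ideal (D (Suc r)))"
    using Suc.prems(3) by auto
  obtain F where F: "closedin (zariski m) F" "F \<subseteq> E" "is_prime_ideal (vanishing_ideal F)"
    "\<phi> ` F = D (Suc r)"
    by (rule irreducible_lift[OF Suc.prems(1,2) D Suc.prems(5)])
  have "D r \<subseteq> \<phi> ` F" using Suc.prems(4)[of r] F(4) by auto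
  moreover have "F \<subseteq> V" using F(2) Suc.prems(2) by blast
  ultimately obtain C where C: "\<And>i. i \<le> r \<Longrightarrow> closedin (zariski m) (C i) \<and> C i \<subseteq> F \<and>
      is_prime_ideal (vanishing_ideal (C i)) \<and> \<phi> ` C i = D i" "\<And>i. i < r \<Longrightarrow> C i \<subseteq> C (Suc i)"
    using Suc.IH[OF F(1)] Suc.prems(3,4) by (metis le_SucI less_SucI)
  let ?C = "C(Suc r := F)"
  have "closedin (zariski m) (?C i) \<and> ?C i \<subseteq> E \<and> is_prime_ideal (vanishing_ideal (?C i)) \<and> \<phi> ` ?C i = D i"
    if "i \<le> Suc r" for i
    using that C(1)[of i] F by (cases "i = Suc r") auto
  moreover have "?C i \<subseteq> ?C (Suc i)" if "i < Suc r" for i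
    using that C(1)[of r] C(2)[of i] by (cases "i = r") auto
  ultimately show ?case by (intro exI[of _ ?C]) blast
qed

lemma krull_dim_image:
  assumes Z: "closedin (zariski m) Z" "Z \<subseteq> V"
  shows "krull_dim (subtopology (zariski m) Z) = krull_dim (subtopology (zariski n) (\<phi> ` Z))"
proof -
  let ?chain = "\<lambda>n Z r C. (\<forall>i\<le>r. closedin (zariski n) (C i) \<and> C i \<subseteq> Z \<and>
    is_prime_ideal (vanishing_ideal (C i))) \<and> (\<forall>i<r. C i \<subset> C (Suc i))"
  have "(\<exists>C. ?chain m Z r C) \<longleftrightarrow> (\<exists>D. ?chain n (\<phi> ` Z) r D)" for r
  proof
    assume "\<exists>C. ?chain m Z r C"
    then obtain C where C: "?chain m Z r C" by blast
    have "?chain n (\<phi> ` Z) r (\<lambda>i. \<phi> ` C i)"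
    proof (intro conjI allI impI)
      fix i assume i: "i \<le> r"
      then have Ci: "closedin (zariski m) (C i)" "C i \<subseteq> Z" "is_prime_ideal (vanishing_ideal (C i))"
        using C by blast+
      have CV: "C i \<subseteq> V" using Ci(2) Z(2) by blast
      show "closedin (zariski n) (\<phi> ` C i)" using closed_image[OF Ci(1) CV] .
      show "\<phi> ` C i \<subseteq> \<phi> ` Z" using Ci(2) by blast
      show "is_prime_ideal (vanishing_ideal (\<phi> ` C i))" using prime_vanishing_image[OF CV Ci(3)] .
    next
      fix i assume i: "i < r"
      then have "Suc i \<le> r" "i \<le> r" by auto
      then have "C (Suc i) \<subseteq> V" "is_prime_ideal (vanishing_ideal (C (Suc i)))"
        "closedin (zariski m) (C i)" "C i \<subset> C (Suc i)"
        using C Z(2) i by blast+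
      then show "\<phi> ` C i \<subset> \<phi> ` C (Suc i)" by (intro image_psubset)
    qed
    then show "\<exists>D. ?chain n (\<phi> ` Z) r D" by (intro exI[of _ "\<lambda>i. \<phi> ` C i"])
  next
    assume "\<exists>D. ?chain n (\<phi> ` Z) r D"
    then obtain D where D: "?chain n (\<phi> ` Z) r D" by blast
    have "D r \<subseteq> \<phi> ` Z" "\<And>i. i < r \<Longrightarrow> D i \<subset> D (Suc i)"
      "\<And>i. i \<le> r \<Longrightarrow> closedin (zariski n) (D i) \<and> is_prime_ideal (vanishing_ideal (D i))"
      using D by blast+
    from chain_lift[OF Z this(3,2,1)] obtain C where
      C: "\<forall>i\<le>r. closedin (zariski m) (C i) \<and> C i \<subseteq> Z \<and> is_prime_ideal (vanishing_ideal (C i)) \<and>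
        \<phi> ` C i = D i" "\<forall>i<r. C i \<subseteq> C (Suc i)" by blast
    \<comment> \<open>\<open>chain_lift\<close> gives weak inclusions; strictness comes from the
      distinct images.\<close>
    have "C i \<subset> C (Suc i)" if "i < r" for i
    proof -
      have "\<phi> ` C i \<noteq> \<phi> ` C (Suc i)" using that C(1) D by (auto simp: Suc_le_eq)
      then show ?thesis using that C(2) by blast
    qed
    then show "\<exists>C. ?chain m Z r C" using C(1) by blast
  qed
  then show ?thesis
    unfolding krull_dim_closed[OF Z(1)] krull_dim_closed[OF closed_image[OF Z]] by simp
qed

end

section \<open>Openness and components over a normal base\<close>

text \<open>\<open>h_inj\<close> encodes dominance. \<open>normal\<close> is integral closedness
  with denominators cleared: its premise is a monic equation for p/b multiplied by
  \<open>b ^ e\<close>, its conclusion says that p/b is a regular function.\<close>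

locale finite_normal_cover = finite_cover +
  assumes V_prime: "is_prime_ideal (vanishing_ideal V)"
    and Y_prime: "is_prime_ideal (vanishing_ideal Y)"
    and h_inj: "\<And>a. h a \<in> vanishing_ideal V \<longleftrightarrow> a \<in> vanishing_ideal Y"
    and normal: "\<And>p b c e. b \<notin> vanishing_ideal Y \<Longrightarrow>
      p ^ e + (\<Sum>i<e. c i * p ^ i * b ^ (e - i)) \<in> vanishing_ideal Y \<Longrightarrow>
      \<exists>q. p - q * b \<in> vanishing_ideal Y"
begin

text \<open>\<open>P\<close> is the minimal polynomial of \<open>f\<close>, so a root
  \<open>c\<close> of \<open>P\<close> at \<open>y\<close> defines a point of k[Y][f] over
  \<open>y\<close>; \<open>nakayama\<close> with the polynomials in \<open>f\<close> as scalars
  lifts that point to \<open>V\<close>.\<close>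

lemma fibre_values:
  obtains P where "Polynomial.lead_coeff P = 1" "hpoly h P f \<in> vanishing_ideal V"
    "\<And>y c. y \<in> Y \<Longrightarrow> hpoly (mpoly_eval y) P c = 0 \<Longrightarrow> \<exists>x\<in>V. \<phi> x = y \<and> mpoly_eval x f = c"
proof -
  let ?I = "vanishing_ideal V"
  note I = is_ideal_vanishing[of V]
  obtain F where F: "Polynomial.lead_coeff F = 1" "hpoly h F f \<in> ?I" by (rule integral)
  have "\<exists>P. Polynomial.lead_coeff P = 1 \<and> hpoly h P f \<in> ?I \<and>
      (\<forall>Q. hpoly h Q f \<in> ?I \<longrightarrow> (\<exists>S. \<forall>i. Polynomial.coeff (Q - P * S) i \<in> vanishing_ideal Y))"
    by (rule minimal_polynomial_exists[OF h Y_prime V_prime h_inj _ F]) (rule normal)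
  then obtain P where P: "Polynomial.lead_coeff P = 1" "hpoly h P f \<in> ?I"
    "\<And>Q. hpoly h Q f \<in> ?I \<Longrightarrow> \<exists>S. \<forall>i. Polynomial.coeff (Q - P * S) i \<in> vanishing_ideal Y"
    by blast
  have "\<exists>x\<in>V. \<phi> x = y \<and> mpoly_eval x f = c"
    if y: "y \<in> Y" and c: "hpoly (mpoly_eval y) P c = 0" for y c
  proof -
    let ?ev = "\<lambda>R. hpoly (mpoly_eval y) R c"
    \<comment> \<open>Representatives of the ideal of the point \<open>(y, c)\<close> in
      k[Y][f].\<close>
    let ?N = "{hpoly h R f | R. ?ev R = 0}"
    note ev = mpoly_eval_hom[of y]
    obtain J where J: "is_ideal J" "?I \<subseteq> J" "?N \<subseteq> J" "1 \<notin> J"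
    proof (rule nakayama[OF I fin_G, of "{hpoly h R f | R. True}" ?N])
      show "\<exists>d. (\<forall>g\<in>G. d g \<in> {hpoly h R f | R. True}) \<and> b - (\<Sum>g\<in>G. d g * g) \<in> ?I" for b
      proof -
        obtain d where "b - (\<Sum>g\<in>G. h (d g) * g) \<in> ?I" using gen by blast
        moreover have "h a \<in> {hpoly h R f | R. True}" for a
          using hpoly_const[OF h, of a f] by (intro CollectI exI[of _ "[:a:]"]) simp
        ultimately show ?thesis by (intro exI[of _ "\<lambda>g. h (d g)"]) blast
      qed
      show "0 \<in> ?N" by (intro CollectI exI[of _ 0]) (simp add: hpoly_0[OF h] hpoly_0[OF ev])
      show "a + b \<in> ?N" if ab: "a \<in> ?N" "b \<in> ?N" for a b
      proof -
        obtain A B where "a = hpoly h A f" "b = hpoly h B f" "?ev A = 0" "?ev B = 0" using ab by blast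
        then show ?thesis by (intro CollectI exI[of _ "A + B"]) (simp add: hpoly_add[OF h] hpoly_add[OF ev])
      qed
      show "- a \<in> ?N" if a: "a \<in> ?N" for a
      proof -
        obtain A where "a = hpoly h A f" "?ev A = 0" using a by blast
        then show ?thesis by (intro CollectI exI[of _ "- A"]) (simp add: hpoly_uminus[OF h] hpoly_uminus[OF ev])
      qed
      show "s * a \<in> ?N" if sa: "s \<in> {hpoly h R f | R. True}" "a \<in> ?N" for s a
      proof -
        obtain S A where "s = hpoly h S f" "a = hpoly h A f" "?ev A = 0" using sa by blast
        then show ?thesis by (intro CollectI exI[of _ "S * A"]) (simp add: hpoly_mult[OF h] hpoly_mult[OF ev])
      qed
      show "1 + a \<notin> ?I" if a: "a \<in> ?N" for a
      proof
        assume 1: "1 + a \<in> ?I"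
        obtain A where A: "a = hpoly h A f" "?ev A = 0" using a by blast
        \<comment> \<open>\<open>P\<close> divides \<open>1 + A\<close> modulo the ideal of
          \<open>Y\<close>; evaluating at \<open>y\<close> and \<open>c\<close>, where
          \<open>P\<close> and \<open>A\<close> vanish, would give 1 = 0.\<close>
        have "hpoly h (1 + A) f \<in> ?I" using 1 A by (simp add: hpoly_add[OF h] hpoly_1[OF h])
        from P(3)[OF this] obtain S where
          S: "\<And>i. Polynomial.coeff (1 + A - P * S) i \<in> vanishing_ideal Y" by blast
        have "?ev (1 + A - P * S) \<in> {0}"
        proof (rule hpoly_in_ideal[OF ev])
          show "is_ideal {0 :: 'a}" by (rule is_idealI) auto
          show "mpoly_eval y (Polynomial.coeff (1 + A - P * S) i) \<in> {0}" for i
            using vanishing_idealD[OF S[of i] y] by simp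
        qed
        then show False
          using A(2) c by (simp add: hpoly_add[OF ev] hpoly_diff[OF ev] hpoly_mult[OF ev] hpoly_1[OF ev])
      qed
    qed auto
    obtain Q where Q: "is_prime_ideal Q" "J \<subseteq> Q"
      using prime_avoiding_exists[OF J(1), of "{1}"] J(4) by auto
    have QV: "?I \<subseteq> Q" using J(2) Q(2) by blast
    have NQ: "hpoly h R f \<in> Q" if "?ev R = 0" for R using that J(3) Q(2) by blast
    obtain x where x: "x \<in> V" "\<phi> x = y" "\<And>p. p \<in> Q \<Longrightarrow> mpoly_eval x p = 0"
    proof (rule point_over[OF Q(1) QV])
      show "h a \<in> Q" if "mpoly_eval y a = 0" for a
        using NQ[of "[:a:]"] that by (simp add: hpoly_const[OF h] hpoly_const[OF ev])
    qed blast
    \<comment> \<open>T - c vanishes at \<open>c\<close>, so \<open>f\<close> takes the value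
      \<open>c\<close> at the point found.\<close>
    have "hpoly h [:- mconst c, 1:] f \<in> Q"
      by (rule NQ) (simp add: hpoly_pCons[OF ev] hpoly_0[OF ev] hom_uminus[OF ev])
    then have "f - mconst c \<in> Q"
      by (simp add: hpoly_pCons[OF h] hpoly_0[OF h] hom_uminus[OF h] h_mconst hom_one[OF h])
    from x(3)[OF this] show ?thesis using x(1,2) by (auto simp: mpoly_eval_diff)
  qed
  then show thesis using that P(1,2) by blast
qed

lemma open_on_fibres:
  assumes x0: "x0 \<in> V" "\<phi> x0 \<in> W" "mpoly_eval x0 f \<noteq> 0"
    and W: "W \<subseteq> Y" "is_prime_ideal (vanishing_ideal W)" and a: "a \<notin> vanishing_ideal W"
  obtains x where "x \<in> V" "\<phi> x \<in> W" "mpoly_eval x f \<noteq> 0" "mpoly_eval (\<phi> x) a \<noteq> 0"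
proof -
  obtain P where P: "Polynomial.lead_coeff P = 1" "hpoly h P f \<in> vanishing_ideal V"
    "\<And>y c. y \<in> Y \<Longrightarrow> hpoly (mpoly_eval y) P c = 0 \<Longrightarrow> \<exists>x\<in>V. \<phi> x = y \<and> mpoly_eval x f = c"
    using fibre_values[of f] by blast
  let ?d = "Polynomial.degree P"
  let ?P = "\<lambda>y. map_poly (mpoly_eval y) P"
  have cP: "Polynomial.coeff (?P y) i = mpoly_eval y (Polynomial.coeff P i)" for y i
    by (simp add: coeff_map_poly)
  have dP: "Polynomial.degree (?P y) = ?d" for y
    by (rule map_poly_degree_eq) (simp add: P(1))
  \<comment> \<open>Otherwise \<open>P\<close> would specialise at the image of \<open>x0\<close> to
    a power of the variable, forcing the value of \<open>f\<close> at \<open>x0\<close> to be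
    0.\<close>
  have "\<exists>i<?d. mpoly_eval (\<phi> x0) (Polynomial.coeff P i) \<noteq> 0"
  proof (rule ccontr)
    assume "\<not> ?thesis"
    then have "Polynomial.coeff (?P (\<phi> x0)) k = Polynomial.coeff (Polynomial.monom 1 ?d) k" for k
      by (cases k ?d rule: linorder_cases) (use P(1) in \<open>auto simp: cP coeff_eq_0\<close>)
    then have "?P (\<phi> x0) = Polynomial.monom 1 ?d" by (rule poly_eqI)
    moreover have "poly (?P (\<phi> x0)) (mpoly_eval x0 f) = 0"
      using mpoly_eval_hpoly[OF h eval_h[OF x0(1)], of P f] vanishing_idealD[OF P(2) x0(1)] by simp
    ultimately show False using x0(3) by (simp add: poly_monom)
  qed
  then obtain i where i: "i < ?d" "mpoly_eval (\<phi> x0) (Polynomial.coeff P i) \<noteq> 0" by blast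
  then have "Polynomial.coeff P i \<notin> vanishing_ideal W" using x0(2) vanishing_idealD by blast
  \<comment> \<open>Primality of the ideal of \<open>W\<close> gives a point where this coefficient
    and \<open>a\<close> are both nonzero; there the specialised \<open>P\<close> has a nonzero
    root.\<close>
  then have "Polynomial.coeff P i * a \<notin> vanishing_ideal W" using a W(2) by (auto simp: is_prime_ideal_def)
  then obtain y where y: "y \<in> W" "mpoly_eval y (Polynomial.coeff P i) \<noteq> 0" "mpoly_eval y a \<noteq> 0"
    by (auto simp: vanishing_ideal_def mpoly_eval_mult)
  obtain c where c: "poly (?P y) c = 0" "c \<noteq> 0"
    using nonzero_root_exists[of "?P y" i] y(2) i(1) by (auto simp: cP dP)
  have "\<exists>x\<in>V. \<phi> x = y \<and> mpoly_eval x f = c"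
    by (rule P(3)) (use y(1) W(1) c(1) in \<open>auto simp: hpoly_def\<close>)
  then show thesis using that y c(2) by blast
qed

lemma irreducible_component_preimage:
  assumes W: "closedin (zariski n) W" "W \<subseteq> Y" "is_prime_ideal (vanishing_ideal W)"
    and Z: "irreducible_component (subtopology (zariski m) {x\<in>V. \<phi> x \<in> W}) Z"
  shows "closedin (zariski m) Z" "Z \<subseteq> V" "\<phi> ` Z = W"
proof -
  let ?T = "{x\<in>V. \<phi> x \<in> W}"
  have T: "closedin (zariski m) ?T" by (rule preimage_closed[OF W(1)])
  have top: "topspace (subtopology (zariski m) ?T) = ?T"
    using closedin_zariski_subset[OF T] by auto
  have sub: "subtopology (subtopology (zariski m) ?T) C = subtopology (zariski m) C" if "C \<subseteq> ?T" for C
    using that by (simp add: subtopology_subtopology Int_absorb1)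
  have ZT: "Z \<subseteq> ?T" using Z by (simp only: irreducible_component_def top)
  have aff: "C \<subseteq> affine_space m" if "C \<subseteq> ?T" for C
    using that closedin_zariski_subset[OF T] by blast
  have Z_prime: "is_prime_ideal (vanishing_ideal Z)"
    using Z irreducible_iff_prime[OF aff[OF ZT]] sub[OF ZT] by (simp add: irreducible_component_def)
  have Z_max: "C = Z" if "Z \<subseteq> C" "C \<subseteq> ?T" "is_prime_ideal (vanishing_ideal C)" for C
    using Z that irreducible_iff_prime[OF aff[OF that(2)]] sub[OF that(2)]
    by (simp only: irreducible_component_def top)
  \<comment> \<open>A prime containing the ideal of \<open>?T\<close> and avoiding \<open>?M\<close> lies inside the ideal of \<open>Z\<close>
    and contracts to the ideal of \<open>W\<close>.\<close>
  let ?M = "{f * h a | f a. f \<notin> vanishing_ideal Z \<and> a \<notin> vanishing_ideal W}"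
  have Z1: "1 \<notin> vanishing_ideal Z" and W1: "1 \<notin> vanishing_ideal W"
    using Z_prime W(3) by (auto simp: is_prime_ideal_def)
  have fM: "f \<in> ?M" if "f \<notin> vanishing_ideal Z" for f
    using that W1 by (intro CollectI exI[of _ f] exI[of _ 1]) (simp add: hom_one[OF h])
  have hM: "h a \<in> ?M" if "a \<notin> vanishing_ideal W" for a
    using that Z1 by (intro CollectI exI[of _ 1] exI[of _ a]) simp
  have M_mult: "s * t \<in> ?M" if st: "s \<in> ?M" "t \<in> ?M" for s t
  proof -
    obtain f a where s: "s = f * h a" "f \<notin> vanishing_ideal Z" "a \<notin> vanishing_ideal W"
      using st(1) by blast
    obtain g b where t: "t = g * h b" "g \<notin> vanishing_ideal Z" "b \<notin> vanishing_ideal W"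
      using st(2) by blast
    have "s * t = (f * g) * h (a * b)" unfolding s t by (simp add: hom_mult[OF h] mult_ac)
    moreover have "f * g \<notin> vanishing_ideal Z" "a * b \<notin> vanishing_ideal W"
      using s t Z_prime W(3) by (auto simp: is_prime_ideal_def)
    ultimately show ?thesis by blast
  qed
  \<comment> \<open>Here openness enters: from a point of \<open>Z\<close> where \<open>f\<close> is
    nonzero, \<open>open_on_fibres\<close> reaches a point of the preimage where \<open>f\<close>
    and \<open>h a\<close> are both nonzero.\<close>
  have disj: "vanishing_ideal ?T \<inter> ?M = {}"
  proof (rule ccontr)
    assume "vanishing_ideal ?T \<inter> ?M \<noteq> {}"
    then obtain f a where fa: "f * h a \<in> vanishing_ideal ?T" "f \<notin> vanishing_ideal Z"
      "a \<notin> vanishing_ideal W" by blast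
    obtain x0 where x0: "x0 \<in> Z" "mpoly_eval x0 f \<noteq> 0" using fa(2) by (auto simp: vanishing_ideal_def)
    obtain x where x: "x \<in> V" "\<phi> x \<in> W" "mpoly_eval x f \<noteq> 0" "mpoly_eval (\<phi> x) a \<noteq> 0"
      by (rule open_on_fibres[of x0 W f a]) (use x0 ZT W(2,3) fa(3) in auto)
    have "mpoly_eval x (f * h a) = 0" using vanishing_idealD[OF fa(1)] x(1,2) by blast
    then show False using x by (simp add: mpoly_eval_mult eval_h)
  qed
  have TV: "?T \<subseteq> V" by blast
  obtain C where C: "closedin (zariski m) C" "C \<subseteq> ?T" "is_prime_ideal (vanishing_ideal C)"
    "\<phi> ` C = W" "vanishing_ideal C \<inter> ?M = {}"
  proof (rule irreducible_lift_avoiding[OF T TV W(1) _ fM[OF Z1] _ disj])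
    show "\<phi> ` ?T \<subseteq> W" by blast
    show "s * t \<in> ?M" if "s \<in> ?M" "t \<in> ?M" for s t using that by (rule M_mult)
    show "h a \<in> ?M" if "a \<notin> vanishing_ideal W" for a using that by (rule hM)
  qed blast
  \<comment> \<open>Missing \<open>?M\<close> forces the ideal of \<open>C\<close> into that of
    \<open>Z\<close>; as \<open>C\<close> is closed it contains \<open>Z\<close>, and maximality
    identifies the two.\<close>
  have "vanishing_ideal C \<subseteq> vanishing_ideal Z" using C(5) fM by blast
  then have "Z \<subseteq> C"
    using closedin_zariski_memI[OF C(1)] aff[OF ZT] vanishing_idealD by blast
  then have "C = Z" using C(2,3) by (rule Z_max)
  then show "closedin (zariski m) Z" "Z \<subseteq> V" "\<phi> ` Z = W" using C ZT by auto
qed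

end

section \<open>Coordinate rings and normality\<close>

definition poly_fun :: "(nat \<Rightarrow> 'k) set \<Rightarrow> 'k::comm_ring_1 mpoly \<Rightarrow> (nat \<Rightarrow> 'k) \<Rightarrow> 'k" where
  "poly_fun V p = (\<lambda>x\<in>V. mpoly_eval x p)"

lemma poly_fun_eq_iff: "poly_fun V p = poly_fun V q \<longleftrightarrow> p - q \<in> vanishing_ideal V"
  by (auto simp: poly_fun_def vanishing_ideal_def mpoly_eval_diff restrict_def fun_eq_iff)

lemma carrier_coord_ring:
  assumes "V \<subseteq> affine_space n"
  shows "carrier (coord_ring n V) = range (poly_fun V)"
proof
  show "carrier (coord_ring n V) \<subseteq> range (poly_fun V)"
    by (auto simp: coord_ring_def poly_fun_def)
  show "range (poly_fun V) \<subseteq> carrier (coord_ring n V)"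
  proof
    fix f assume "f \<in> range (poly_fun V)"
    then obtain p where p: "f = poly_fun V p" by blast
    obtain q where q: "q \<in> mpolys n" "\<And>x. x \<in> affine_space n \<Longrightarrow> mpoly_eval x q = mpoly_eval x p"
      using mpoly_restrict_vars[of n p] by blast
    have "f = (\<lambda>x\<in>V. mpoly_eval x q)"
      unfolding p poly_fun_def using q(2) assms by (intro restrict_ext) auto
    then show "f \<in> carrier (coord_ring n V)" using q(1) by (auto simp: coord_ring_def)
  qed
qed

lemma coord_ring_ops:
  "poly_fun V p \<otimes>\<^bsub>coord_ring n V\<^esub> poly_fun V q = poly_fun V (p * q)"
  "poly_fun V p \<oplus>\<^bsub>coord_ring n V\<^esub> poly_fun V q = poly_fun V (p + q)"
  "\<one>\<^bsub>coord_ring n V\<^esub> = poly_fun V 1"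
  "\<zero>\<^bsub>coord_ring n V\<^esub> = poly_fun V 0"
  by (auto simp: coord_ring_def poly_fun_def mpoly_eval_mult mpoly_eval_add restrict_def fun_eq_iff)

lemma cring_coord_ring:
  assumes V: "V \<subseteq> affine_space n"
  shows "cring (coord_ring n V)"
proof (rule cringI)
  note C = carrier_coord_ring[OF V]
  show "abelian_group (coord_ring n V)"
  proof (rule abelian_groupI)
    fix f assume "f \<in> carrier (coord_ring n V)"
    then obtain p where "f = poly_fun V p" unfolding C by blast
    then show "\<exists>g\<in>carrier (coord_ring n V). g \<oplus>\<^bsub>coord_ring n V\<^esub> f = \<zero>\<^bsub>coord_ring n V\<^esub>"
      unfolding C by (intro bexI[of _ "poly_fun V (- p)"]) (auto simp: coord_ring_ops)
  qed (auto simp: C coord_ring_ops add_ac)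
  show "Group.comm_monoid (coord_ring n V)"
    by (rule comm_monoidI) (auto simp: C coord_ring_ops mult_ac)
qed (auto simp: carrier_coord_ring[OF V] coord_ring_ops distrib_right)

lemma domain_coord_ring:
  assumes V: "V \<subseteq> affine_space n" and prime: "is_prime_ideal (vanishing_ideal V)"
  shows "domain (coord_ring n V)"
proof (rule domain.intro[OF cring_coord_ring[OF V]], unfold_locales)
  show "\<one>\<^bsub>coord_ring n V\<^esub> \<noteq> \<zero>\<^bsub>coord_ring n V\<^esub>"
    using prime by (simp add: coord_ring_ops poly_fun_eq_iff is_prime_ideal_def)
  fix f g
  assume fg: "f \<otimes>\<^bsub>coord_ring n V\<^esub> g = \<zero>\<^bsub>coord_ring n V\<^esub>"
    "f \<in> carrier (coord_ring n V)" "g \<in> carrier (coord_ring n V)"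
  then obtain p q where "f = poly_fun V p" "g = poly_fun V q" unfolding carrier_coord_ring[OF V] by blast
  then show "f = \<zero>\<^bsub>coord_ring n V\<^esub> \<or> g = \<zero>\<^bsub>coord_ring n V\<^esub>"
    using fg(1) prime by (auto simp: coord_ring_ops poly_fun_eq_iff is_prime_ideal_def)
qed

lemma finsum_coord_ring:
  assumes V: "V \<subseteq> affine_space n" and "finite A" and "\<And>a. a \<in> A \<Longrightarrow> f a \<in> carrier (coord_ring n V)"
    and x: "x \<in> V"
  shows "(\<Oplus>\<^bsub>coord_ring n V\<^esub>a\<in>A. f a) x = (\<Sum>a\<in>A. f a x)"
proof -
  interpret cring "coord_ring n V" by (rule cring_coord_ring[OF V])
  have zero: "\<zero>\<^bsub>coord_ring n V\<^esub> x = 0" and add: "(g \<oplus>\<^bsub>coord_ring n V\<^esub> g') x = g x + g' x" for g g'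
    using x by (simp_all add: coord_ring_def)
  show ?thesis
    using assms(2,3)
  proof (induction A rule: finite_induct)
    case empty
    then show ?case by (simp add: zero)
  next
    case (insert a A)
    then have "(\<Oplus>\<^bsub>coord_ring n V\<^esub>a\<in>insert a A. f a) = f a \<oplus>\<^bsub>coord_ring n V\<^esub> (\<Oplus>\<^bsub>coord_ring n V\<^esub>a\<in>A. f a)"
      by (intro finsum_insert) auto
    then show ?case using insert by (simp add: add)
  qed
qed

text \<open>Dividing the relation by \<open>b ^ e\<close> exhibits p/b as a root of a monic
  polynomial over the image of the coordinate ring in its fraction field. The work lies in computing
  there with fractions \<open>fr u v\<close> of residues.\<close>

lemma integrally_closed_coord_ringD:
  fixes Y :: "(nat \<Rightarrow> 'k::field) set"
  assumes Y: "Y \<subseteq> affine_space n" and prime: "is_prime_ideal (vanishing_ideal Y)"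
    and closed: "integrally_closed (coord_ring n Y)"
    and b: "b \<notin> vanishing_ideal Y"
    and rel: "p ^ e + (\<Sum>i<e. c i * p ^ i * b ^ (e - i)) \<in> vanishing_ideal Y"
  shows "\<exists>q. p - q * b \<in> vanishing_ideal Y"
proof -
  let ?I = "vanishing_ideal Y"
  have I: "is_ideal ?I" and I1: "1 \<notin> ?I" and I_mult: "\<And>u v. u \<notin> ?I \<Longrightarrow> v \<notin> ?I \<Longrightarrow> u * v \<notin> ?I"
    using prime by (auto simp: is_prime_ideal_def)
  define R where "R = coord_ring n Y"
  define F where "F = fraction_field R"
  define fr where "fr u v = fraction R (poly_fun Y u) (poly_fun Y v)" for u v
  interpret R: domain R unfolding R_def by (rule domain_coord_ring[OF Y prime])
  have C: "carrier R = range (poly_fun Y)" unfolding R_def by (rule carrier_coord_ring[OF Y])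
  note ops = coord_ring_ops[where V = Y and n = n, folded R_def]
  have nz: "poly_fun Y v \<in> carrier R - {\<zero>\<^bsub>R\<^esub>}" if "v \<notin> ?I" for v
    using that by (auto simp: C ops poly_fun_eq_iff)
  have cl: "poly_fun Y u \<in> carrier R" for u using C by auto
  have fr_mult: "fr u v \<otimes>\<^bsub>F\<^esub> fr u' v' = fr (u * u') (v * v')" if "v \<notin> ?I" "v' \<notin> ?I" for u v u' v'
    unfolding fr_def F_def using R.fraction_mult[OF cl nz[OF that(1)] cl nz[OF that(2)]]
    by (simp add: ops)
  have fr_add: "fr u v \<oplus>\<^bsub>F\<^esub> fr u' v' = fr (u * v' + u' * v) (v * v')" if "v \<notin> ?I" "v' \<notin> ?I" for u v u' v'
    unfolding fr_def F_def using R.fraction_add[OF cl nz[OF that(1)] cl nz[OF that(2)]]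
    by (simp add: ops)
  have fr_eq: "fr u v = fr u' v' \<longleftrightarrow> u * v' - u' * v \<in> ?I" if "v \<notin> ?I" "v' \<notin> ?I" for u v u' v'
    unfolding fr_def using R.fraction_eq_iff[OF cl nz[OF that(1)] cl nz[OF that(2)]]
    by (simp add: ops poly_fun_eq_iff)
  have fr_eqI: "fr u v = fr u' v'" if "v \<notin> ?I" "v' \<notin> ?I" "u * v' = u' * v" for u v u' v'
    using that fr_eq ideal_zero[OF I] by simp
  have CF: "carrier F = {fr u v | u v. v \<notin> ?I}"
  proof -
    have "carrier F = {fraction R a b | a b. a \<in> carrier R \<and> b \<in> carrier R - {\<zero>\<^bsub>R\<^esub>}}"
      by (simp add: F_def fraction_field_def)
    also have "\<dots> = {fr u v | u v. v \<notin> ?I}"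
    proof (intro subset_antisym subsetI)
      fix z assume "z \<in> {fraction R a b | a b. a \<in> carrier R \<and> b \<in> carrier R - {\<zero>\<^bsub>R\<^esub>}}"
      then obtain u v where z: "z = fr u v" "poly_fun Y v \<noteq> \<zero>\<^bsub>R\<^esub>" unfolding C fr_def by blast
      then have "v \<notin> ?I" by (simp add: ops poly_fun_eq_iff)
      then show "z \<in> {fr u v | u v. v \<notin> ?I}" using z(1) by blast
    qed (use cl nz fr_def in blast)
    finally show ?thesis .
  qed
  have oneF: "\<one>\<^bsub>F\<^esub> = fr 1 1" and zeroF: "\<zero>\<^bsub>F\<^esub> = fr 0 1"
    by (simp_all add: F_def fraction_field_def fr_def ops)
  have F_obtain: "\<exists>u v. z = fr u v \<and> v \<notin> ?I" if "z \<in> carrier F" for z using that CF by blast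
  have cF: "fr u v \<in> carrier F" if "v \<notin> ?I" for u v using that CF by blast
  have "cring F"
  proof (rule cringI)
    show "abelian_group F"
    proof (rule abelian_groupI)
      fix x assume "x \<in> carrier F"
      then obtain u v where x: "x = fr u v" "v \<notin> ?I" using F_obtain by blast
      show "\<zero>\<^bsub>F\<^esub> \<oplus>\<^bsub>F\<^esub> x = x"
        unfolding x(1) zeroF using x(2) I1 by (simp add: fr_add)
      show "\<exists>y\<in>carrier F. y \<oplus>\<^bsub>F\<^esub> x = \<zero>\<^bsub>F\<^esub>"
        unfolding x(1) zeroF
      proof (rule bexI)
        show "fr (- u) v \<oplus>\<^bsub>F\<^esub> fr u v = fr 0 1"
          using x(2) I1 I_mult by (simp add: fr_add fr_eq[of "v * v" 1] ideal_zero[OF I])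
        show "fr (- u) v \<in> carrier F" using x(2) by (rule cF)
      qed
      fix y assume "y \<in> carrier F"
      then obtain u' v' where y: "y = fr u' v'" "v' \<notin> ?I" using F_obtain by blast
      show "x \<oplus>\<^bsub>F\<^esub> y \<in> carrier F" unfolding x(1) y(1) using x(2) y(2) by (simp add: fr_add cF I_mult)
      show "x \<oplus>\<^bsub>F\<^esub> y = y \<oplus>\<^bsub>F\<^esub> x"
        unfolding x(1) y(1) using x(2) y(2) by (simp add: fr_add add.commute mult.commute)
      fix z assume "z \<in> carrier F"
      then obtain u'' v'' where z: "z = fr u'' v''" "v'' \<notin> ?I" using F_obtain by blast
      show "x \<oplus>\<^bsub>F\<^esub> y \<oplus>\<^bsub>F\<^esub> z = x \<oplus>\<^bsub>F\<^esub> (y \<oplus>\<^bsub>F\<^esub> z)"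
        unfolding x(1) y(1) z(1) using x(2) y(2) z(2) by (simp add: fr_add I_mult algebra_simps)
    qed (simp add: zeroF cF I1)
    show "Group.comm_monoid F"
    proof (rule comm_monoidI)
      fix x assume "x \<in> carrier F"
      then obtain u v where x: "x = fr u v" "v \<notin> ?I" using F_obtain by blast
      show "\<one>\<^bsub>F\<^esub> \<otimes>\<^bsub>F\<^esub> x = x" unfolding x(1) oneF using x(2) I1 by (simp add: fr_mult)
      fix y assume "y \<in> carrier F"
      then obtain u' v' where y: "y = fr u' v'" "v' \<notin> ?I" using F_obtain by blast
      show "x \<otimes>\<^bsub>F\<^esub> y \<in> carrier F" unfolding x(1) y(1) using x(2) y(2) by (simp add: fr_mult cF I_mult)
      show "x \<otimes>\<^bsub>F\<^esub> y = y \<otimes>\<^bsub>F\<^esub> x"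
        unfolding x(1) y(1) using x(2) y(2) by (simp add: fr_mult mult.commute)
      fix z assume "z \<in> carrier F"
      then obtain u'' v'' where z: "z = fr u'' v''" "v'' \<notin> ?I" using F_obtain by blast
      show "x \<otimes>\<^bsub>F\<^esub> y \<otimes>\<^bsub>F\<^esub> z = x \<otimes>\<^bsub>F\<^esub> (y \<otimes>\<^bsub>F\<^esub> z)"
        unfolding x(1) y(1) z(1) using x(2) y(2) z(2) by (simp add: fr_mult I_mult mult.assoc)
    qed (simp add: oneF cF I1)
    fix x y z assume "x \<in> carrier F" "y \<in> carrier F" "z \<in> carrier F"
    then obtain u v u' v' u'' v'' where x: "x = fr u v" "v \<notin> ?I" and y: "y = fr u' v'" "v' \<notin> ?I"
      and z: "z = fr u'' v''" "v'' \<notin> ?I" using F_obtain by metis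
    show "(x \<oplus>\<^bsub>F\<^esub> y) \<otimes>\<^bsub>F\<^esub> z = x \<otimes>\<^bsub>F\<^esub> z \<oplus>\<^bsub>F\<^esub> y \<otimes>\<^bsub>F\<^esub> z"
      unfolding x(1) y(1) z(1) using x(2) y(2) z(2)
      by (simp add: fr_mult fr_add I_mult) (intro fr_eqI I_mult; simp add: algebra_simps)
  qed
  then interpret F: cring F .
  have b_pow: "b ^ k \<notin> ?I" for k by (induction k) (use I1 b I_mult in auto)
  have x_pow: "fr p b [^]\<^bsub>F\<^esub> k = fr (p ^ k) (b ^ k)" for k :: nat
    by (induction k) (simp_all add: oneF fr_mult b b_pow mult.commute)
  have horner: "fr u 1 \<otimes>\<^bsub>F\<^esub> fr p b [^]\<^bsub>F\<^esub> k \<oplus>\<^bsub>F\<^esub> fr w (b ^ k) = fr (u * p ^ k + w) (b ^ k)" for u w k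
  proof -
    have "fr u 1 \<otimes>\<^bsub>F\<^esub> fr p b [^]\<^bsub>F\<^esub> k \<oplus>\<^bsub>F\<^esub> fr w (b ^ k) =
        fr (u * p ^ k * b ^ k + w * b ^ k) (b ^ k * b ^ k)"
      by (simp add: x_pow fr_mult fr_add I1 b_pow)
    also have "\<dots> = fr (u * p ^ k + w) (b ^ k)"
      by (intro fr_eqI I_mult b_pow) (simp add: algebra_simps)
    finally show ?thesis .
  qed
  let ?S = "\<lambda>e. \<Sum>i<e. c i * p ^ i * b ^ (e - i)"
  \<comment> \<open>Leading coefficients come first, hence \<open>rev\<close>. Over the common
    denominator \<open>b ^ e\<close> the value of this list at p/b has numerator
    \<open>?S e\<close>.\<close>
  let ?cs = "\<lambda>e. map (\<lambda>i. fr (c i) 1) (rev [0..<e])"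
  have len: "length (?cs e) = e" for e by simp
  have eval: "F.eval (?cs e) (fr p b) = fr (?S e) (b ^ e)" for e
  proof (induction e)
    case 0
    then show ?case by (simp add: zeroF)
  next
    case (Suc e)
    have "F.eval (?cs (Suc e)) (fr p b) = fr (c e) 1 \<otimes>\<^bsub>F\<^esub> fr p b [^]\<^bsub>F\<^esub> e \<oplus>\<^bsub>F\<^esub> fr (?S e) (b ^ e)"
      using Suc by simp
    also have "\<dots> = fr (c e * p ^ e + ?S e) (b ^ e)" by (rule horner)
    also have "\<dots> = fr (?S (Suc e)) (b ^ Suc e)"
    proof (rule fr_eqI[OF b_pow b_pow])
      have "?S (Suc e) = b * (c e * p ^ e + ?S e)"
        by (simp add: Suc_diff_le sum_distrib_left algebra_simps)
      then show "(c e * p ^ e + ?S e) * b ^ Suc e = ?S (Suc e) * b ^ e"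
        by (simp only:) (simp add: mult_ac)
    qed
    finally show ?case .
  qed
  let ?\<iota> = "\<lambda>a. fraction R a \<one>\<^bsub>R\<^esub>"
  have \<iota>: "?\<iota> (poly_fun Y u) = fr u 1" for u by (simp add: fr_def ops)
  let ?P = "\<one>\<^bsub>F\<^esub> # ?cs e"
  have "integral_over F (?\<iota> ` carrier R) (fr p b)"
    unfolding integral_over_def
  proof (intro exI[of _ ?P] conjI)
    have in_\<iota>: "fr u 1 \<in> ?\<iota> ` carrier R" for u
      using \<iota>[of u] cl[of u] by (metis imageI)
    have "\<one>\<^bsub>F\<^esub> \<noteq> \<zero>\<^bsub>F\<^esub>" using I1 by (simp add: oneF zeroF fr_eq)
    then show "polynomial\<^bsub>F\<^esub> (?\<iota> ` carrier R) ?P"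
      using in_\<iota> by (auto simp: polynomial_def oneF)
    have "F.eval ?P (fr p b) = fr 1 1 \<otimes>\<^bsub>F\<^esub> fr p b [^]\<^bsub>F\<^esub> e \<oplus>\<^bsub>F\<^esub> fr (?S e) (b ^ e)"
      using eval[of e] by (simp add: oneF)
    also have "\<dots> = fr (p ^ e + ?S e) (b ^ e)" unfolding horner by simp
    also have "\<dots> = \<zero>\<^bsub>F\<^esub>" using rel by (simp add: zeroF fr_eq b_pow I1)
    finally show "F.eval ?P (fr p b) = \<zero>\<^bsub>F\<^esub>" .
  qed auto
  then have "fr p b \<in> ?\<iota> ` carrier R"
    using closed cF[OF b, of p] by (simp add: integrally_closed_def R_def F_def Let_def)
  then obtain q where "fr p b = fr q 1" unfolding C using \<iota> by auto
  then show ?thesis using fr_eq[OF b I1] by auto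
qed

lemma finite_ring_hom_generators:
  fixes V Y :: "(nat \<Rightarrow> 'k::field) set"
  assumes V: "V \<subseteq> affine_space m" and Y: "Y \<subseteq> affine_space n"
    and \<phi>: "\<phi> \<in> V \<rightarrow> Y" and eval_h: "\<And>x a. x \<in> V \<Longrightarrow> mpoly_eval x (h a) = mpoly_eval (\<phi> x) a"
    and fin: "finite_ring_hom (coord_ring n Y) (coord_ring m V) (pullback V \<phi>)"
  obtains G where "finite G"
    "\<And>b. \<exists>c. b - (\<Sum>g\<in>G. h (c g) * g) \<in> vanishing_ideal V"
proof -
  let ?B = "coord_ring m V"
  note CA = carrier_coord_ring[OF Y] and CB = carrier_coord_ring[OF V]
  obtain H where H: "finite H" "H \<subseteq> carrier ?B"
    and gen: "\<And>b. b \<in> carrier ?B \<Longrightarrow> \<exists>c\<in>H \<rightarrow> carrier (coord_ring n Y).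
      b = (\<Oplus>\<^bsub>?B\<^esub>g\<in>H. pullback V \<phi> (c g) \<otimes>\<^bsub>?B\<^esub> g)"
    using fin unfolding finite_ring_hom_def by blast
  have "\<forall>g\<in>H. \<exists>p. g = poly_fun V p" using H(2) CB by blast
  from bchoice[OF this] obtain r where r: "\<And>g. g \<in> H \<Longrightarrow> g = poly_fun V (r g)" by blast
  \<comment> \<open>Module generators are replaced by polynomial representatives; injectivity lets
    the coefficients be reindexed by these through \<open>the_inv_into\<close>.\<close>
  have inj: "inj_on r H" using r by (metis inj_onI)
  have pull: "pullback V \<phi> (poly_fun Y a) = poly_fun V (h a)" for a
    using \<phi> eval_h by (auto simp: pullback_def compose_def poly_fun_def restrict_def fun_eq_iff)
  have "\<exists>c. b - (\<Sum>g\<in>r ` H. h (c g) * g) \<in> vanishing_ideal V" for b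
  proof -
    have "poly_fun V b \<in> carrier ?B" using CB by blast
    from gen[OF this] obtain c where c: "c \<in> H \<rightarrow> carrier (coord_ring n Y)"
      "poly_fun V b = (\<Oplus>\<^bsub>?B\<^esub>g\<in>H. pullback V \<phi> (c g) \<otimes>\<^bsub>?B\<^esub> g)" by blast
    have "\<forall>g\<in>H. \<exists>a. c g = poly_fun Y a" using c(1) CA by blast
    from bchoice[OF this] obtain a where a: "\<And>g. g \<in> H \<Longrightarrow> c g = poly_fun Y (a g)" by blast
    have summand: "pullback V \<phi> (c g) \<otimes>\<^bsub>?B\<^esub> g = poly_fun V (h (a g) * r g)" if "g \<in> H" for g
      using r[OF that] a[OF that] coord_ring_ops(1)[of m V "h (a g)" "r g"] by (simp add: pull)
    have "mpoly_eval x (b - (\<Sum>g\<in>r ` H. h (a (the_inv_into H r g)) * g)) = 0" if x: "x \<in> V" for x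
    proof -
      have "mpoly_eval x b = (\<Oplus>\<^bsub>?B\<^esub>g\<in>H. pullback V \<phi> (c g) \<otimes>\<^bsub>?B\<^esub> g) x"
        using x by (simp add: poly_fun_def flip: c(2))
      also have "\<dots> = (\<Sum>g\<in>H. (pullback V \<phi> (c g) \<otimes>\<^bsub>?B\<^esub> g) x)"
        by (rule finsum_coord_ring[OF V H(1) _ x]) (use summand CB in auto)
      also have "\<dots> = (\<Sum>g\<in>H. mpoly_eval x (h (a g) * r g))"
        using x by (intro sum.cong refl) (simp add: summand poly_fun_def)
      also have "\<dots> = mpoly_eval x (\<Sum>g\<in>H. h (a g) * r g)" by (simp add: mpoly_eval_sum)
      also have "(\<Sum>g\<in>H. h (a g) * r g) = (\<Sum>g\<in>r ` H. h (a (the_inv_into H r g)) * g)"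
        by (simp add: sum.reindex[OF inj] the_inv_into_f_f[OF inj])
      finally show ?thesis by (simp add: mpoly_eval_diff)
    qed
    then show ?thesis
      by (intro exI[of _ "\<lambda>g. a (the_inv_into H r g)"]) (simp add: vanishing_ideal_def)
  qed
  then show thesis using that[of "r ` H"] H(1) by blast
qed

lemma finite_normal_cover_exists:
  fixes V Y :: "(nat \<Rightarrow> 'k::alg_closed_field) set"
  assumes V: "affine_variety m V" and fin: "finite_morphism m V n Y \<phi>"
    and dom: "dominant_morphism m V n Y \<phi>" and Y: "normal_variety n Y"
  shows "\<exists>h G. finite_normal_cover m n V Y \<phi> h G"
proof -
  have Vc: "closedin (zariski m) V" and Yc: "closedin (zariski n) Y"
    using V Y by (auto simp: affine_variety_def normal_variety_def)
  note VA = closedin_zariski_subset[OF Vc] and YA = closedin_zariski_subset[OF Yc]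
  have V_prime: "is_prime_ideal (vanishing_ideal V)" and Y_prime: "is_prime_ideal (vanishing_ideal Y)"
    using V Y irreducible_iff_prime[OF VA] irreducible_iff_prime[OF YA]
    by (auto simp: affine_variety_def normal_variety_def)
  have \<phi>: "\<phi> \<in> V \<rightarrow> Y" and coords: "\<forall>j<n. \<exists>p\<in>mpolys m. \<forall>x\<in>V. \<phi> x j = mpoly_eval x p"
    using fin by (auto simp: finite_morphism_def variety_morphism_def)
  \<comment> \<open>The substitution needs a polynomial for every index; from \<open>n\<close> on,
    the coordinate is the constant \<open>undefined\<close>, since points of \<open>Y\<close> are
    extensional.\<close>
  have "\<exists>p. \<forall>x\<in>V. mpoly_eval x p = \<phi> x j" for j
  proof (cases "j < n")
    case True
    then show ?thesis using coords by metis
  next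
    case False
    then have "\<phi> x j = undefined" if "x \<in> V" for x
      using \<phi> YA that by (auto simp: affine_space_def PiE_def extensional_def)
    then show ?thesis by (intro exI[of _ "mconst undefined"]) simp
  qed
  then have "\<forall>j. \<exists>p. \<forall>x\<in>V. mpoly_eval x p = \<phi> x j" by blast
  from choice[OF this] obtain g where g: "\<And>j x. x \<in> V \<Longrightarrow> mpoly_eval x (g j) = \<phi> x j" by blast
  define h where "h = mpoly_subst g"
  have eval_h: "mpoly_eval x (h a) = mpoly_eval (\<phi> x) a" if "x \<in> V" for x a
    using g[OF that] by (simp add: h_def mpoly_eval_subst)
  obtain G where G: "finite G" "\<And>b. \<exists>c. b - (\<Sum>g\<in>G. h (c g) * g) \<in> vanishing_ideal V"
    using finite_ring_hom_generators[OF VA YA \<phi> eval_h] fin unfolding finite_morphism_def by blast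
  interpret finite_cover m n V Y \<phi> h G
  proof
    show "V \<noteq> {}" using V_prime by (auto simp: is_prime_ideal_def vanishing_ideal_def)
    show "is_ring_hom h" unfolding h_def by (rule mpoly_subst_hom)
    show "h (mconst c) = mconst c" for c unfolding h_def by (rule mpoly_subst_mconst)
  qed (use Vc Yc \<phi> eval_h G in auto)
  have "h a \<in> vanishing_ideal V \<longleftrightarrow> a \<in> vanishing_ideal Y" for a
  proof -
    \<comment> \<open>Dominance: the zeros of \<open>a\<close> in \<open>Y\<close> form a closed set
      containing the image, hence all of \<open>Y\<close>.\<close>
    have "a \<in> vanishing_ideal Y" if a: "a \<in> vanishing_ideal (\<phi> ` V)"
    proof -
      have "closedin (subtopology (zariski n) Y) (zero_locus n {a} \<inter> Y)"
        using closedin_zariski_zero_locus by (auto simp: closedin_subtopology)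
      moreover have "\<phi> ` V \<subseteq> zero_locus n {a} \<inter> Y"
        using a \<phi> \<phi>_affine by (auto simp: zero_locus_def vanishing_ideal_def)
      ultimately have "(subtopology (zariski n) Y) closure_of (\<phi> ` V) \<subseteq> zero_locus n {a} \<inter> Y"
        by (intro closure_of_minimal)
      then show ?thesis using dom by (auto simp: dominant_morphism_def zero_locus_def vanishing_ideal_def)
    qed
    then show ?thesis
      using vanishing_ideal_mono[of "\<phi> ` V" Y] \<phi> pullback_vanishing_iff[of V a] by blast
  qed
  then have "finite_normal_cover m n V Y \<phi> h G"
    using V_prime Y_prime integrally_closed_coord_ringD[OF YA Y_prime] Y
    by unfold_locales (auto simp: normal_variety_def)
  then show ?thesis by blast
qed

theorem proposition2:
  fixes V Y W Z :: "(nat \<Rightarrow> 'k::alg_closed_field) set"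
    and \<phi> :: "(nat \<Rightarrow> 'k) \<Rightarrow> nat \<Rightarrow> 'k"
    and m n :: nat
  assumes "affine_variety m V" and "affine_variety n Y"
    and "finite_morphism m V n Y \<phi>" and "dominant_morphism m V n Y \<phi>"
    and "normal_variety n Y"
    and "closedin (subtopology (zariski n) Y) W" and "irreducible_space (subtopology (zariski n) W)"
    and "irreducible_component (subtopology (zariski m) {x\<in>V. \<phi> x \<in> W}) Z"
  shows "\<phi> ` Z = W \<and> krull_dim (subtopology (zariski m) Z) = krull_dim (subtopology (zariski n) W)"
proof -
  obtain h G where "finite_normal_cover m n V Y \<phi> h G"
    using finite_normal_cover_exists[OF assms(1,3,4,5)] by blast
  then interpret finite_normal_cover m n V Y \<phi> h G .
  have W: "closedin (zariski n) W" "W \<subseteq> Y"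
    using assms(6) by (auto simp: closedin_closed_subtopology[OF Y_closed])
  have "is_prime_ideal (vanishing_ideal W)"
    using assms(7) irreducible_iff_prime[OF closedin_zariski_subset[OF W(1)]] by simp
  from irreducible_component_preimage[OF W this assms(8)]
  show ?thesis using krull_dim_image by simp
qed

end
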